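(* Let the data be as in the context and assume that Slater's constraint qualification holds: $$(\mathrm{int}\,\Sigma-\bm{\widetilde\sigma}(t))\cap\mathcal{V}\neq\varnothing\qquad\text{for all }t\in I.$$ Put $\mathcal{C}(t)=(\Sigma-\bm{\widetilde\sigma}(t))\cap\mathcal{V}$. Then: (i) The sets $\mathcal{C}(t)$ are closed, convex and nonempty for every $t\in I$, the map $t\mapsto\mathcal{C}(t)$ is Lipschitz-continuous on $I$ with respect to the Hausdorff distance in $\mathcal{H}_{\mathbf{C}^{-1}}$, and the sweeping process $$-\frac{d}{dt}\bm y\in N^{\mathbf{C}^{-1}}_{\mathcal{C}(t)}(\bm y),\qquad \bm y(0)=\bm\sigma_{\bf 0}-\bm{\widetilde\sigma}(0)\in\mathcal{C}(0),$$ has a unique solution $y\in W^{1,\infty}(I,\mathcal{H}_{\mathbf{C}^{-1}})$. (ii) For this $y$, the right-hand side of the differential inclusion $$\frac{d}{dt}\bm\varepsilon\in\mathbf{C}^{-1}\left(\left(N^{\mathbf{C}^{-1}}_{\Sigma-\bm{\widetilde\sigma}(t)}(\bm y)+\frac{d}{dt}\bm y\right)\cap\mathcal{U}+\frac{d}{dt}\bm{\widetilde\sigma}(t)\right)$$ is a nonempty set for a.a. $t\in I$. (iii) There exists at least one $\varepsilon\in W^{1,\infty}(I,\mathcal{H})$ which solves the differential inclusion in (ii) for a.a. $t\in I$ with the initial condition $\bm\varepsilon(0)=\bm\varepsilon_{\bf 0}\in\mathbf{C}^{-1}(\mathcal{U}+\bm{\widetilde\sigma}(0))$.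
   Context: All spaces are real and $I=[0,T]$ with $T>0$. For a function $h$ on $I$, $\bm h(t)$ denotes its value at $t$. Spaces and operators. $\mathcal{H}$ is a separable Hilbert space, $\mathcal{X}$ is a reflexive Banach space, $\mathcal{W}_0\subset\mathcal{X}$ is a linear (not necessarily closed) subspace, $\mathbf{E}:\mathcal{W}_0\subset\mathcal{X}\to\mathcal{H}$ is a linear operator which is closed (closed graph in $\mathcal X\times\mathcal H$) and has closed image. $\mathcal{X}_0=\overline{\mathcal{W}_0}$ (closure in $\mathcal{X}$). $\mathbf{D}:D(\mathbf{D})\subset\mathcal{H}\to\mathcal{X}_0^*$ is the adjoint, in the sense of unbounded operators, of $\mathbf{E}$ regarded as a densely defined operator from $\mathcal{X}_0$ to $\mathcal{H}$. $\mathbf{C}:\mathcal{H}\to\mathcal{H}$ is linear, bounded, symmetric, and coercive ($\langle\mathbf C\bm\tau,\bm\tau\rangle\ge c_0\|\bm\tau\|^2$ for some $c_0>0$). The loads are $g\in W^{1,\infty}(I,\mathcal{H})$ and $f\in W^{1,\infty}(I,\mathrm{Im}\,\mathbf{D})$. Weighted space. $\mathcal{H}_{\mathbf{C}^{-1}}$ is $\mathcal{H}$ with the inner product $\langle\bm\sigma,\bm\tau\rangle_{\mathbf{C}^{-1}}=\langle\bm\sigma,\mathbf{C}^{-1}\bm\tau\rangle_{\mathcal{H}}$. $\mathcal{U}=\mathrm{Im}(\mathbf{C}\mathbf{E})$ and $\mathcal{V}=\mathrm{Ker}\,\mathbf{D}$ are closed orthogonal complements of each other in $\mathcal{H}_{\mathbf{C}^{-1}}$;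 $P_{\mathcal V}$ is the orthogonal projection of $\mathcal{H}_{\mathbf{C}^{-1}}$ onto $\mathcal{V}$; $G=P_{\mathcal V}\mathbf{C}$; $Q:\mathrm{Im}\,\mathbf{D}\to\mathcal{U}$ is the (bounded) inverse of the bijection $\mathcal{U}\cap D(\mathbf{D})\to\mathrm{Im}\,\mathbf{D}$, $\bm\sigma\mapsto\mathbf{D}\bm\sigma$. The stress solution for elasticity is $\bm{\widetilde\sigma}(t)=G\bm g(t)+Q\bm f(t)$, which belongs to $W^{1,\infty}(I,\mathcal{H})$. $\Sigma\subset\mathcal{H}$ is a given bounded closed convex nonempty set. The initial data $\bm\sigma_{\bf 0},\bm\varepsilon_{\bf 0}\in\mathcal{H}$ satisfy $\bm\sigma_{\bf 0}-\bm{\widetilde\sigma}(0)\in\mathcal{C}(0)$ and $\bm\varepsilon_{\bf 0}\in\mathbf{C}^{-1}(\mathcal{U}+\bm{\widetilde\sigma}(0))$. For a closed convex nonempty $\mathcal{C}\subset\mathcal{H}_{\mathbf{C}^{-1}}$ and $\bm x\in\mathcal{C}$, $N^{\mathbf{C}^{-1}}_{\mathcal C}(\bm x)=\{\bm z\in\mathcal{H}_{\mathbf{C}^{-1}}:\langle\bm z,\bm c-\bm x\rangle_{\mathbf{C}^{-1}}\le0\ \forall\bm c\in\mathcal{C}\}$. A solution of the sweeping process is a function $y:I\to\mathcal{H}_{\mathbf{C}^{-1}}$ satisfying the initial condition, $\bm y(t)\in\mathcal{C}(t)$ for all $t\in I$, and such that $\frac{d}{dt}\bm y(t)$ exists and the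 inclusion holds for a.a. $t\in I$. *)

theory Defs
  imports "HOL-Analysis.Analysis"
begin

definition reflexive_banach :: "'a::banach itself \<Rightarrow> bool" where
  "reflexive_banach _ \<longleftrightarrow>
     (\<forall>\<Phi> :: ('a \<Rightarrow>\<^sub>L real) \<Rightarrow>\<^sub>L real.
        \<exists>x::'a. \<forall>l. blinfun_apply \<Phi> l = blinfun_apply l x)"

definition linear_on_subspace ::
    "'a::real_vector set \<Rightarrow> ('a \<Rightarrow> 'b::real_vector) \<Rightarrow> bool" where
  "linear_on_subspace S h \<longleftrightarrow>
     (\<forall>x\<in>S. \<forall>y\<in>S. h (x + y) = h x + h y) \<and> (\<forall>c. \<forall>x\<in>S. h (c *\<^sub>R x) = c *\<^sub>R h x)"

text \<open>
  The dual of a subspace \<open>S\<close> is not a type of its own, so its elements are functions on the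
  ambient type, made unique by \<^const>\<open>extensional\<close>. The values outside \<open>S\<close> carry no meaning;
  the linear operations of the dual are the pointwise ones on \<open>S\<close>.
\<close>

definition dual_space :: "'a::real_normed_vector set \<Rightarrow> ('a \<Rightarrow> real) set" where
  "dual_space S =
     {l \<in> extensional S. linear_on_subspace S l \<and> (\<exists>K. \<forall>x\<in>S. \<bar>l x\<bar> \<le> K * norm x)}"

definition dual_norm :: "'a::real_normed_vector set \<Rightarrow> ('a \<Rightarrow> real) \<Rightarrow> real" where
  "dual_norm S l = (SUP x\<in>{x\<in>S. norm x \<le> 1}. \<bar>l x\<bar>)"

definition dual_dist :: "'a::real_normed_vector set \<Rightarrow> ('a \<Rightarrow> real) \<Rightarrow> ('a \<Rightarrow> real) \<Rightarrow> real" where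
  "dual_dist S l m = dual_norm S (\<lambda>x. l x - m x)"


text \<open>
  The adjoint of an operator \<open>E\<close> with domain \<open>W0\<close>, dense in \<open>closure W0\<close>. Its values lie in
  the dual of \<open>closure W0\<close>; the functional in \<open>adj_op\<close> is unique by density.
\<close>

definition adj_dom ::
    "'x::real_normed_vector set \<Rightarrow> ('x \<Rightarrow> 'h::real_inner) \<Rightarrow> 'h set" where
  "adj_dom W0 E = {\<sigma>. \<exists>l\<in>dual_space (closure W0). \<forall>w\<in>W0. l w = \<sigma> \<bullet> E w}"

definition adj_op ::
    "'x::real_normed_vector set \<Rightarrow> ('x \<Rightarrow> 'h::real_inner) \<Rightarrow> 'h \<Rightarrow> ('x \<Rightarrow> real)" where
  "adj_op W0 E \<sigma> = (THE l. l \<in> dual_space (closure W0) \<and> (\<forall>w\<in>W0. l w = \<sigma> \<bullet> E w))"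

definition adj_ker ::
    "'x::real_normed_vector set \<Rightarrow> ('x \<Rightarrow> 'h::real_inner) \<Rightarrow> 'h set" where
  "adj_ker W0 E = {\<sigma> \<in> adj_dom W0 E. \<forall>x\<in>closure W0. adj_op W0 E \<sigma> x = 0}"

definition adj_im ::
    "'x::real_normed_vector set \<Rightarrow> ('x \<Rightarrow> 'h::real_inner) \<Rightarrow> ('x \<Rightarrow> real) set" where
  "adj_im W0 E = adj_op W0 E ` adj_dom W0 E"


text \<open>
  Bochner--Sobolev spaces \<open>W\<^sup>1\<^sup>,\<^sup>\<infinity>\<close> on \<open>[0,T]\<close>, by weak derivatives tested against \<open>C\<^sup>1\<close>
  functions with compact support in \<open>(0,T)\<close>. As point values are used, an element is always its
  continuous representative; in particular it is bounded on \<open>[0,T]\<close>.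
\<close>

definition test_fun :: "real \<Rightarrow> (real \<Rightarrow> real) \<Rightarrow> bool" where
  "test_fun T \<phi> \<longleftrightarrow> \<phi> C1_differentiable_on UNIV \<and> closure {t. \<phi> t \<noteq> 0} \<subseteq> {0<..<T}"

definition W1inf :: "real \<Rightarrow> (real \<Rightarrow> 'a::{banach,second_countable_topology}) \<Rightarrow> bool" where
  "W1inf T u \<longleftrightarrow> continuous_on {0..T} u \<and>
     (\<exists>v. v \<in> borel_measurable (lebesgue_on {0..T}) \<and>
          (\<exists>B. AE t in lebesgue_on {0..T}. norm (v t) \<le> B) \<and>
          (\<forall>\<phi>. test_fun T \<phi> \<longrightarrow>
             (\<integral>t. deriv \<phi> t *\<^sub>R u t \<partial>lebesgue_on {0..T}) =
               - (\<integral>t. \<phi> t *\<^sub>R v t \<partial>lebesgue_on {0..T})))"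

text \<open>
  The same space for functions with values in a subspace \<open>A\<close> of \<open>dual_space S\<close>. Measurability is
  Bochner's, by simple functions. The Bochner integrals in the weak derivative formula are
  evaluated at \<open>x \<in> S\<close>: evaluation commutes with the integral, and evaluations separate points.
\<close>

definition W1inf_dual ::
    "'x::real_normed_vector set \<Rightarrow> ('x \<Rightarrow> real) set \<Rightarrow> real \<Rightarrow> (real \<Rightarrow> 'x \<Rightarrow> real) \<Rightarrow> bool" where
  "W1inf_dual S A T u \<longleftrightarrow>
     (\<forall>t\<in>{0..T}. u t \<in> A) \<and>
     (\<forall>t\<in>{0..T}. ((\<lambda>s. dual_dist S (u s) (u t)) \<longlongrightarrow> 0) (at t within {0..T})) \<and>
     (\<exists>v. (\<forall>t\<in>{0..T}. v t \<in> A) \<and>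
          (\<exists>s. (\<forall>n::nat. simple_function (lebesgue_on {0..T}) (s n) \<and> s n ` {0..T} \<subseteq> A) \<and>
               (AE t in lebesgue_on {0..T}. (\<lambda>n. dual_dist S (s n t) (v t)) \<longlonglongrightarrow> 0)) \<and>
          (\<exists>B. AE t in lebesgue_on {0..T}. dual_norm S (v t) \<le> B) \<and>
          (\<forall>\<phi>. test_fun T \<phi> \<longrightarrow>
             (\<forall>x\<in>S. (\<integral>t. deriv \<phi> t * u t x \<partial>lebesgue_on {0..T}) =
                       - (\<integral>t. \<phi> t * v t x \<partial>lebesgue_on {0..T}))))"


text \<open>
  The weighted space with inner product \<open>\<langle>\<sigma>, C\<^sup>-\<^sup>1 \<tau>\<rangle>\<close> lives on the same type. For bounded, symmetric,
  coercive \<open>C\<close> its norm is equivalent to the original one, so closedness, derivatives and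
  \<^const>\<open>W1inf\<close> have the same meaning in both spaces and are expressed by the library notions for
  the original norm.
\<close>

definition inner_C :: "('h \<Rightarrow> 'h) \<Rightarrow> 'h::real_inner \<Rightarrow> 'h \<Rightarrow> real" where
  "inner_C C \<sigma> \<tau> = \<sigma> \<bullet> inv C \<tau>"

definition norm_C :: "('h \<Rightarrow> 'h) \<Rightarrow> 'h::real_inner \<Rightarrow> real" where
  "norm_C C \<sigma> = sqrt (inner_C C \<sigma> \<sigma>)"

definition proj_C :: "('h \<Rightarrow> 'h) \<Rightarrow> 'h::real_inner set \<Rightarrow> 'h \<Rightarrow> 'h" where
  "proj_C C V \<sigma> = (THE p. p \<in> V \<and> (\<forall>v\<in>V. inner_C C (\<sigma> - p) v = 0))"

definition infdist_C :: "('h \<Rightarrow> 'h) \<Rightarrow> 'h::real_inner \<Rightarrow> 'h set \<Rightarrow> real" where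
  "infdist_C C x A = (INF a\<in>A. norm_C C (x - a))"

text \<open>Meaningful for nonempty bounded sets only, the suprema being taken in the reals.\<close>

definition hausdorff_C :: "('h \<Rightarrow> 'h) \<Rightarrow> 'h::real_inner set \<Rightarrow> 'h set \<Rightarrow> real" where
  "hausdorff_C C A B = max (SUP a\<in>A. infdist_C C a B) (SUP b\<in>B. infdist_C C b A)"

definition normal_cone_C :: "('h \<Rightarrow> 'h) \<Rightarrow> 'h::real_inner set \<Rightarrow> 'h \<Rightarrow> 'h set" where
  "normal_cone_C C K x = {z. \<forall>c\<in>K. inner_C C z (c - x) \<le> 0}"


definition stress_range :: "'x set \<Rightarrow> ('x \<Rightarrow> 'h) \<Rightarrow> ('h \<Rightarrow> 'h) \<Rightarrow> 'h set" where
  "stress_range W0 E C = (\<lambda>w. C (E w)) ` W0"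

definition G_op ::
    "'x::real_normed_vector set \<Rightarrow> ('x \<Rightarrow> 'h::real_inner) \<Rightarrow> ('h \<Rightarrow> 'h) \<Rightarrow> 'h \<Rightarrow> 'h" where
  "G_op W0 E C \<tau> = proj_C C (adj_ker W0 E) (C \<tau>)"

definition Q_op ::
    "'x::real_normed_vector set \<Rightarrow> ('x \<Rightarrow> 'h::real_inner) \<Rightarrow> ('h \<Rightarrow> 'h) \<Rightarrow> ('x \<Rightarrow> real) \<Rightarrow> 'h" where
  "Q_op W0 E C = the_inv_into (stress_range W0 E C \<inter> adj_dom W0 E) (adj_op W0 E)"

definition elastic_stress ::
    "'x::real_normed_vector set \<Rightarrow> ('x \<Rightarrow> 'h::real_inner) \<Rightarrow> ('h \<Rightarrow> 'h) \<Rightarrow>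
     (real \<Rightarrow> 'h) \<Rightarrow> (real \<Rightarrow> 'x \<Rightarrow> real) \<Rightarrow> real \<Rightarrow> 'h" where
  "elastic_stress W0 E C g f t = G_op W0 E C (g t) + Q_op W0 E C (f t)"


definition sweeping_solution ::
    "('h \<Rightarrow> 'h) \<Rightarrow> real \<Rightarrow> (real \<Rightarrow> 'h::real_inner set) \<Rightarrow> 'h \<Rightarrow> (real \<Rightarrow> 'h) \<Rightarrow> bool" where
  "sweeping_solution C T K y0 y \<longleftrightarrow>
     y 0 = y0 \<and> (\<forall>t\<in>{0..T}. y t \<in> K t) \<and>
     (AE t in lebesgue_on {0..T}. \<exists>y'.
        (y has_vector_derivative y') (at t within {0..T}) \<and> - y' \<in> normal_cone_C C (K t) (y t))"

text \<open>
  \<open>strain_rates C K U y y' s'\<close> is \<open>C\<^sup>-\<^sup>1((N\<^sub>K(y) + y') \<inter> U + s')\<close>.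
\<close>

definition strain_rates ::
    "('h \<Rightarrow> 'h) \<Rightarrow> 'h::real_inner set \<Rightarrow> 'h set \<Rightarrow> 'h \<Rightarrow> 'h \<Rightarrow> 'h \<Rightarrow> 'h set" where
  "strain_rates C K U y y' s' =
     inv C ` ((\<lambda>z. z + s') ` (((\<lambda>n. n + y') ` normal_cone_C C K y) \<inter> U))"

end

theory Submission
  imports Defs
begin

text \<open>
  Write \<open>C = S\<^sup>2\<close> with \<open>S\<close> symmetric and invertible; \<open>S\<^sup>-\<^sup>1\<close> is an isometry of the weighted space onto the
  unweighted one, so the evolution can be solved in a plain Hilbert space. There \<open>\<C>(t) = V \<inter> A(t)\<close>, with \<open>A(t)\<close>
  a translate of \<open>\<Sigma>\<close>, and Slater's condition (uniform in \<open>t\<close> by compactness) bounds the distance to \<open>\<C>(t)\<close> of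
  points of \<open>V\<close> by a multiple of their distance to \<open>A(t)\<close>.

  The alternating projections \<open>y \<mapsto> P\<^sub>V (P\<^sub>A y)\<close> along dyadic time grids converge uniformly to the solution \<open>y\<close>.
  The vectors \<open>y - P\<^sub>A y\<close> are normal to \<open>A\<close>, of the size of the time step, and their \<open>V\<close>-component is minus the
  increment of \<open>y\<close>. Their partial sums have a weak limit \<open>p\<close>, which is Lipschitz; wherever both derivatives exist,
  \<open>p'\<close> is normal to \<open>A(t)\<close> at \<open>y(t)\<close> and \<open>p' + y' \<in> U\<close>. Hence \<open>p\<close> integrates a selection of the strain inclusion, and
  no sum rule for normal cones or measurable selection theorem is required.

  Lipschitz functions into a Hilbert space are differentiable almost everywhere because the energies of their dyadic
  interpolants increase to a finite limit, which controls the oscillation of difference quotients through the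
  Vitali covering lemma.
\<close>

section \<open>Hilbert space preliminaries\<close>

text \<open>The obstacle is part (iii): the rates may form a nonempty set at almost every t and
  still a bounded integrable selection has to be found. Recording the residual of the projection
  onto A(t) in every step, and summing these records before any limit is taken, replaces a choice
  made afterwards. The price is that the iterates need not lie in \<C>(t). Slater's condition pays
  it: with \<open>\<kappa> = D / r\<close> the distance to \<C>(t) contracts by the factor sqrt (1 -
  1/\<kappa>^2) in each step, against a drift of L times the step size, so it stays below M times
  the step size, where M solves M = rate * M + L. The same M bounds the normal vectors and all
  Lipschitz constants of the limits. For p only scalar products with fixed vectors are needed, so
  one generalized limit, used for all times at once, defines p(t) by Riesz representation. Normality
  survives as an inequality for increments of p with a slack quadratic in the time increment, and so
  passes to p' by division. The regularity hypotheses enter through Lipschitz bounds, and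
  \<open>W1inf\<close> of the results is recovered from such bounds.\<close>

lemma closed_convex_projection_ex:
  fixes A :: "'h::{real_inner,banach} set"
  assumes "closed A" "convex A" "A \<noteq> {}"
  shows "\<exists>a\<in>A. \<forall>b\<in>A. (x - a) \<bullet> (b - a) \<le> 0"
proof -
  define d where "d = infdist x A"
  have d: "d \<le> norm (x - b)" if "b \<in> A" for b
    using infdist_le[OF that, of x] by (simp add: d_def dist_norm)
  have d0: "0 \<le> d" by (simp add: d_def infdist_nonneg)
  have "\<exists>b\<in>A. norm (x - b) < d + 1 / real (Suc n)" for n
  proof -
    have "infdist x A < d + 1 / real (Suc n)" by (simp add: d_def)
    then have "\<exists>b\<in>A. dist x b < d + 1 / real (Suc n)"
      using cInf_lessD[of "dist x ` A"] \<open>A \<noteq> {}\<close> by (auto simp: infdist_notempty)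
    then show ?thesis by (simp add: dist_norm)
  qed
  then obtain b where bA: "\<And>n. b n \<in> A" and b: "\<And>n. norm (x - b n) < d + 1 / real (Suc n)"
    by metis
  have lim: "(\<lambda>n. norm (x - b n)) \<longlonglongrightarrow> d"
  proof (rule tendsto_sandwich[of "\<lambda>_. d" _ _ "\<lambda>n. d + 1 / real (Suc n)"])
    show "\<forall>\<^sub>F n in sequentially. norm (x - b n) \<le> d + 1 / real (Suc n)"
      using b by (simp add: less_imp_le)
    have "(\<lambda>n. d + 1 / real (Suc n)) \<longlonglongrightarrow> d + 0"
      by (intro tendsto_intros LIMSEQ_Suc[OF lim_1_over_n])
    then show "(\<lambda>n. d + 1 / real (Suc n)) \<longlonglongrightarrow> d" by simp
  qed (use d bA in auto)
  \<comment> \<open>Parallelogram law with the midpoint, which lies in \<open>A\<close> by convexity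
    and so has distance at least \<open>d\<close> from \<open>x\<close>.\<close>
  have par: "(norm (b m - b n))\<^sup>2 \<le> 2 * (norm (x - b m))\<^sup>2 + 2 * (norm (x - b n))\<^sup>2 - 4 * d\<^sup>2" for m n
  proof -
    have "(1/2) *\<^sub>R b m + (1/2) *\<^sub>R b n \<in> A"
      using convexD[OF \<open>convex A\<close> bA bA] by simp
    then have "d\<^sup>2 \<le> (norm (x - ((1/2) *\<^sub>R b m + (1/2) *\<^sub>R b n)))\<^sup>2"
      using d d0 by (intro power_mono)
    then show ?thesis
      by (simp add: power2_norm_eq_inner algebra_simps inner_commute)
  qed
  have "Cauchy b"
  proof (rule metric_CauchyI)
    fix e :: real assume e: "0 < e"
    have "(\<lambda>n. (norm (x - b n))\<^sup>2) \<longlonglongrightarrow> d\<^sup>2"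
      by (intro tendsto_intros lim)
    then have "\<forall>\<^sub>F n in sequentially. (norm (x - b n))\<^sup>2 < d\<^sup>2 + e\<^sup>2 / 4"
      using e by (intro order_tendstoD(2)) auto
    then obtain N where N: "\<And>n. n \<ge> N \<Longrightarrow> (norm (x - b n))\<^sup>2 < d\<^sup>2 + e\<^sup>2 / 4"
      by (auto simp: eventually_sequentially)
    show "\<exists>M. \<forall>m\<ge>M. \<forall>n\<ge>M. dist (b m) (b n) < e"
    proof (intro exI allI impI)
      fix m n assume "N \<le> m" "N \<le> n"
      then have "(norm (b m - b n))\<^sup>2 < e\<^sup>2" using par[of m n] N[of m] N[of n] by linarith
      then show "dist (b m) (b n) < e"
        using e by (simp add: dist_norm power2_less_imp_less)
    qed
  qed
  then obtain a where a: "b \<longlonglongrightarrow> a" using Cauchy_convergent convergent_def by blast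
  have aA: "a \<in> A" using closed_sequentially[OF \<open>closed A\<close>] bA a by blast
  have da: "norm (x - a) = d"
    using LIMSEQ_unique[OF lim] tendsto_norm[OF tendsto_diff[OF tendsto_const a]] by metis
  have "(x - a) \<bullet> (c - a) \<le> 0" if "c \<in> A" for c
  proof (rule ccontr)
    assume "\<not> ?thesis"
    then have pos: "(x - a) \<bullet> (c - a) > 0" by simp
    then have ca: "0 < (norm (c - a))\<^sup>2" by auto
    \<comment> \<open>The best step from \<open>a\<close> towards \<open>c\<close>, capped at 1 to
      stay on the segment.\<close>
    define t where "t = min 1 ((x - a) \<bullet> (c - a) / (norm (c - a))\<^sup>2)"
    have t: "0 < t" "t \<le> 1" using pos ca by (auto simp: t_def)
    have t2: "t * (norm (c - a))\<^sup>2 \<le> (x - a) \<bullet> (c - a)"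
      using ca by (simp add: t_def min_def field_simps split: if_splits)
    have "(1 - t) *\<^sub>R a + t *\<^sub>R c \<in> A"
      using convexD_alt[OF \<open>convex A\<close> aA that] t by simp
    then have "d\<^sup>2 \<le> (norm (x - ((1 - t) *\<^sub>R a + t *\<^sub>R c)))\<^sup>2"
      using d d0 by (intro power_mono)
    also have "x - ((1 - t) *\<^sub>R a + t *\<^sub>R c) = (x - a) - t *\<^sub>R (c - a)"
      by (simp add: algebra_simps)
    also have "(norm ((x - a) - t *\<^sub>R (c - a)))\<^sup>2
        = (norm (x - a))\<^sup>2 - 2 * t * ((x - a) \<bullet> (c - a)) + t\<^sup>2 * (norm (c - a))\<^sup>2"
      unfolding power2_norm_eq_inner by (simp add: algebra_simps inner_commute power2_eq_square)
    finally have "2 * t * ((x - a) \<bullet> (c - a)) \<le> t * (t * (norm (c - a))\<^sup>2)"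
      by (simp add: da power2_eq_square)
    also have "\<dots> \<le> t * ((x - a) \<bullet> (c - a))" using t t2 by (intro mult_left_mono) auto
    finally show False using t pos by simp
  qed
  then show ?thesis using aA by blast
qed

definition cproj :: "'h::real_inner set \<Rightarrow> 'h \<Rightarrow> 'h" where
  "cproj A x = (SOME a. a \<in> A \<and> (\<forall>b\<in>A. (x - a) \<bullet> (b - a) \<le> 0))"

lemma
  fixes A :: "'h::{real_inner,banach} set"
  assumes "closed A" "convex A" "A \<noteq> {}"
  shows cproj_in: "cproj A x \<in> A"
    and cproj_le: "b \<in> A \<Longrightarrow> (x - cproj A x) \<bullet> (b - cproj A x) \<le> 0"
proof -
  have "cproj A x \<in> A \<and> (\<forall>b\<in>A. (x - cproj A x) \<bullet> (b - cproj A x) \<le> 0)"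
    unfolding cproj_def by (rule someI_ex) (use closed_convex_projection_ex[OF assms, of x] in \<open>auto simp: Bex_def\<close>)
  then show "cproj A x \<in> A" "b \<in> A \<Longrightarrow> (x - cproj A x) \<bullet> (b - cproj A x) \<le> 0" by auto
qed

text \<open>The cosine formula, with the sign of the cross term from the variational inequality. The
  subtracted square drives the contraction of the alternating projections later on.\<close>

lemma cproj_dist_sq:
  fixes A :: "'h::{real_inner,banach} set"
  assumes "closed A" "convex A" "b \<in> A"
  shows "(norm (cproj A x - b))\<^sup>2 \<le> (norm (x - b))\<^sup>2 - (norm (x - cproj A x))\<^sup>2"
proof -
  let ?p = "cproj A x"
  have "(norm (?p - b))\<^sup>2 = (norm (x - b))\<^sup>2 - (norm (x - ?p))\<^sup>2 + 2 * ((x - ?p) \<bullet> (b - ?p))"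
    by (simp add: power2_norm_eq_inner inner_diff_left inner_diff_right inner_commute)
  moreover have "(x - cproj A x) \<bullet> (b - cproj A x) \<le> 0" by (rule cproj_le[OF assms(1,2) _ assms(3)]) (use assms(3) in auto)
  ultimately show ?thesis by (smt (verit))
qed

lemma cproj_nearest:
  fixes A :: "'h::{real_inner,banach} set"
  assumes "closed A" "convex A" "b \<in> A"
  shows "norm (x - cproj A x) \<le> norm (x - b)"
proof -
  have "(norm (x - cproj A x))\<^sup>2 \<le> (norm (x - b))\<^sup>2"
    using cproj_dist_sq[OF assms, of x] by (smt (verit) zero_le_power2)
  then show ?thesis by (rule power2_le_imp_le) simp
qed

lemma cproj_subspace_orth:
  fixes V :: "'h::{real_inner,banach} set"
  assumes "subspace V" "closed V" "v \<in> V"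
  shows "(x - cproj V x) \<bullet> v = 0"
proof -
  have ne: "V \<noteq> {}" using assms by blast
  have p: "cproj V x \<in> V" by (intro cproj_in assms subspace_imp_convex ne)
  have "(x - cproj V x) \<bullet> w \<le> 0" if "w \<in> V" for w
    using cproj_le[OF \<open>closed V\<close> subspace_imp_convex[OF \<open>subspace V\<close>] ne, of "cproj V x + w" x]
      subspace_add[OF \<open>subspace V\<close> p that] by simp
  from this[OF \<open>v \<in> V\<close>] this[OF subspace_neg[OF \<open>subspace V\<close> \<open>v \<in> V\<close>]] show ?thesis by simp
qed

lemma cproj_subspace_in:
  fixes V :: "'h::{real_inner,banach} set"
  assumes "subspace V" "closed V"
  shows "cproj V x \<in> V"
  using assms subspace_0[OF assms(1)] by (intro cproj_in subspace_imp_convex) auto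

text \<open>Double orthogonal complement: the residual \<open>x - cproj V x\<close> is orthogonal to
  \<open>x\<close> by assumption and to the projection by construction, hence to itself.\<close>

lemma biorthogonal_in_closed_subspace:
  fixes V :: "'h::{real_inner,banach} set"
  assumes "subspace V" "closed V" "\<And>z. (\<forall>v\<in>V. z \<bullet> v = 0) \<Longrightarrow> x \<bullet> z = 0"
  shows "x \<in> V"
proof -
  have "x \<bullet> (x - cproj V x) = 0"
    using assms cproj_subspace_orth[OF assms(1,2)] by blast
  moreover have "(x - cproj V x) \<bullet> cproj V x = 0"
    using cproj_subspace_orth[OF assms(1,2) cproj_subspace_in[OF assms(1,2)]] .
  ultimately have "(x - cproj V x) \<bullet> (x - cproj V x) = 0"
    by (simp add: inner_diff_right inner_commute)
  then show ?thesis using cproj_subspace_in[OF assms(1,2), of x] by simp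
qed

text \<open>Needed to turn generalized limits of scalar products into vectors. The representing
  vector is a multiple of the component, orthogonal to the kernel, of some \<open>x0\<close> outside
  the kernel.\<close>

lemma Riesz_representation:
  fixes l :: "'h::{real_inner,banach} \<Rightarrow> real"
  assumes "bounded_linear l"
  shows "\<exists>z. \<forall>x. l x = z \<bullet> x"
proof (cases "\<forall>x. l x = 0")
  case True
  then show ?thesis by (intro exI[of _ 0]) simp
next
  case False
  interpret l: bounded_linear l by fact
  obtain x0 where x0: "l x0 \<noteq> 0" using False by blast
  define N where "N = {x. l x = 0}"
  have N: "subspace N" unfolding subspace_def N_def by (auto simp: l.add l.scaleR)
  have "closed N" unfolding N_def by (intro closed_Collect_eq l.continuous_on continuous_intros)
  define e where "e = x0 - cproj N x0"
  have "cproj N x0 \<in> N" using cproj_subspace_in[OF N \<open>closed N\<close>] .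
  then have le: "l e = l x0" by (simp add: e_def l.diff N_def)
  have eo: "e \<bullet> v = 0" if "v \<in> N" for v
    unfolding e_def using cproj_subspace_orth[OF N \<open>closed N\<close> that] .
  have ee: "e \<bullet> e \<noteq> 0" using le x0 l.zero by auto
  have "l x = ((l e / (e \<bullet> e)) *\<^sub>R e) \<bullet> x" for x
  proof -
    have "x - (l x / l e) *\<^sub>R e \<in> N" using x0 le by (simp add: N_def l.diff l.scaleR)
    then have "e \<bullet> x = (l x / l e) * (e \<bullet> e)" using eo by (fastforce simp: inner_diff_right)
    then show ?thesis using ee x0 le by simp
  qed
  then show ?thesis by blast
qed

text \<open>A positive linear functional on bounded sequences extending the limit; it replaces
  extraction of weakly convergent subsequences.\<close>

lemma generalized_limit:
  obtains L :: "(nat \<Rightarrow> real) \<Rightarrow> real"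
  where "\<And>x y. Bseq x \<Longrightarrow> Bseq y \<Longrightarrow> L (\<lambda>n. x n + y n) = L x + L y"
    and "\<And>c x. Bseq x \<Longrightarrow> L (\<lambda>n. c * x n) = c * L x"
    and "\<And>x y l. Bseq x \<Longrightarrow> (\<And>n. x n \<le> y n) \<Longrightarrow> y \<longlonglongrightarrow> l \<Longrightarrow> L x \<le> l"
proof -
  define b :: "(nat \<Rightarrow> real) \<Rightarrow> real" where "b x = (if Bseq x then SOME K. \<forall>n. norm (x n) \<le> K else 0)" for x
  define e :: "nat \<Rightarrow> (nat \<Rightarrow> real) \<Rightarrow> real" where "e n x = (if Bseq x then x n else 0)" for n x
  \<comment> \<open>Tychonoff setting: all evaluations \<open>e n\<close>, set to 0 on unbounded
    sequences, lie in one product of compact intervals. The functional \<open>L\<close> will be a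
    cluster point of them.\<close>
  define S where "S = PiE UNIV (\<lambda>x. {- b x .. b x})"
  have b: "\<bar>x n\<bar> \<le> b x" if "Bseq x" for x n
  proof -
    have "\<exists>K. \<forall>n. norm (x n) \<le> K" using that by (auto simp: Bseq_def)
    from someI_ex[OF this] show ?thesis using that by (simp add: b_def)
  qed
  have eS: "e n \<in> S" for n
    unfolding S_def
  proof (rule PiE_I)
    fix x :: "nat \<Rightarrow> real"
    show "e n x \<in> {- b x .. b x}"
      using b[of x n] by (cases "Bseq x") (auto simp: e_def b_def abs_le_iff minus_le_iff)
  qed auto
  have "compact S"
    using compactin_PiE[of "\<lambda>_. euclideanreal" "UNIV :: (nat \<Rightarrow> real) set" "\<lambda>x. {- b x .. b x}"]
    by (simp add: S_def euclidean_product_topology)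
  then obtain L where L: "inf (nhds L) (filtermap e sequentially) \<noteq> bot"
    unfolding compact_filter using eS
    by (metis (mono_tags, lifting) always_eventually eventually_filtermap filtermap_bot_iff sequentially_bot)
  \<comment> \<open>Closed conditions shared by all evaluations are inherited by a cluster point.
    Additivity, homogeneity and order are such conditions, each involving finitely many
    coordinates.\<close>
  have closedL: "L \<in> X" if "closed X" "\<And>n. e n \<in> X" for X
  proof (rule ccontr)
    assume "L \<notin> X"
    then have "\<forall>\<^sub>F l in nhds L. l \<in> - X" using that by (intro eventually_nhds_in_open) auto
    moreover have "\<forall>\<^sub>F l in filtermap e sequentially. l \<in> X" using that by (simp add: eventually_filtermap)
    ultimately have "\<forall>\<^sub>F l in inf (nhds L) (filtermap e sequentially). False"
      unfolding eventually_inf by blast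
    then show False using L by (simp add: trivial_limit_def)
  qed
  \<comment> \<open>Convergence constrains the evaluations only eventually, so
    \<open>closedL\<close> does not apply; an open neighbourhood of \<open>L\<close> is used
    instead.\<close>
  have limL: "L y \<le> l" if "y \<longlonglongrightarrow> l" for y l
  proof (rule field_le_epsilon, rule ccontr)
    fix \<epsilon> :: real assume \<epsilon>: "\<epsilon> > 0" and "\<not> L y \<le> l + \<epsilon>"
    then have Ly: "l + \<epsilon> < L y" by simp
    have By: "Bseq y" using that convergentI convergent_imp_Bseq by blast
    have "open {f :: (nat \<Rightarrow> real) \<Rightarrow> real. l + \<epsilon> < f y}"
      by (intro open_Collect_less continuous_intros continuous_on_product_coordinates)
    then have "\<forall>\<^sub>F f in nhds L. f \<in> {f. l + \<epsilon> < f y}"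
      using Ly by (intro eventually_nhds_in_open) auto
    moreover have "\<forall>\<^sub>F f in filtermap e sequentially. f y < l + \<epsilon>"
      using order_tendstoD(2)[OF that, of "l + \<epsilon>"] \<epsilon> By by (simp add: eventually_filtermap e_def)
    ultimately have "\<forall>\<^sub>F l in inf (nhds L) (filtermap e sequentially). False"
      unfolding eventually_inf
      by (intro exI[of _ "\<lambda>f. f \<in> {f. l + \<epsilon> < f y}"] exI[of _ "\<lambda>f. f y < l + \<epsilon>"]) auto
    then show False using L by (simp add: trivial_limit_def)
  qed
  note cont = continuous_on_product_coordinates
  have "L (\<lambda>n. x n + y n) = L x + L y" if "Bseq x" "Bseq y" for x y
  proof -
    obtain K K' where "\<And>n. norm (x n) \<le> K" "\<And>n. norm (y n) \<le> K'" using \<open>Bseq x\<close> \<open>Bseq y\<close> by (auto simp: Bseq_def)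
    then have "Bseq (\<lambda>n. x n + y n)" by (intro BseqI'[of _ "K + K'"] norm_triangle_mono)
    then have "L \<in> {f. f (\<lambda>n. x n + y n) = f x + f y}"
      by (intro closedL closed_Collect_eq continuous_intros cont) (use that in \<open>auto simp: e_def\<close>)
    then show ?thesis by simp
  qed
  moreover have "L (\<lambda>n. c * x n) = c * L x" if "Bseq x" for c x
  proof -
    have "L \<in> {f. f (\<lambda>n. c * x n) = c * f x}"
      by (rule closedL, intro closed_Collect_eq continuous_intros cont)
        (use that Bseq_mult[OF Bfun_const that, of c] in \<open>auto simp: e_def\<close>)
    then show ?thesis by simp
  qed
  moreover have "L x \<le> l" if "Bseq x" "\<And>n. x n \<le> y n" "y \<longlonglongrightarrow> l" for x y l
  proof -
    have "Bseq y" using that convergentI convergent_imp_Bseq by blast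
    then have "L \<in> {f. f x \<le> f y}"
      by (intro closedL closed_Collect_le cont) (use that in \<open>auto simp: e_def\<close>)
    then show ?thesis using limL[OF that(3)] by simp
  qed
  ultimately show thesis by (rule that)
qed

section \<open>Uniform boundedness\<close>

lemma Cauchy_tail_bound:
  fixes x :: "nat \<Rightarrow> 'a::real_normed_vector"
  assumes tail: "\<And>m n. n \<le> m \<Longrightarrow> norm (x m - x n) \<le> e n" and "e \<longlonglongrightarrow> 0"
  shows "Cauchy x"
proof (rule metric_CauchyI)
  fix \<epsilon> :: real assume "0 < \<epsilon>"
  then have "\<forall>\<^sub>F n in sequentially. e n < \<epsilon> / 2"
    using order_tendstoD(2)[OF assms(2), of "\<epsilon> / 2"] by simp
  then obtain N where N: "e N < \<epsilon> / 2" by (auto simp: eventually_sequentially)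
  have "dist (x m) (x n) < \<epsilon>" if "m \<ge> N" "n \<ge> N" for m n
    using dist_triangle2[of "x m" "x n" "x N"] tail[OF that(1)] tail[OF that(2)] N by (simp add: dist_norm)
  then show "\<exists>M. \<forall>m\<ge>M. \<forall>n\<ge>M. dist (x m) (x n) < \<epsilon>" by blast
qed

text \<open>A gliding hump: if the norms exceed \<open>4 ^ n\<close> along a sequence, a series with
  terms of norm \<open>(1/3)^n\<close> in those directions converges to some \<open>z\<close> in
  \<open>R\<close>, and the pairings with \<open>z\<close> grow at least like
  \<open>(4/3)^n\<close>.\<close>

lemma uniform_boundedness_inner:
  fixes \<T> R :: "'h::{real_inner,banach} set"
  assumes R: "subspace R" "closed R" and \<T>: "\<T> \<subseteq> R"
    and bd: "\<And>h. h \<in> R \<Longrightarrow> \<exists>K. \<forall>e\<in>\<T>. \<bar>e \<bullet> h\<bar> \<le> K"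
  shows "bounded \<T>"
proof (rule ccontr)
  assume "\<not> bounded \<T>"
  then have "\<exists>e\<in>\<T>. norm e > 4 ^ n" for n
    by (metis boundedI not_le_imp_less)
  then obtain e where e\<T>: "\<And>n. e n \<in> \<T>" and en: "\<And>n. norm (e n) > 4 ^ n" by metis
  have en0: "norm (e n) > 0" for n using en[of n] by (smt (verit) zero_less_power)
  \<comment> \<open>The sign is chosen so that the new term adds to the pairing of
    \<open>e n\<close> with the partial sum instead of cancelling it.\<close>
  define sg :: "'h \<Rightarrow> nat \<Rightarrow> real" where "sg x n = (if e n \<bullet> x \<ge> 0 then 1 else -1)" for x n
  define x where "x = rec_nat 0 (\<lambda>n x. x + (sg x n * (1/3)^n / norm (e n)) *\<^sub>R e n)"
  have xS: "x (Suc n) = x n + (sg (x n) n * (1/3)^n / norm (e n)) *\<^sub>R e n" for n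
    by (simp add: x_def)
  have xR: "x n \<in> R" for n
  proof (induction n)
    case 0
    then show ?case using R by (simp add: x_def subspace_0)
  next
    case (Suc n)
    then show ?case unfolding xS using e\<T> \<T> R by (intro subspace_add subspace_scale) auto
  qed
  have step: "norm (x (Suc n) - x n) \<le> (1/3)^n" for n
    using en0[of n] by (simp add: xS sg_def abs_mult)
  have big: "\<bar>e n \<bullet> x (Suc n)\<bar> \<ge> (1/3)^n * norm (e n)" for n
  proof -
    have "e n \<bullet> x (Suc n) = e n \<bullet> x n + sg (x n) n * ((1/3)^n * norm (e n))"
      using en0[of n] by (simp add: xS inner_add_right dot_square_norm power2_eq_square)
    then show ?thesis by (cases "e n \<bullet> x n \<ge> 0") (auto simp: sg_def)
  qed
  have tail: "norm (x (n + k) - x n) \<le> (3/2) * (1/3)^n - (3/2) * (1/3)^(n+k)" for n k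
  proof (induction k)
    case (Suc k)
    have "norm (x (n + Suc k) - x n) \<le> norm (x (Suc (n + k)) - x (n + k)) + norm (x (n + k) - x n)"
      using norm_triangle_ineq[of "x (Suc (n + k)) - x (n + k)" "x (n + k) - x n"] by simp
    then show ?case using step[of "n + k"] Suc by simp
  qed simp
  have tail': "norm (x m - x n) \<le> (3/2) * (1/3)^n" if "n \<le> m" for m n
  proof -
    have "0 \<le> (3/2) * (1/3::real)^m" by simp
    moreover have "norm (x m - x n) \<le> (3/2) * (1/3)^n - (3/2) * (1/3)^m" using tail[of n "m - n"] that by simp
    ultimately show ?thesis by linarith
  qed
  have lim0: "(\<lambda>n. (3/2) * (1/3::real)^n) \<longlonglongrightarrow> 0"
    by (intro tendsto_mult_right_zero LIMSEQ_power_zero) simp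
  have "Cauchy x" by (rule Cauchy_tail_bound[OF tail' lim0])
  then obtain z where z: "x \<longlonglongrightarrow> z" using Cauchy_convergent convergent_def by blast
  then have zR: "z \<in> R" using closed_sequentially[OF R(2)] xR by blast
  then obtain K where K: "\<And>n. \<bar>e n \<bullet> z\<bar> \<le> K" using bd e\<T> by metis
  \<comment> \<open>The terms after the n-th sum to at most \<open>(3/2) * (1/3)^Suc n\<close>, half
    of the hump, so the other half survives in the limit.\<close>
  have lower: "(1/2) * (1/3)^n * norm (e n) \<le> \<bar>e n \<bullet> z\<bar>" for n
  proof -
    have "norm (z - x (Suc n)) \<le> (3/2) * (1/3)^Suc n"
    proof (rule Lim_bounded)
      show "(\<lambda>m. norm (x m - x (Suc n))) \<longlonglongrightarrow> norm (z - x (Suc n))" by (intro tendsto_intros z)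
      show "\<forall>m\<ge>Suc n. norm (x m - x (Suc n)) \<le> (3/2) * (1/3)^Suc n" using tail' by blast
    qed
    then have "norm (e n) * norm (z - x (Suc n)) \<le> norm (e n) * ((1/2) * (1/3)^n)"
      by (intro mult_left_mono) auto
    then have "\<bar>e n \<bullet> (z - x (Suc n))\<bar> \<le> (1/2) * (1/3)^n * norm (e n)"
      using Cauchy_Schwarz_ineq2[of "e n" "z - x (Suc n)"] by (simp add: mult.commute)
    then have "\<bar>e n \<bullet> z - e n \<bullet> x (Suc n)\<bar> \<le> (1/2) * ((1/3)^n * norm (e n))"
      by (simp add: inner_diff_right)
    then show ?thesis using big[of n] by arith
  qed
  have "(1/2) * (4/3)^n \<le> K" for n :: nat
  proof -
    have "(1/2) * (1/3)^n * 4^n \<le> (1/2) * (1/3)^n * norm (e n)"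
      using en[of n] by (intro mult_left_mono) auto
    moreover have "(1/3::real)^n * 4^n = (4/3)^n" by (simp add: power_mult_distrib[symmetric])
    ultimately show ?thesis using lower[of n] K[of n] by (simp add: mult.assoc)
  qed
  note fin = this
  obtain n where "2 * K < (4/3)^n" using real_arch_pow[of "4/3" "2 * K"] by auto
  with fin[of n] show False by linarith
qed

text \<open>The square root is \<open>\<rho>\<^sup>-\<^sup>1\<^sup>/\<^sup>2 (I - Y)\<close>, where \<open>Y\<close> solves the contractive fixed point equation
  \<open>Y = ((I - \<rho> C) + Y\<^sup>2) / 2\<close> for a small \<open>\<rho>\<close>.\<close>

lemma coercive_square_root:
  fixes C :: "'h::{real_inner,banach} \<Rightarrow> 'h"
  assumes lin: "bounded_linear C" and sym: "\<And>x y. C x \<bullet> y = x \<bullet> C y"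
    and c0: "c0 > 0" and coer: "\<And>x. C x \<bullet> x \<ge> c0 * (norm x)\<^sup>2"
  shows "\<exists>S. bounded_linear S \<and> (\<forall>x y. S x \<bullet> y = x \<bullet> S y) \<and> (\<forall>x. S (S x) = C x) \<and> surj S"
proof -
  interpret C: bounded_linear C by fact
  obtain M where M: "M > 0" "\<And>x. norm (C x) \<le> norm x * M" using C.pos_bounded by blast
  \<comment> \<open>Enlarging the bound gives \<open>c0 < M'\<close>, which makes the radicand of
    \<open>q\<close> below positive.\<close>
  define M' where "M' = max M (2 * c0)"
  have M': "M' > 0" "\<And>x. norm (C x) \<le> M' * norm x" "c0 < M'"
  proof -
    show "norm (C x) \<le> M' * norm x" for x
    proof -
      have "norm x * M \<le> norm x * M'" by (intro mult_left_mono) (auto simp: M'_def)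
      then show ?thesis using M(2)[of x] by (simp add: mult.commute)
    qed
  qed (use M c0 in \<open>auto simp: M'_def\<close>)
  \<comment> \<open>The minimiser of
    \<open>1 - 2 * \<rho> * c0 + \<rho>\<^sup>2 * M'\<^sup>2\<close>, which bounds the squared norm
    of \<open>I - \<rho> C\<close>; the minimum is \<open>q\<^sup>2\<close>.\<close>
  define \<rho> where "\<rho> = c0 / M'\<^sup>2"
  have \<rho>: "\<rho> > 0" using c0 M' by (simp add: \<rho>_def)
  define q where "q = sqrt (1 - c0\<^sup>2 / M'\<^sup>2)"
  have cM: "0 < c0\<^sup>2 / M'\<^sup>2" "c0\<^sup>2 / M'\<^sup>2 < 1" using c0 M' by (auto simp: power_strict_mono)
  have q: "0 \<le> q" "q < 1" "q\<^sup>2 = 1 - c0\<^sup>2 / M'\<^sup>2" using cM by (auto simp: q_def)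
  have contr: "norm (x - \<rho> *\<^sub>R C x) \<le> q * norm x" for x
  proof (rule power2_le_imp_le)
    have "(norm (x - \<rho> *\<^sub>R C x))\<^sup>2 = (norm x)\<^sup>2 - 2 * \<rho> * (C x \<bullet> x) + \<rho>\<^sup>2 * (norm (C x))\<^sup>2"
      unfolding power2_norm_eq_inner by (simp add: algebra_simps inner_commute power2_eq_square)
    also have "\<dots> \<le> (norm x)\<^sup>2 - 2 * \<rho> * (c0 * (norm x)\<^sup>2) + \<rho>\<^sup>2 * (M' * norm x)\<^sup>2"
      using coer[of x] M'(2)[of x] \<rho> by (intro add_mono diff_mono mult_left_mono power_mono) auto
    also have "\<dots> = (1 - 2 * \<rho> * c0 + \<rho>\<^sup>2 * M'\<^sup>2) * (norm x)\<^sup>2"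
      by (simp add: power_mult_distrib algebra_simps)
    also have "1 - 2 * \<rho> * c0 + \<rho>\<^sup>2 * M'\<^sup>2 = q\<^sup>2"
      unfolding q(3) using M' by (simp add: \<rho>_def field_simps power2_eq_square)
    also have "q\<^sup>2 * (norm x)\<^sup>2 = (q * norm x)\<^sup>2" by (simp add: power_mult_distrib)
    finally show "(norm (x - \<rho> *\<^sub>R C x))\<^sup>2 \<le> (q * norm x)\<^sup>2" .
  qed (use q in simp)
  define R where "R = Blinfun (\<lambda>x. x - \<rho> *\<^sub>R C x)"
  have R: "blinfun_apply R x = x - \<rho> *\<^sub>R C x" for x
    unfolding R_def by (subst bounded_linear_Blinfun_apply) (intro bounded_linear_intros lin, simp)
  have nR: "norm R \<le> q" by (rule norm_blinfun_bound) (use q contr R in auto)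
  \<comment> \<open>The ball of radius \<open>q\<close> is invariant since
    \<open>(q + q * q) / 2 \<le> q\<close>, and there \<open>\<Phi>\<close> has Lipschitz constant
    \<open>q\<close>. Symmetry is made part of the set because it is preserved by
    \<open>\<Phi>\<close> and by limits.\<close>
  define \<Y> :: "('h \<Rightarrow>\<^sub>L 'h) set" where "\<Y> = cball 0 q \<inter> {Y. \<forall>x y. blinfun_apply Y x \<bullet> y = x \<bullet> blinfun_apply Y y}"
  define \<Phi> where "\<Phi> Y = (1/2) *\<^sub>R (R + (Y o\<^sub>L Y))" for Y
  have "closed \<Y>"
    unfolding \<Y>_def by (intro closed_Int closed_cball closed_Collect_all closed_Collect_eq continuous_intros)
  then have "complete \<Y>" by (simp add: complete_eq_closed)
  moreover have "0 \<in> \<Y>" using q by (simp add: \<Y>_def)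
  then have "\<Y> \<noteq> {}" by blast
  moreover have "\<Phi> ` \<Y> \<subseteq> \<Y>"
  proof (rule image_subsetI)
    fix Y assume Y: "Y \<in> \<Y>"
    have "norm (Y o\<^sub>L Y) \<le> q * q"
      using Y q by (intro order_trans[OF norm_blinfun_compose] mult_mono) (auto simp: \<Y>_def)
    also have "\<dots> \<le> q" using q by (simp add: mult_left_le)
    finally have "norm (R + (Y o\<^sub>L Y)) \<le> q + q" using nR by (intro norm_triangle_mono)
    then have "norm (\<Phi> Y) \<le> q" by (simp add: \<Phi>_def)
    moreover have "blinfun_apply (\<Phi> Y) x \<bullet> y = x \<bullet> blinfun_apply (\<Phi> Y) y" for x y
      using Y by (simp add: \<Phi>_def \<Y>_def blinfun.bilinear_simps R algebra_simps sym)
    ultimately show "\<Phi> Y \<in> \<Y>" by (simp add: \<Y>_def)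
  qed
  moreover have "dist (\<Phi> Y) (\<Phi> Z) \<le> q * dist Y Z" if "Y \<in> \<Y>" "Z \<in> \<Y>" for Y Z
  proof -
    \<comment> \<open>A factorisation of the difference of squares in which \<open>Y\<close> and
      \<open>Z\<close> may fail to commute.\<close>
    have "\<Phi> Y - \<Phi> Z = (1/2) *\<^sub>R ((Y o\<^sub>L (Y - Z)) + ((Y - Z) o\<^sub>L Z))"
      by (rule blinfun_eqI) (simp add: \<Phi>_def blinfun.bilinear_simps algebra_simps)
    moreover have "norm ((Y o\<^sub>L (Y - Z)) + ((Y - Z) o\<^sub>L Z)) \<le> q * norm (Y - Z) + norm (Y - Z) * q"
      using that by (intro norm_triangle_mono order_trans[OF norm_blinfun_compose] mult_mono)
        (use q in \<open>auto simp: \<Y>_def\<close>)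
    ultimately show ?thesis by (simp add: dist_norm mult.commute)
  qed
  ultimately obtain Y where Y: "Y \<in> \<Y>" "\<Phi> Y = Y"
    using Banach_fix[of \<Y> q \<Phi>] q by blast
  define X where "X x = x - blinfun_apply Y x" for x
  have Xlin: "bounded_linear X"
    unfolding X_def by (intro bounded_linear_intros)
  have YY: "2 *\<^sub>R blinfun_apply Y x = (x - \<rho> *\<^sub>R C x) + blinfun_apply Y (blinfun_apply Y x)" for x
  proof -
    have "blinfun_apply Y x = blinfun_apply (\<Phi> Y) x" using Y by simp
    then have "2 *\<^sub>R blinfun_apply Y x = 2 *\<^sub>R blinfun_apply (\<Phi> Y) x" by simp
    then show ?thesis by (simp add: \<Phi>_def blinfun.bilinear_simps R)
  qed
  have XX: "X (X x) = \<rho> *\<^sub>R C x" for x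
    using YY[of x] by (simp add: X_def blinfun.bilinear_simps scaleR_2 algebra_simps)
  have Xsym: "X x \<bullet> y = x \<bullet> X y" for x y
    using Y by (simp add: X_def \<Y>_def inner_diff_left inner_diff_right)
  \<comment> \<open>\<open>I - Y\<close> is onto because the norm of \<open>Y\<close> is at most
    \<open>q < 1\<close>: a solution of \<open>x = b + Y x\<close> is the fixed point of a
    contraction.\<close>
  have Xsurj: "\<exists>x. X x = b" for b
  proof -
    have "\<forall>x y. dist (b + blinfun_apply Y x) (b + blinfun_apply Y y) \<le> q * dist x y"
    proof (intro allI)
      fix x y
      have "norm (blinfun_apply Y (x - y)) \<le> norm Y * norm (x - y)" by (rule norm_blinfun)
      also have "\<dots> \<le> q * norm (x - y)" using Y by (intro mult_right_mono) (auto simp: \<Y>_def)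
      finally show "dist (b + blinfun_apply Y x) (b + blinfun_apply Y y) \<le> q * dist x y"
        by (simp add: dist_norm blinfun.diff_right)
    qed
    from banach_fix_type[OF q(1,2) this] obtain x where "b + blinfun_apply Y x = x" by blast
    then show ?thesis by (intro exI[of _ x]) (simp add: X_def algebra_simps)
  qed
  interpret X: bounded_linear X by fact
  let ?S = "\<lambda>x. (1 / sqrt \<rho>) *\<^sub>R X x"
  have "?S (?S x) = C x" for x using \<rho> by (simp add: X.scaleR XX)
  moreover have "\<exists>x. b = ?S x" for b
  proof -
    obtain x where "X x = sqrt \<rho> *\<^sub>R b" using Xsurj by blast
    then show ?thesis using \<rho> by (intro exI[of _ x]) simp
  qed
  then have "surj ?S" by (simp add: surj_def)
  moreover have "bounded_linear ?S" by (intro bounded_linear_intros Xlin)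
  ultimately show ?thesis using Xsym by (intro exI[of _ ?S]) simp
qed

section \<open>Almost everywhere differentiability of Lipschitz functions\<close>

text \<open>The open intervals between the values of \<open>G\<close> at the endpoints are disjoint
  subsets of \<open>{G c..G d}\<close>, so additivity of Lebesgue measure replaces an ordering of
  the given intervals.\<close>

lemma mono_on_sum_disjoint_increments:
  fixes G :: "real \<Rightarrow> real" and l r :: "'i \<Rightarrow> real"
  assumes G: "mono_on {c..d} G" and "finite I" "c \<le> d"
    and I: "\<And>i. i \<in> I \<Longrightarrow> c \<le> l i \<and> l i < r i \<and> r i \<le> d"
    and disj: "pairwise (\<lambda>i j. disjnt {l i..r i} {l j..r j}) I"
  shows "(\<Sum>i\<in>I. G (r i) - G (l i)) \<le> G d - G c"
proof -
  let ?J = "\<lambda>i. {G (l i)<..<G (r i)}"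
  have mono: "G x \<le> G y" if "c \<le> x" "x \<le> y" "y \<le> d" for x y
    using mono_onD[OF G, of x y] that by auto
  have dj: "disjoint_family_on ?J I"
    unfolding disjoint_family_on_def
  proof (intro ballI impI)
    fix i j assume ij: "i \<in> I" "j \<in> I" "i \<noteq> j"
    then have "disjnt {l i..r i} {l j..r j}" using disj by (auto simp: pairwise_def)
    then have "r i < l j \<or> r j < l i"
      using I[OF ij(1)] I[OF ij(2)] by (auto simp: disjnt_def)
    then have "G (r i) \<le> G (l j) \<or> G (r j) \<le> G (l i)"
      using mono I[OF ij(1)] I[OF ij(2)] by (meson less_imp_le order_trans)
    then show "?J i \<inter> ?J j = {}" by auto
  qed
  have em: "emeasure lborel (?J i) \<noteq> \<infinity>" for i
    by (cases "G (l i) \<le> G (r i)") auto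
  have "(\<Sum>i\<in>I. G (r i) - G (l i)) = (\<Sum>i\<in>I. measure lborel (?J i))"
  proof (rule sum.cong)
    fix i assume "i \<in> I"
    then have "G (l i) \<le> G (r i)" using mono I[of i] by (meson less_imp_le order_trans)
    then show "G (r i) - G (l i) = measure lborel (?J i)" by simp
  qed simp
  also have "\<dots> = measure lborel (\<Union>i\<in>I. ?J i)"
    using dj \<open>finite I\<close> em by (intro measure_finite_Union[symmetric]) auto
  also have "\<dots> \<le> measure lborel {G c..G d}"
  proof (rule measure_mono_fmeasurable)
    show "(\<Union>i\<in>I. ?J i) \<subseteq> {G c..G d}"
    proof (intro UN_least subsetI)
      fix i x assume "i \<in> I" "x \<in> ?J i"
      moreover have "G c \<le> G (l i)" "G (r i) \<le> G d" using mono I[OF \<open>i \<in> I\<close>] by auto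
      ultimately show "x \<in> {G c..G d}" by auto
    qed
  qed (auto simp: \<open>finite I\<close> intro: fmeasurable_compact)
  also have "\<dots> = G d - G c" using mono[of c d] \<open>c \<le> d\<close> by simp
  finally show ?thesis .
qed

text \<open>A weak-type estimate. Each point of \<open>S\<close> is an endpoint of an interval on
  which \<open>G\<close> grows by more than \<open>\<mu>\<close> times the length; the Vitali lemma
  selects disjoint ones whose fivefold enlargements still cover \<open>S\<close>, which is the
  origin of the 5.\<close>

lemma mono_steep_set_measure:
  fixes G :: "real \<Rightarrow> real"
  assumes G: "mono_on {c..d} G" and "c \<le> d" "\<mu> > 0"
    and S: "\<And>x. x \<in> S \<Longrightarrow> \<exists>y\<in>{c..d}. x \<in> {c..d} \<and> y \<noteq> x \<and> \<mu> * \<bar>y - x\<bar> < \<bar>G y - G x\<bar>"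
  shows "\<exists>U. S \<subseteq> U \<and> U \<in> lmeasurable \<and> measure lebesgue U \<le> 5 * (G d - G c) / \<mu>"
proof -
  define K where "K = {(l, r). c \<le> l \<and> l < r \<and> r \<le> d \<and> \<mu> * (r - l) < G r - G l}"
  define a where "a = (\<lambda>(l::real, r). (l + r) / 2)"
  define \<rho> where "\<rho> = (\<lambda>(l::real, r). (r - l) / 2)"
  have cb: "cball (a i) (\<rho> i) = {fst i..snd i}" for i
    by (cases i) (auto simp: a_def \<rho>_def cball_eq_atLeastAtMost field_simps)
  have mono: "G x \<le> G y" if "c \<le> x" "x \<le> y" "y \<le> d" for x y
    using mono_onD[OF G, of x y] that by auto
  have cov: "S \<subseteq> (\<Union>i\<in>K. cball (a i) (\<rho> i))"
  proof
    fix x assume "x \<in> S"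
    then obtain y where y: "y \<in> {c..d}" "x \<in> {c..d}" "y \<noteq> x" "\<mu> * \<bar>y - x\<bar> < \<bar>G y - G x\<bar>" using S by blast
    show "x \<in> (\<Union>i\<in>K. cball (a i) (\<rho> i))"
    proof (cases "x < y")
      case True
      then have "(x, y) \<in> K" using y mono[of x y] by (auto simp: K_def)
      moreover have "x \<in> cball (a (x, y)) (\<rho> (x, y))" using True by (simp add: cb)
      ultimately show ?thesis by blast
    next
      case False
      then have "(y, x) \<in> K" using y mono[of y x] by (auto simp: K_def)
      moreover have "x \<in> cball (a (y, x)) (\<rho> (y, x))" using False by (simp add: cb)
      ultimately show ?thesis by blast
    qed
  qed
  have rb: "0 < \<rho> i \<and> \<rho> i \<le> d - c" if "i \<in> K" for i
    using that by (auto simp: K_def \<rho>_def)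
  obtain C where C: "countable C" "C \<subseteq> K"
    "pairwise (\<lambda>i j. disjnt (cball (a i) (\<rho> i)) (cball (a j) (\<rho> j))) C"
    "S \<subseteq> (\<Union>i\<in>C. cball (a i) (5 * \<rho> i))"
    by (rule Vitali_covering_lemma_cballs[OF cov rb])
  have fin: "(\<Sum>i\<in>I. measure lebesgue (cball (a i) (5 * \<rho> i))) \<le> 5 * (G d - G c) / \<mu>"
    if "I \<subseteq> C" "finite I" for I
  proof -
    have "(\<Sum>i\<in>I. measure lebesgue (cball (a i) (5 * \<rho> i))) = (\<Sum>i\<in>I. 5 * (snd i - fst i))"
    proof (rule sum.cong)
      fix i assume "i \<in> I"
      then have "0 < \<rho> i" using rb that C by blast
      moreover have "\<rho> i = (snd i - fst i) / 2" by (cases i) (simp add: \<rho>_def)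
      ultimately show "measure lebesgue (cball (a i) (5 * \<rho> i)) = 5 * (snd i - fst i)"
        by (simp add: cball_eq_atLeastAtMost)
    qed simp
    also have "\<dots> \<le> (\<Sum>i\<in>I. 5 / \<mu> * (G (snd i) - G (fst i)))"
    proof (rule sum_mono)
      fix i assume "i \<in> I"
      then have "i \<in> K" using that C by blast
      then have "\<mu> * (snd i - fst i) \<le> G (snd i) - G (fst i)" by (auto simp: K_def)
      then show "5 * (snd i - fst i) \<le> 5 / \<mu> * (G (snd i) - G (fst i))"
        using \<open>\<mu> > 0\<close> by (simp add: field_simps)
    qed
    also have "\<dots> = 5 / \<mu> * (\<Sum>i\<in>I. G (snd i) - G (fst i))" by (simp add: sum_distrib_left)
    also have "\<dots> \<le> 5 / \<mu> * (G d - G c)"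
    proof (intro mult_left_mono mono_on_sum_disjoint_increments[OF G \<open>finite I\<close> \<open>c \<le> d\<close>])
      show "c \<le> fst i \<and> fst i < snd i \<and> snd i \<le> d" if "i \<in> I" for i
        using that \<open>I \<subseteq> C\<close> C by (auto simp: K_def)
      show "pairwise (\<lambda>i j. disjnt {fst i..snd i} {fst j..snd j}) I"
        using pairwise_subset[OF C(3) \<open>I \<subseteq> C\<close>] by (simp add: cb)
    qed (use \<open>\<mu> > 0\<close> in auto)
    finally show ?thesis by simp
  qed
  have finU: "measure lebesgue (\<Union>i\<in>I. cball (a i) (5 * \<rho> i)) \<le> 5 * (G d - G c) / \<mu>"
    if "I \<subseteq> C" "finite I" for I
    using measure_UNION_le[OF that(2), of "\<lambda>i. cball (a i) (5 * \<rho> i)" lebesgue] fin[OF that] by simp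
  show ?thesis
  proof (intro exI conjI)
    show "S \<subseteq> (\<Union>i\<in>C. cball (a i) (5 * \<rho> i))" by fact
    show "(\<Union>i\<in>C. cball (a i) (5 * \<rho> i)) \<in> lmeasurable"
      by (rule fmeasurable_UN_bound[OF C(1) _ finU]) auto
    show "measure lebesgue (\<Union>i\<in>C. cball (a i) (5 * \<rho> i)) \<le> 5 * (G d - G c) / \<mu>"
      by (rule measure_UN_bound[OF C(1) _ finU]) auto
  qed
qed


section \<open>Derivatives as limits of difference quotients\<close>

lemma difference_quotients_converge:
  fixes q :: "real \<Rightarrow> 'a::banach"
  assumes "\<And>\<epsilon>. \<epsilon> > 0 \<Longrightarrow> \<exists>\<delta>>0. \<forall>x y. x \<noteq> t \<longrightarrow> y \<noteq> t \<longrightarrow> \<bar>x - t\<bar> < \<delta> \<longrightarrow> \<bar>y - t\<bar> < \<delta> \<longrightarrow> norm (q x - q y) \<le> \<epsilon>"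
  shows "\<exists>l. (q \<longlongrightarrow> l) (at t)"
proof -
  define z where "z n = q (t + 1 / real (Suc n))" for n
  have ev: "\<forall>\<^sub>F n in sequentially. 1 / real (Suc n) < \<delta>" if "\<delta> > 0" for \<delta>
    using order_tendstoD(2)[OF LIMSEQ_Suc[OF lim_1_over_n] that] by simp
  have "Cauchy z"
  proof (rule metric_CauchyI)
    fix \<epsilon> :: real assume "0 < \<epsilon>"
    then obtain \<delta> where \<delta>: "\<delta> > 0" and *: "\<And>x y. x \<noteq> t \<Longrightarrow> y \<noteq> t \<Longrightarrow> \<bar>x - t\<bar> < \<delta> \<Longrightarrow> \<bar>y - t\<bar> < \<delta> \<Longrightarrow> norm (q x - q y) \<le> \<epsilon> / 2"
      using assms[of "\<epsilon> / 2"] by auto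
    obtain N where N: "\<And>n. n \<ge> N \<Longrightarrow> 1 / real (Suc n) < \<delta>" using ev[OF \<delta>] by (auto simp: eventually_sequentially)
    have "dist (z m) (z n) < \<epsilon>" if "m \<ge> N" "n \<ge> N" for m n
    proof -
      have "norm (z m - z n) \<le> \<epsilon> / 2" unfolding z_def using N[OF that(1)] N[OF that(2)] by (intro *) auto
      then show ?thesis using \<open>0 < \<epsilon>\<close> by (simp add: dist_norm)
    qed
    then show "\<exists>M. \<forall>m\<ge>M. \<forall>n\<ge>M. dist (z m) (z n) < \<epsilon>" by blast
  qed
  then obtain l where l: "z \<longlonglongrightarrow> l" using Cauchy_convergent convergent_def by blast
  have "(q \<longlongrightarrow> l) (at t)"
    unfolding Lim_at
  proof (intro allI impI)
    fix \<epsilon> :: real assume "0 < \<epsilon>"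
    then obtain \<delta> where \<delta>: "\<delta> > 0" and *: "\<And>x y. x \<noteq> t \<Longrightarrow> y \<noteq> t \<Longrightarrow> \<bar>x - t\<bar> < \<delta> \<Longrightarrow> \<bar>y - t\<bar> < \<delta> \<Longrightarrow> norm (q x - q y) \<le> \<epsilon> / 2"
      using assms[of "\<epsilon> / 2"] by auto
    have "dist (q x) l < \<epsilon>" if "0 < dist x t" "dist x t < \<delta>" for x
    proof -
      have "norm (q x - l) \<le> \<epsilon> / 2"
      proof (rule tendsto_upperbound[OF tendsto_norm[OF tendsto_diff[OF tendsto_const l]]])
        show "\<forall>\<^sub>F n in sequentially. norm (q x - z n) \<le> \<epsilon> / 2"
          using ev[OF \<delta>] unfolding z_def
          by eventually_elim (rule *, use that in \<open>auto simp: dist_real_def\<close>)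
      qed simp
      then show ?thesis using \<open>0 < \<epsilon>\<close> by (simp add: dist_norm)
    qed
    then show "\<exists>d>0. \<forall>x. 0 < dist x t \<and> dist x t < d \<longrightarrow> dist (q x) l < \<epsilon>" using \<delta> by blast
  qed
  then show ?thesis ..
qed

lemma filterlim_add_inverse_Suc_at: "filterlim (\<lambda>n. t + 1 / real (Suc n)) (at t) sequentially"
  unfolding filterlim_at
proof
  have "(\<lambda>n. t + 1 / real (Suc n)) \<longlonglongrightarrow> t + 0" by (intro tendsto_intros LIMSEQ_Suc lim_1_over_n)
  then show "(\<lambda>n. t + 1 / real (Suc n)) \<longlonglongrightarrow> t" by simp
qed auto

lemma has_vector_derivative_at_iff_quotient:
  "(u has_vector_derivative l) (at t) \<longleftrightarrow> ((\<lambda>s. (1 / (s - t)) *\<^sub>R (u s - u t)) \<longlongrightarrow> l) (at t)"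
proof -
  have "(u has_vector_derivative l) (at t) \<longleftrightarrow>
     ((\<lambda>s. norm (u s - u t - (s - t) *\<^sub>R l) / norm (s - t)) \<longlongrightarrow> 0) (at t)"
    by (simp add: has_vector_derivative_def has_derivative_iff_norm bounded_linear_scaleR_left)
  also have "\<dots> \<longleftrightarrow> ((\<lambda>s. norm ((1 / (s - t)) *\<^sub>R (u s - u t) - l)) \<longlongrightarrow> 0) (at t)"
  proof (rule filterlim_cong[OF refl refl], unfold eventually_at_filter, rule always_eventually, intro allI impI)
    fix s assume "s \<noteq> t"
    then have "(1 / (s - t)) *\<^sub>R (u s - u t) - l = (1 / (s - t)) *\<^sub>R (u s - u t - (s - t) *\<^sub>R l)"
      by (simp add: scaleR_diff_right)
    then show "norm (u s - u t - (s - t) *\<^sub>R l) / norm (s - t) = norm ((1 / (s - t)) *\<^sub>R (u s - u t) - l)"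
      by simp
  qed
  also have "\<dots> \<longleftrightarrow> ((\<lambda>s. (1 / (s - t)) *\<^sub>R (u s - u t)) \<longlongrightarrow> l) (at t)"
    by (simp add: tendsto_norm_zero_iff LIM_zero_iff)
  finally show ?thesis .
qed

text \<open>The limit \<open>F\<close> of the energies of the dyadic interpolants plays the role of
  \<open>\<integral>\<^sub>0\<^sup>t |u'|\<^sup>2\<close>, without any derivative being available yet.\<close>

lemma lipschitz_energy_ex:
  fixes u :: "real \<Rightarrow> 'h::{real_inner,banach}"
  assumes lip: "\<And>s t. norm (u t - u s) \<le> M * \<bar>t - s\<bar>"
  defines "e \<equiv> \<lambda>(n::nat) i. 2^n * (norm (u (real (Suc i) / 2^n) - u (real i / 2^n)))\<^sup>2"
  shows "\<exists>F. F 0 = 0 \<and> (\<forall>s t. 0 \<le> s \<longrightarrow> s \<le> t \<longrightarrow> (norm (u t - u s))\<^sup>2 \<le> (t - s) * (F t - F s)) \<and>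
     (\<forall>N::nat. (\<lambda>n. \<Sum>i<N * 2^n. e n i) \<longlonglongrightarrow> F (real N))"
proof -
  have M0: "M \<ge> 0" using lip[of 1 0] norm_ge_zero[of "u 1 - u 0"] by (simp del: norm_ge_zero)
  \<comment> \<open>Number of complete dyadic cells of length \<open>1 / 2^n\<close> in
    \<open>[0, t]\<close>.\<close>
  define k where "k n t = nat \<lfloor>2^n * t\<rfloor>" for n :: nat and t :: real
  define \<Phi> where "\<Phi> n t = (\<Sum>i<k n t. e n i)" for n t
  have e0: "0 \<le> e n i" for n i by (simp add: e_def)
  have eM: "e n i \<le> M\<^sup>2 / 2^n" for n i
  proof -
    have "norm (u (real (Suc i) / 2^n) - u (real i / 2^n)) \<le> M * (1 / 2^n)"
      using lip[of "real (Suc i) / 2^n" "real i / 2^n"] by (simp add: diff_divide_distrib[symmetric])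
    then have "(norm (u (real (Suc i) / 2^n) - u (real i / 2^n)))\<^sup>2 \<le> (M * (1 / 2^n))\<^sup>2"
      by (intro power_mono) auto
    then have "e n i \<le> 2^n * (M * (1 / 2^n))\<^sup>2" unfolding e_def by (intro mult_left_mono) auto
    then show ?thesis by (simp add: power2_eq_square)
  qed
  have kle: "real (k n t) \<le> 2^n * t" if "0 \<le> t" for n t using that by (simp add: k_def)
  have kge: "2^n * t \<le> real (k n t) + 1" if "0 \<le> t" for n t
    using that by (simp add: k_def)
  have kmono: "k n s \<le> k n t" if "s \<le> t" for n s t
    unfolding k_def using that by (intro nat_mono floor_mono) simp
  \<comment> \<open>The energy of a cell is the squared increment divided by the cell length; by the
    parallelogram law it cannot drop when the cell is halved. This makes \<open>\<Phi> n t\<close>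
    increasing in \<open>n\<close>.\<close>
  have refine: "e n i \<le> e (Suc n) (2 * i) + e (Suc n) (Suc (2 * i))" for n i
  proof -
    define a where "a = u (real (Suc (2 * i)) / 2^Suc n) - u (real (2 * i) / 2^Suc n)"
    define b where "b = u (real (Suc (Suc (2 * i))) / 2^Suc n) - u (real (Suc (2 * i)) / 2^Suc n)"
    have "real (Suc (Suc (2 * i))) / 2^Suc n = real (Suc i) / 2^n" "real (2 * i) / 2^Suc n = real i / 2^n"
      by (simp_all add: field_simps)
    then have ab: "u (real (Suc i) / 2^n) - u (real i / 2^n) = a + b" unfolding a_def b_def by simp
    have "(norm (a + b))\<^sup>2 + (norm (a - b))\<^sup>2 = 2 * (norm a)\<^sup>2 + 2 * (norm b)\<^sup>2"
      by (simp add: power2_norm_eq_inner algebra_simps inner_commute)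
    then have "(norm (a + b))\<^sup>2 \<le> 2 * (norm a)\<^sup>2 + 2 * (norm b)\<^sup>2"
      using zero_le_power2[of "norm (a - b)"] by linarith
    then have "2^n * (norm (a + b))\<^sup>2 \<le> 2^n * (2 * (norm a)\<^sup>2 + 2 * (norm b)\<^sup>2)" by (intro mult_left_mono) auto
    then show ?thesis unfolding e_def ab by (simp add: a_def b_def algebra_simps)
  qed
  have sum2: "(\<Sum>i<m. e n i) \<le> (\<Sum>i<2*m. e (Suc n) i)" for n m
  proof (induction m)
    case (Suc m)
    then show ?case using refine[of n m] by (simp add: algebra_simps)
  qed simp
  have inc: "\<Phi> n t \<le> \<Phi> (Suc n) t" if "0 \<le> t" for n t
  proof -
    have "2 * k n t \<le> k (Suc n) t"
      using kle[OF that, of n] by (simp add: k_def le_nat_floor)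
    then have "(\<Sum>i<2 * k n t. e (Suc n) i) \<le> \<Phi> (Suc n) t"
      unfolding \<Phi>_def by (intro sum_mono2) (auto simp: e0)
    then show ?thesis using sum2[of n "k n t"] by (simp add: \<Phi>_def)
  qed
  have bd: "\<Phi> n t \<le> M\<^sup>2 * t" if "0 \<le> t" for n t
  proof -
    have "\<Phi> n t \<le> (\<Sum>i<k n t. M\<^sup>2 / 2^n)" unfolding \<Phi>_def by (intro sum_mono eM)
    also have "\<dots> = real (k n t) * (M\<^sup>2 / 2^n)" by simp
    also have "\<dots> \<le> (2^n * t) * (M\<^sup>2 / 2^n)" by (intro mult_right_mono kle that) auto
    also have "\<dots> = M\<^sup>2 * t" by simp
    finally show ?thesis .
  qed
  define F where "F t = lim (\<lambda>n. \<Phi> n t)" for t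
  have F: "(\<lambda>n. \<Phi> n t) \<longlonglongrightarrow> F t" if "0 \<le> t" for t
  proof -
    have "incseq (\<lambda>n. \<Phi> n t)" using inc[OF that] by (intro incseq_SucI)
    then obtain L where "(\<lambda>n. \<Phi> n t) \<longlonglongrightarrow> L"
      using incseq_convergent[of "\<lambda>n. \<Phi> n t" "M\<^sup>2 * t"] bd[OF \<open>0 \<le> t\<close>] by blast
    then show ?thesis unfolding F_def by (simp add: limI)
  qed
  have kN: "k n (real N) = N * 2^n" for n N
  proof -
    have "2^n * real N = real_of_int (int (N * 2^n))" by simp
    then show ?thesis unfolding k_def by (metis floor_of_int nat_int)
  qed
  have lim: "(\<lambda>n. real (k n t) / 2^n) \<longlonglongrightarrow> t" if "0 \<le> t" for t
  proof (rule tendsto_sandwich[of "\<lambda>n. t - (1/2)^n" _ _ "\<lambda>_. t"])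
    have "t - (1/2)^n \<le> real (k n t) / 2^n \<and> real (k n t) / 2^n \<le> t" for n
    proof -
      have "t - (1/2)^n = (2^n * t - 1) / 2^n" by (simp add: power_divide diff_divide_distrib)
      also have "\<dots> \<le> real (k n t) / 2^n" using kge[OF that, of n] by (intro divide_right_mono) auto
      finally show ?thesis using divide_right_mono[OF kle[OF that, of n], of "2^n"] by simp
    qed
    then show "\<forall>\<^sub>F n in sequentially. t - (1/2)^n \<le> real (k n t) / 2^n" "\<forall>\<^sub>F n in sequentially. real (k n t) / 2^n \<le> t"
      by auto
    have "(\<lambda>n. t - (1/2::real)^n) \<longlonglongrightarrow> t - 0" by (intro tendsto_intros LIMSEQ_power_zero) simp
    then show "(\<lambda>n. t - (1/2::real)^n) \<longlonglongrightarrow> t" by simp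
  qed simp
  have ulim: "(\<lambda>n. u (real (k n t) / 2^n)) \<longlonglongrightarrow> u t" if "0 \<le> t" for t
  proof (rule Lim_null_comparison[THEN LIM_zero_cancel])
    show "\<forall>\<^sub>F n in sequentially. norm (u (real (k n t) / 2^n) - u t) \<le> M * \<bar>real (k n t) / 2^n - t\<bar>"
      using lip by simp
    have "(\<lambda>n. M * \<bar>real (k n t) / 2^n - t\<bar>) \<longlonglongrightarrow> M * \<bar>t - t\<bar>" by (intro tendsto_intros lim that)
    then show "(\<lambda>n. M * \<bar>real (k n t) / 2^n - t\<bar>) \<longlonglongrightarrow> 0" by simp
  qed
  \<comment> \<open>Cauchy-Schwarz over the cells between the two grid points; the inequality for
    \<open>F\<close> is its limit.\<close>
  have CS: "(norm (u (real (k n t) / 2^n) - u (real (k n s) / 2^n)))\<^sup>2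
      \<le> (real (k n t) / 2^n - real (k n s) / 2^n) * (\<Phi> n t - \<Phi> n s)" if "s \<le> t" for n s t
  proof -
    let ?I = "{k n s..<k n t}"
    let ?d = "\<lambda>i. u (real (Suc i) / 2^n) - u (real i / 2^n)"
    have kk: "k n s \<le> k n t" using kmono that .
    have "norm (u (real (k n t) / 2^n) - u (real (k n s) / 2^n)) = norm (\<Sum>i\<in>?I. ?d i)"
      using sum_Suc_diff'[OF kk, of "\<lambda>i. u (real i / 2^n)"] by simp
    also have "\<dots> \<le> (\<Sum>i\<in>?I. norm (?d i))" by (rule norm_sum)
    finally have "(norm (u (real (k n t) / 2^n) - u (real (k n s) / 2^n)))\<^sup>2 \<le> (\<Sum>i\<in>?I. norm (?d i))\<^sup>2"
      by (intro power_mono) auto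
    also have "\<dots> \<le> (\<Sum>i\<in>?I. (norm (?d i))\<^sup>2) * card ?I"
      by (rule sum_squared_le_sum_of_squares)
    also have "(\<Sum>i\<in>?I. (norm (?d i))\<^sup>2) = (1/2^n) * (\<Sum>i\<in>?I. e n i)"
      by (simp add: e_def sum_distrib_left)
    also have "(\<Sum>i\<in>?I. e n i) = \<Phi> n t - \<Phi> n s"
      unfolding \<Phi>_def using kk by (simp add: sum_diff_nat_ivl lessThan_atLeast0)
    also have "1 / 2^n * (\<Phi> n t - \<Phi> n s) * real (card ?I) = (real (k n t) / 2^n - real (k n s) / 2^n) * (\<Phi> n t - \<Phi> n s)"
      using kk by (simp add: of_nat_diff diff_divide_distrib[symmetric] mult.commute)
    finally show ?thesis .
  qed
  have "(norm (u t - u s))\<^sup>2 \<le> (t - s) * (F t - F s)" if "0 \<le> s" "s \<le> t" for s t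
  proof (rule LIMSEQ_le)
    show "(\<lambda>n. (norm (u (real (k n t) / 2^n) - u (real (k n s) / 2^n)))\<^sup>2) \<longlonglongrightarrow> (norm (u t - u s))\<^sup>2"
      using that by (intro tendsto_intros ulim) auto
    show "(\<lambda>n. (real (k n t) / 2^n - real (k n s) / 2^n) * (\<Phi> n t - \<Phi> n s)) \<longlonglongrightarrow> (t - s) * (F t - F s)"
      using that by (intro tendsto_intros lim F) auto
  qed (use CS that in blast)
  moreover have "F 0 = 0"
    using LIMSEQ_unique[OF F[of 0], of 0] by (simp add: \<Phi>_def k_def)
  moreover have "(\<lambda>n. \<Sum>i<N * 2^n. e n i) \<longlonglongrightarrow> F (real N)" for N
    using F[of "real N"] by (simp add: \<Phi>_def kN)
  ultimately show ?thesis by blast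
qed


text \<open>After subtraction of the affine interpolant of slope \<open>m\<close>, the function
  \<open>G\<close> is an energy for the remainder, and its total increment is the energy defect of
  the cell. If two difference quotients differ by more than \<open>2 * \<epsilon>\<close>, one of
  them is further than \<open>\<epsilon>\<close> from \<open>m\<close>, which makes \<open>G\<close>
  steep at \<open>t\<close> and lets the weak-type estimate apply.\<close>

lemma nondifferentiability_set_cell:
  fixes u :: "real \<Rightarrow> 'h::real_inner"
  assumes F: "\<And>s t. c \<le> s \<Longrightarrow> s \<le> t \<Longrightarrow> t \<le> d \<Longrightarrow> (norm (u t - u s))\<^sup>2 \<le> (t - s) * (F t - F s)"
    and "c < d" "\<epsilon> > 0"
  defines "q \<equiv> \<lambda>t s. (1 / (s - t)) *\<^sub>R (u s - u t)"
  shows "\<exists>U. {t \<in> {c<..<d}. \<forall>\<delta>>0. \<exists>x y. x \<noteq> t \<and> y \<noteq> t \<and> \<bar>x - t\<bar> < \<delta> \<and> \<bar>y - t\<bar> < \<delta> \<and> norm (q t x - q t y) > 2 * \<epsilon>} \<subseteq> U \<and>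
     U \<in> lmeasurable \<and> measure lebesgue U \<le> 5 * (F d - F c - (norm (u d - u c))\<^sup>2 / (d - c)) / \<epsilon>\<^sup>2"
proof -
  define m where "m = (1 / (d - c)) *\<^sub>R (u d - u c)"
  define w where "w t = u t - t *\<^sub>R m" for t
  define G where "G t = F t - 2 * (m \<bullet> u t) + (norm m)\<^sup>2 * t" for t
  have norm_sq: "(norm (a - k *\<^sub>R m))\<^sup>2 = (norm a)\<^sup>2 - 2 * k * (m \<bullet> a) + k\<^sup>2 * (norm m)\<^sup>2" for a k
    unfolding power2_norm_eq_inner by (simp add: algebra_simps inner_commute power2_eq_square)
  have G: "(norm (w t - w s))\<^sup>2 \<le> (t - s) * (G t - G s)" if "c \<le> s" "s \<le> t" "t \<le> d" for s t
  proof -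
    have "w t - w s = (u t - u s) - (t - s) *\<^sub>R m" by (simp add: w_def algebra_simps)
    then have "(norm (w t - w s))\<^sup>2 = (norm (u t - u s))\<^sup>2 - 2 * (t - s) * (m \<bullet> (u t - u s)) + (t - s)\<^sup>2 * (norm m)\<^sup>2"
      using norm_sq[of "u t - u s" "t - s"] by simp
    also have "\<dots> \<le> (t - s) * (F t - F s) - 2 * (t - s) * (m \<bullet> (u t - u s)) + (t - s)\<^sup>2 * (norm m)\<^sup>2"
      using F[OF that] by simp
    also have "\<dots> = (t - s) * (G t - G s)" by (simp add: G_def algebra_simps inner_diff_right power2_eq_square)
    finally show ?thesis .
  qed
  have mono: "mono_on {c..d} G"
  proof (rule mono_onI)
    fix s t assume st: "s \<in> {c..d}" "t \<in> {c..d}" "s \<le> t"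
    show "G s \<le> G t"
    proof (cases "s = t")
      case False
      have "0 \<le> (t - s) * (G t - G s)" using order_trans[OF zero_le_power2 G[of s t]] st by simp
      then show ?thesis using False st by (simp add: zero_le_mult_iff)
    qed simp
  qed
  have GG: "G d - G c = F d - F c - (norm (u d - u c))\<^sup>2 / (d - c)"
  proof -
    have "m \<bullet> (u d - u c) = (norm (u d - u c))\<^sup>2 / (d - c)"
      by (simp add: m_def power2_norm_eq_inner)
    moreover have "(norm m)\<^sup>2 * (d - c) = (norm (u d - u c))\<^sup>2 / (d - c)"
    proof -
      have "norm m = norm (u d - u c) / (d - c)" using \<open>c < d\<close> by (simp add: m_def)
      then show ?thesis using \<open>c < d\<close> by (simp add: power_divide power2_eq_square)
    qed
    ultimately show ?thesis by (simp add: G_def inner_diff_right algebra_simps)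
  qed
  let ?B = "{t \<in> {c<..<d}. \<forall>\<delta>>0. \<exists>x y. x \<noteq> t \<and> y \<noteq> t \<and> \<bar>x - t\<bar> < \<delta> \<and> \<bar>y - t\<bar> < \<delta> \<and> norm (q t x - q t y) > 2 * \<epsilon>}"
  have "\<exists>y\<in>{c..d}. t \<in> {c..d} \<and> y \<noteq> t \<and> \<epsilon>\<^sup>2 * \<bar>y - t\<bar> < \<bar>G y - G t\<bar>" if "t \<in> ?B" for t
  proof -
    have t: "c < t" "t < d" using that by auto
    then have pos: "0 < min (t - c) (d - t)" by simp
    from that have "\<forall>\<delta>>0. \<exists>x y. x \<noteq> t \<and> y \<noteq> t \<and> \<bar>x - t\<bar> < \<delta> \<and> \<bar>y - t\<bar> < \<delta> \<and> norm (q t x - q t y) > 2 * \<epsilon>"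
      by simp
    from this[rule_format, OF pos] obtain x y where xy: "x \<noteq> t" "y \<noteq> t" "\<bar>x - t\<bar> < min (t - c) (d - t)" "\<bar>y - t\<bar> < min (t - c) (d - t)"
      and big: "norm (q t x - q t y) > 2 * \<epsilon>" by blast
    have "norm (q t x - m) > \<epsilon> \<or> norm (q t y - m) > \<epsilon>"
      using big norm_triangle_ineq4[of "q t x - m" "q t y - m"] by auto
    then obtain z where z: "z \<noteq> t" "\<bar>z - t\<bar> < min (t - c) (d - t)" "norm (q t z - m) > \<epsilon>" using xy by blast
    have "q t z - m = (1 / (z - t)) *\<^sub>R (w z - w t)"
    proof -
      have "m = (1 / (z - t)) *\<^sub>R ((z - t) *\<^sub>R m)" using z by simp
      then show ?thesis by (simp only: q_def w_def scaleR_diff_right scaleR_diff_left) (simp add: algebra_simps)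
    qed
    then have "norm (q t z - m) = norm (w z - w t) / \<bar>z - t\<bar>" by simp
    then have "\<epsilon> * \<bar>z - t\<bar> < norm (w z - w t)" using z by (simp add: pos_less_divide_eq)
    then have "(\<epsilon> * \<bar>z - t\<bar>)\<^sup>2 < (norm (w z - w t))\<^sup>2"
      using \<open>\<epsilon> > 0\<close> by (intro power_strict_mono) auto
    also have "\<dots> \<le> \<bar>z - t\<bar> * \<bar>G z - G t\<bar>"
    proof (cases "t \<le> z")
      case True
      then have "(norm (w z - w t))\<^sup>2 \<le> (z - t) * (G z - G t)" using G[of t z] z t by auto
      also have "\<dots> \<le> \<bar>(z - t) * (G z - G t)\<bar>" by simp
      finally show ?thesis by (simp add: abs_mult)
    next
      case False
      then have "(norm (w t - w z))\<^sup>2 \<le> (t - z) * (G t - G z)" using G[of z t] z t by auto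
      also have "\<dots> \<le> \<bar>(t - z) * (G t - G z)\<bar>" by simp
      finally show ?thesis by (simp add: abs_mult norm_minus_commute abs_minus_commute)
    qed
    finally have "\<bar>z - t\<bar> * (\<epsilon>\<^sup>2 * \<bar>z - t\<bar>) < \<bar>z - t\<bar> * \<bar>G z - G t\<bar>"
      by (simp add: power2_eq_square algebra_simps)
    then have "\<epsilon>\<^sup>2 * \<bar>z - t\<bar> < \<bar>G z - G t\<bar>" using z by simp
    then show ?thesis using z t by (intro bexI[of _ z]) auto
  qed
  then show ?thesis
    unfolding GG[symmetric]
    by (intro mono_steep_set_measure[OF mono]) (use \<open>c < d\<close> \<open>\<epsilon> > 0\<close> in auto)
qed

text \<open>For fixed \<open>\<epsilon>\<close> the defects of the dyadic cells add up to
  \<open>F (real N)\<close> minus the dyadic energy, which tends to 0 under refinement. Hence the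
  points of oscillation above \<open>2 * \<epsilon>\<close> have arbitrarily small outer
  measure.\<close>

theorem lipschitz_Hilbert_differentiable_ae:
  fixes u :: "real \<Rightarrow> 'h::{real_inner,banach}"
  assumes lip: "\<And>s t. norm (u t - u s) \<le> M * \<bar>t - s\<bar>"
  shows "negligible {t \<in> {0<..}. \<nexists>l. (u has_vector_derivative l) (at t)}"
proof -
  define e where "e = (\<lambda>(n::nat) i. 2^n * (norm (u (real (Suc i) / 2^n) - u (real i / 2^n)))\<^sup>2)"
  obtain F where F0: "F 0 = 0"
    and F: "\<And>s t. 0 \<le> s \<Longrightarrow> s \<le> t \<Longrightarrow> (norm (u t - u s))\<^sup>2 \<le> (t - s) * (F t - F s)"
    and Flim: "\<And>N::nat. (\<lambda>n. \<Sum>i<N * 2^n. e n i) \<longlonglongrightarrow> F (real N)"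
    using lipschitz_energy_ex[of u M, OF lip] unfolding e_def by blast
  define q where "q = (\<lambda>t s. (1 / (s - t)) *\<^sub>R (u s - u t))"
  define B where "B \<epsilon> = {t. \<forall>\<delta>>0. \<exists>x y. x \<noteq> t \<and> y \<noteq> t \<and> \<bar>x - t\<bar> < \<delta> \<and> \<bar>y - t\<bar> < \<delta> \<and> norm (q t x - q t y) > 2 * \<epsilon>}" for \<epsilon>
  have neg: "negligible (B \<epsilon> \<inter> {0<..<real N})" if "\<epsilon> > 0" for \<epsilon> N
    unfolding negligible_outer_le
  proof (intro allI impI)
    fix \<eta> :: real assume "\<eta> > 0"
    have "(\<lambda>n. 5 * (F (real N) - (\<Sum>i<N * 2^n. e n i)) / \<epsilon>\<^sup>2) \<longlonglongrightarrow> 5 * (F (real N) - F (real N)) / \<epsilon>\<^sup>2"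
      using \<open>\<epsilon> > 0\<close> by (intro tendsto_intros Flim) auto
    then have "\<forall>\<^sub>F n in sequentially. 5 * (F (real N) - (\<Sum>i<N * 2^n. e n i)) / \<epsilon>\<^sup>2 < \<eta>"
      using \<open>\<eta> > 0\<close> by (intro order_tendstoD) auto
    then obtain n where n: "5 * (F (real N) - (\<Sum>i<N * 2^n. e n i)) / \<epsilon>\<^sup>2 < \<eta>" by (auto simp: eventually_sequentially)
    define g where "g i = real i / 2^n" for i
    have gS: "g (Suc i) - g i = 1 / 2^n" for i by (simp add: g_def diff_divide_distrib[symmetric])
    have g0: "0 \<le> g i" for i by (simp add: g_def)
    define \<delta> where "\<delta> i = F (g (Suc i)) - F (g i) - e n i" for i
    have "\<exists>U. B \<epsilon> \<inter> {g i<..<g (Suc i)} \<subseteq> U \<and> U \<in> lmeasurable \<and> measure lebesgue U \<le> 5 * \<delta> i / \<epsilon>\<^sup>2" for i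
    proof -
      have "g i < g (Suc i)" using gS[of i] by (smt (verit) zero_less_divide_1_iff zero_less_power)
      from nondifferentiability_set_cell[of "g i" "g (Suc i)" u F \<epsilon>, OF _ this \<open>\<epsilon> > 0\<close>]
      obtain U where "{t \<in> {g i<..<g (Suc i)}. t \<in> B \<epsilon>} \<subseteq> U" "U \<in> lmeasurable"
        "measure lebesgue U \<le> 5 * (F (g (Suc i)) - F (g i) - (norm (u (g (Suc i)) - u (g i)))\<^sup>2 / (g (Suc i) - g i)) / \<epsilon>\<^sup>2"
        using F g0[of i] unfolding B_def q_def by (auto intro: order_trans)
      moreover have "(norm (u (g (Suc i)) - u (g i)))\<^sup>2 / (g (Suc i) - g i) = e n i"
        unfolding gS by (simp add: e_def g_def)
      ultimately show ?thesis unfolding \<delta>_def by (intro exI[of _ U]) auto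
    qed
    then obtain U where U: "\<And>i. B \<epsilon> \<inter> {g i<..<g (Suc i)} \<subseteq> U i" "\<And>i. U i \<in> lmeasurable"
      "\<And>i. measure lebesgue (U i) \<le> 5 * \<delta> i / \<epsilon>\<^sup>2" by metis
    \<comment> \<open>The cell estimate concerns open cells only; the finitely many grid points are
      added as a null set.\<close>
    let ?W = "g ` {..N * 2^n} \<union> (\<Union>i<N * 2^n. U i)"
    have fin0: "negligible (g ` {..N * 2^n})" by (intro negligible_finite) auto
    have "B \<epsilon> \<inter> {0<..<real N} \<subseteq> ?W"
    proof
      fix t assume t: "t \<in> B \<epsilon> \<inter> {0<..<real N}"
      define i where "i = nat \<lfloor>2^n * t\<rfloor>"
      have i: "real i \<le> 2^n * t" "2^n * t < real i + 1" using t by (auto simp: i_def)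
      have "real i < real (N * 2^n)" using i(1) t by (auto intro: le_less_trans simp: mult.commute)
      then have iN: "i < N * 2^n" by linarith
      have git: "g i \<le> t" "t < g (Suc i)" using i by (auto simp: g_def field_simps)
      show "t \<in> ?W"
      proof (cases "t = g i")
        case True
        then show ?thesis using iN by auto
      next
        case False
        then have "t \<in> U i" using U(1)[of i] git t by auto
        then show ?thesis using iN by auto
      qed
    qed
    moreover have "?W \<in> lmeasurable"
      using U(2) negligible_imp_measurable[OF fin0] by (intro fmeasurable.Un fmeasurable.finite_UN) auto
    moreover have "measure lebesgue ?W \<le> \<eta>"
    proof -
      have "measure lebesgue ?W \<le> measure lebesgue (g ` {..N * 2^n}) + measure lebesgue (\<Union>i<N * 2^n. U i)"
        using U(2) negligible_imp_measurable[OF fin0] by (intro measure_Un_le) (auto intro!: sets.finite_UN)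
      also have "\<dots> = measure lebesgue (\<Union>i<N * 2^n. U i)"
        using negligible_imp_measure0[OF fin0] by simp
      also have "\<dots> \<le> (\<Sum>i<N * 2^n. measure lebesgue (U i))"
        using U(2) by (intro measure_UNION_le) auto
      also have "\<dots> \<le> (\<Sum>i<N * 2^n. 5 / \<epsilon>\<^sup>2 * \<delta> i)" using U(3) by (intro sum_mono) simp
      also have "\<dots> = 5 / \<epsilon>\<^sup>2 * (\<Sum>i<N * 2^n. \<delta> i)" by (simp add: sum_distrib_left)
      also have "(\<Sum>i<N * 2^n. \<delta> i) = F (g (N * 2^n)) - F (g 0) - (\<Sum>i<N * 2^n. e n i)"
        unfolding \<delta>_def sum_subtractf[of _ "\<lambda>i. e n i"] by (simp add: sum_lessThan_telescope[of "\<lambda>i. F (g i)"])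
      also have "g (N * 2^n) = real N" by (simp add: g_def)
      also have "F (g 0) = 0" by (simp add: g_def F0)
      finally show ?thesis using n by simp
    qed
    ultimately show "\<exists>T. B \<epsilon> \<inter> {0<..<real N} \<subseteq> T \<and> T \<in> lmeasurable \<and> measure lebesgue T \<le> \<eta>" by blast
  qed
  have "negligible (\<Union>N::nat. \<Union>k::nat. B (1 / real (Suc k)) \<inter> {0<..<real N})"
    by (intro negligible_countable_Union[unfolded image_def] negligible_Union_nat neg) auto
  moreover have "{t \<in> {0<..}. \<nexists>l. (u has_vector_derivative l) (at t)} \<subseteq> (\<Union>N::nat. \<Union>k::nat. B (1 / real (Suc k)) \<inter> {0<..<real N})"
  proof
    fix t assume t: "t \<in> {t \<in> {0<..}. \<nexists>l. (u has_vector_derivative l) (at t)}"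
    obtain N :: nat where N: "t < real N" using reals_Archimedean2 by blast
    have "\<exists>k. t \<in> B (1 / real (Suc k))"
    proof (rule ccontr)
      assume no: "\<not> ?thesis"
      have "\<exists>l. (q t \<longlongrightarrow> l) (at t)"
      proof (rule difference_quotients_converge)
        fix \<epsilon> :: real assume "\<epsilon> > 0"
        then obtain k :: nat where k: "1 / real (Suc k) < \<epsilon> / 2"
          using reals_Archimedean[of "\<epsilon> / 2"] by (auto simp: inverse_eq_divide)
        have "t \<notin> B (1 / real (Suc k))" using no by blast
        then obtain \<delta> where "\<delta> > 0" and no\<delta>: "\<not> (\<exists>x y. x \<noteq> t \<and> y \<noteq> t \<and> \<bar>x - t\<bar> < \<delta> \<and> \<bar>y - t\<bar> < \<delta> \<and>
            norm (q t x - q t y) > 2 * (1 / real (Suc k)))"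
          unfolding B_def mem_Collect_eq not_all not_imp by (elim exE conjE)
        have "norm (q t x - q t y) \<le> \<epsilon>" if "x \<noteq> t" "y \<noteq> t" "\<bar>x - t\<bar> < \<delta>" "\<bar>y - t\<bar> < \<delta>" for x y
        proof (rule ccontr)
          assume "\<not> ?thesis"
          then have "norm (q t x - q t y) > 2 * (1 / real (Suc k))" using k by linarith
          then show False using no\<delta> that by blast
        qed
        then show "\<exists>\<delta>>0. \<forall>x y. x \<noteq> t \<longrightarrow> y \<noteq> t \<longrightarrow> \<bar>x - t\<bar> < \<delta> \<longrightarrow> \<bar>y - t\<bar> < \<delta> \<longrightarrow> norm (q t x - q t y) \<le> \<epsilon>"
          using \<open>\<delta> > 0\<close> by blast
      qed
      then show False using t unfolding q_def has_vector_derivative_at_iff_quotient by blast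
    qed
    then show "t \<in> (\<Union>N::nat. \<Union>k::nat. B (1 / real (Suc k)) \<inter> {0<..<real N})" using t N by auto
  qed
  ultimately show ?thesis by (rule negligible_subset)
qed

section \<open>Lipschitz functions and bounded weak derivatives\<close>

lemma AE_lebesgue_on_iff_negligible:
  assumes "S \<in> sets lebesgue"
  shows "(AE x in lebesgue_on S. P x) \<longleftrightarrow> negligible {x \<in> S. \<not> P x}"
proof -
  have "(AE x in lebesgue_on S. P x) \<longleftrightarrow> (AE x in lebesgue. x \<in> S \<longrightarrow> P x)"
    using assms by (intro AE_restrict_space_iff) simp
  also have "\<dots> \<longleftrightarrow> negligible {x \<in> S. \<not> P x}"
  proof
    assume "AE x in lebesgue. x \<in> S \<longrightarrow> P x"
    then obtain N where "{x \<in> space lebesgue. \<not> (x \<in> S \<longrightarrow> P x)} \<subseteq> N" "N \<in> null_sets lebesgue"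
      by (auto simp: eventually_ae_filter)
    then show "negligible {x \<in> S. \<not> P x}"
      using negligible_subset[of N] by (auto simp: negligible_iff_null_sets)
  next
    assume "negligible {x \<in> S. \<not> P x}"
    then show "AE x in lebesgue. x \<in> S \<longrightarrow> P x"
      by (intro AE_I'[of "{x \<in> S. \<not> P x}"]) (auto simp: negligible_iff_null_sets)
  qed
  finally show ?thesis .
qed

text \<open>The integral of the forward difference quotient telescopes into the difference of two
  short averages of \<open>w\<close>, at \<open>b\<close> and at \<open>a\<close>, which tend to
  \<open>w b\<close> and \<open>w a\<close>; the Lipschitz constant dominates the quotients.\<close>

lemma lipschitz_has_integral_derivative:
  fixes w D :: "real \<Rightarrow> real"
  assumes lip: "\<And>s t. \<bar>w t - w s\<bar> \<le> M * \<bar>t - s\<bar>" and "a \<le> b" and N: "negligible N"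
    and D: "\<And>x. x \<in> {a..b} - N \<Longrightarrow> (w has_vector_derivative D x) (at x)"
  shows "(D has_integral (w b - w a)) {a..b}"
proof -
  have M0: "M \<ge> 0" using order_trans[OF abs_ge_zero lip[of 1 0]] by simp
  have cont: "continuous_on X w" for X
    by (rule continuous_on_subset[OF lipschitz_on_continuous_on[of M UNIV]])
       (use lip M0 in \<open>auto simp: lipschitz_on_def dist_real_def\<close>)
  define h where "h k = 1 / real (Suc k)" for k
  have h0: "h k > 0" for k by (simp add: h_def)
  have hlim: "h \<longlonglongrightarrow> 0" unfolding h_def by (intro LIMSEQ_Suc lim_1_over_n)
  define f where "f k x = (w (x + h k) - w x) / h k" for k x
  \<comment> \<open>Set to 0 on the exceptional set, so that convergence and domination hold at
    every point while the integrals stay the same.\<close>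
  define f' where "f' k x = (if x \<in> N then 0 else f k x)" for k x
  define D' where "D' x = (if x \<in> N then 0 else D x)" for x
  have fint: "f k integrable_on {a..b}" for k
    unfolding f_def using h0[of k]
    by (intro integrable_continuous_real continuous_intros continuous_on_compose2[OF cont[of UNIV]] cont) auto
  have f'int: "f' k integrable_on {a..b}" and f'eq: "integral {a..b} (f' k) = integral {a..b} (f k)" for k
    using integrable_spike[OF fint[of k] N] integral_spike[OF N, of "{a..b}" "f' k" "f k"] by (auto simp: f'_def)
  have bound: "norm (f' k x) \<le> M" for k x
  proof -
    have "\<bar>w (x + h k) - w x\<bar> \<le> M * h k" using lip[of "x + h k" x] h0[of k] by simp
    then show ?thesis using h0[of k] M0 by (simp add: f'_def f_def pos_divide_le_eq)
  qed
  have conv: "(\<lambda>k. f' k x) \<longlonglongrightarrow> D' x" if "x \<in> {a..b}" for x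
  proof (cases "x \<in> N")
    case False
    then have "((\<lambda>s. (1 / (s - x)) *\<^sub>R (w s - w x)) \<longlongrightarrow> D x) (at x)"
      using D[of x] that by (simp add: has_vector_derivative_at_iff_quotient)
    moreover have "filterlim (\<lambda>k. x + h k) (at x) sequentially"
      unfolding h_def by (rule filterlim_add_inverse_Suc_at)
    ultimately have "(\<lambda>k. (1 / (x + h k - x)) *\<^sub>R (w (x + h k) - w x)) \<longlonglongrightarrow> D x"
      by (rule filterlim_compose)
    then show ?thesis using False by (simp add: f'_def D'_def f_def)
  qed (simp add: f'_def D'_def)
  have DC: "D' integrable_on {a..b}" "(\<lambda>k. integral {a..b} (f' k)) \<longlonglongrightarrow> integral {a..b} D'"
    using dominated_convergence[of f' "{a..b}" "\<lambda>_. M" D'] f'int bound conv by auto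
  have avg: "(\<lambda>k. integral {c..c + h k} w / h k) \<longlonglongrightarrow> w c" for c
  proof (rule Lim_null_comparison[THEN LIM_zero_cancel])
    show "\<forall>\<^sub>F k in sequentially. norm (integral {c..c + h k} w / h k - w c) \<le> M * h k"
    proof (intro always_eventually allI)
      fix k
      have wi: "w integrable_on {c..c + h k}" by (intro integrable_continuous_real cont)
      have "integral {c..c + h k} w / h k - w c = integral {c..c + h k} (\<lambda>x. w x - w c) / h k"
        using h0[of k] Henstock_Kurzweil_Integration.integral_diff[OF wi integrable_const_ivl[of "w c"]]
        by (simp add: diff_divide_distrib)
      also have "norm \<dots> \<le> (M * h k * h k) / h k"
      proof -
        have "norm (integral {c..c + h k} (\<lambda>x. w x - w c)) \<le> M * h k * (c + h k - c)"
        proof (rule integral_bound)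
          fix x assume x: "x \<in> {c..c + h k}"
          have "\<bar>w x - w c\<bar> \<le> M * \<bar>x - c\<bar>" by (rule lip)
          also have "\<dots> \<le> M * h k" using x M0 by (intro mult_left_mono) auto
          finally show "norm (w x - w c) \<le> M * h k" by simp
        qed (use h0[of k] in \<open>auto intro!: continuous_intros cont\<close>)
        then show ?thesis using h0[of k] by (simp add: pos_divide_le_eq)
      qed
      finally show "norm (integral {c..c + h k} w / h k - w c) \<le> M * h k" using h0[of k] by simp
    qed
    have "(\<lambda>k. M * h k) \<longlonglongrightarrow> M * 0" by (intro tendsto_intros hlim)
    then show "(\<lambda>k. M * h k) \<longlonglongrightarrow> 0" by simp
  qed
  have If: "integral {a..b} (f k) = integral {b..b + h k} w / h k - integral {a..a + h k} w / h k" for k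
  proof -
    have "integral {a..b} (\<lambda>x. w (x + h k)) = integral {a + h k..b + h k} w"
      using integral_shift_Icc_real[of a b w "h k"] by (simp add: o_def add.commute)
    moreover have "integral {a..b} w + integral {b..b + h k} w = integral {a..b + h k} w"
      using \<open>a \<le> b\<close> h0[of k] by (intro Henstock_Kurzweil_Integration.integral_combine integrable_continuous_real cont) auto
    moreover have "integral {a..a + h k} w + integral {a + h k..b + h k} w = integral {a..b + h k} w"
      using \<open>a \<le> b\<close> h0[of k] by (intro Henstock_Kurzweil_Integration.integral_combine integrable_continuous_real cont) auto
    moreover have "integral {a..b} (f k) = (integral {a..b} (\<lambda>x. w (x + h k)) - integral {a..b} w) / h k"
      unfolding f_def by (subst Henstock_Kurzweil_Integration.integral_diff[symmetric])
        (auto intro!: integrable_continuous_real continuous_intros continuous_on_compose2[OF cont[of UNIV]] cont)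
    ultimately show ?thesis by (simp add: diff_divide_distrib[symmetric])
  qed
  have "(\<lambda>k. integral {a..b} (f' k)) \<longlonglongrightarrow> w b - w a"
    unfolding f'eq If by (intro tendsto_diff avg)
  then have "integral {a..b} D' = w b - w a" using DC(2) LIMSEQ_unique by blast
  then have "(D' has_integral (w b - w a)) {a..b}" using DC(1) integrable_integral by metis
  then show ?thesis by (rule has_integral_spike[OF N, rotated]) (simp add: D'_def)
qed

text \<open>Composition with this map continues a function on \<open>[0, T]\<close> by constants to
  the real line. It keeps Lipschitz constants and so gives access to results about globally
  Lipschitz functions.\<close>

definition clamp_time :: "real \<Rightarrow> real \<Rightarrow> real" where
  "clamp_time T t = max 0 (min T t)"

lemma clamp_time:
  assumes "T > 0"
  shows "clamp_time T t \<in> {0..T}" "\<bar>clamp_time T t - clamp_time T s\<bar> \<le> \<bar>t - s\<bar>"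
    "t \<in> {0..T} \<Longrightarrow> clamp_time T t = t"
  using assms by (auto simp: clamp_time_def)

lemma lipschitz_clamp_time:
  assumes "T > 0" and lip: "\<And>s t. s \<in> {0..T} \<Longrightarrow> t \<in> {0..T} \<Longrightarrow> norm (u t - u s) \<le> M * \<bar>t - s\<bar>"
  shows "0 \<le> M" "norm (u (clamp_time T t) - u (clamp_time T s)) \<le> M * \<bar>t - s\<bar>"
proof -
  show "0 \<le> M" using order_trans[OF norm_ge_zero lip[of 0 T]] \<open>T > 0\<close> by (simp add: zero_le_mult_iff)
  then show "norm (u (clamp_time T t) - u (clamp_time T s)) \<le> M * \<bar>t - s\<bar>"
    using lip[of "clamp_time T s" "clamp_time T t"] clamp_time(1,2)[OF \<open>T > 0\<close>]
    by (meson mult_left_mono order_trans)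
qed

lemma has_vector_derivative_clamp_iff:
  assumes "t \<in> {0<..<T}"
  shows "((\<lambda>t. u (clamp_time T t)) has_vector_derivative l) (at t) \<longleftrightarrow> (u has_vector_derivative l) (at t)"
proof -
  have ev: "\<forall>\<^sub>F s in nhds t. clamp_time T s = s"
    using eventually_nhds_in_open[of "{0<..<T}" t] assms by (auto simp: clamp_time_def elim: eventually_mono)
  have "clamp_time T t = t" using assms by (auto simp: clamp_time_def)
  then show ?thesis
    by (intro has_vector_derivative_cong_ev eventually_mono[OF ev]) auto
qed

text \<open>Membership in the open interval is part of the conclusion so that later arguments may
  work with two-sided derivatives.\<close>

lemma lipschitz_on_interval_differentiable_ae:
  fixes u :: "real \<Rightarrow> 'h::{real_inner,banach}"
  assumes "T > 0" and lip: "\<And>s t. s \<in> {0..T} \<Longrightarrow> t \<in> {0..T} \<Longrightarrow> norm (u t - u s) \<le> M * \<bar>t - s\<bar>"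
  shows "AE t in lebesgue_on {0..T}. t \<in> {0<..<T} \<and> (\<exists>l. (u has_vector_derivative l) (at t))"
proof -
  have "norm (u (clamp_time T t) - u (clamp_time T s)) \<le> M * \<bar>t - s\<bar>" for s t
    by (rule lipschitz_clamp_time(2)[OF \<open>T > 0\<close>]) (rule lip)
  from lipschitz_Hilbert_differentiable_ae[of "\<lambda>t. u (clamp_time T t)" M, OF this]
  have "negligible ({t \<in> {0<..}. \<nexists>l. ((\<lambda>t. u (clamp_time T t)) has_vector_derivative l) (at t)} \<union> {0, T})"
    by (intro negligible_Un) auto
  then have "negligible {t \<in> {0..T}. \<not> (t \<in> {0<..<T} \<and> (\<exists>l. (u has_vector_derivative l) (at t)))}"
    by (rule negligible_subset) (use has_vector_derivative_clamp_iff[of _ T u] in auto)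
  then show ?thesis by (subst AE_lebesgue_on_iff_negligible) auto
qed

text \<open>Serves the uniqueness proof, where the squared distance of two solutions has a
  nonpositive derivative almost everywhere.\<close>

lemma lipschitz_derivative_nonpos_imp_le:
  fixes w :: "real \<Rightarrow> real"
  assumes "T > 0" and lip: "\<And>s t. s \<in> {0..T} \<Longrightarrow> t \<in> {0..T} \<Longrightarrow> \<bar>w t - w s\<bar> \<le> M * \<bar>t - s\<bar>"
    and D: "AE t in lebesgue_on {0..T}. t \<in> {0<..<T} \<longrightarrow> (\<exists>l\<le>0. (w has_vector_derivative l) (at t))"
    and t: "t \<in> {0..T}"
  shows "w t \<le> w 0"
proof -
  let ?w = "\<lambda>t. w (clamp_time T t)"
  have lip': "\<bar>?w t - ?w s\<bar> \<le> M * \<bar>t - s\<bar>" for s t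
    by (rule lipschitz_clamp_time(2)[OF \<open>T > 0\<close>, of w, unfolded real_norm_def]) (rule lip)
  define N where "N = {t \<in> {0..T}. \<not> (t \<in> {0<..<T} \<longrightarrow> (\<exists>l\<le>0. (w has_vector_derivative l) (at t)))} \<union> {0, T}"
  have N: "negligible N"
    using D unfolding N_def by (subst (asm) AE_lebesgue_on_iff_negligible) (auto intro!: negligible_Un)
  define D' where "D' t = (if t \<in> N then 0 else SOME l. l \<le> 0 \<and> (w has_vector_derivative l) (at t))" for t
  have D': "D' x \<le> 0 \<and> (x \<notin> N \<longrightarrow> (?w has_vector_derivative D' x) (at x))" if "x \<in> {0..t}" for x
  proof (cases "x \<in> N")
    case False
    then have x: "x \<in> {0<..<T}" using that t by (auto simp: N_def)
    then have "\<exists>l. l \<le> 0 \<and> (w has_vector_derivative l) (at x)" using False by (auto simp: N_def)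
    from someI_ex[OF this] show ?thesis
      using False by (simp add: D'_def has_vector_derivative_clamp_iff[OF x])
  qed (simp add: D'_def)
  have "(D' has_integral (?w t - ?w 0)) {0..t}"
    by (rule lipschitz_has_integral_derivative[OF lip' _ N]) (use t D' in auto)
  then have "?w t - ?w 0 \<le> 0"
    by (rule has_integral_le[OF _ has_integral_0]) (use D' in auto)
  then show ?thesis using clamp_time(3)[OF \<open>T > 0\<close>, of t] clamp_time(3)[OF \<open>T > 0\<close>, of 0] t \<open>T > 0\<close> by simp
qed


section \<open>Lipschitz functions have bounded weak derivatives\<close>

lemma test_fun_properties:
  assumes "test_fun T \<phi>"
  shows "\<And>t. (\<phi> has_real_derivative deriv \<phi> t) (at t)" "continuous_on UNIV (deriv \<phi>)"
    "\<And>t. t \<notin> {0<..<T} \<Longrightarrow> \<phi> t = 0"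
proof -
  have d: "\<phi> differentiable at t" for t
    using assms by (auto simp: test_fun_def C1_differentiable_on_eq)
  then show *: "(\<phi> has_real_derivative deriv \<phi> t) (at t)" for t
    by (metis DERIV_deriv_iff_real_differentiable)
  have "vector_derivative \<phi> (at t) = deriv \<phi> t" for t
    using * by (simp add: has_real_derivative_iff_has_vector_derivative vector_derivative_at)
  then show "continuous_on UNIV (deriv \<phi>)"
    using assms by (simp add: test_fun_def C1_differentiable_on_eq)
  show "\<phi> t = 0" if "t \<notin> {0<..<T}" for t
    using assms that closure_subset[of "{t. \<phi> t \<noteq> 0}"] by (auto simp: test_fun_def)
qed

lemma integrable_lebesgue_on_interval_continuous:
  fixes f :: "real \<Rightarrow> 'a::{banach,second_countable_topology}"
  assumes "continuous_on {a..b} f"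
  shows "integrable (lebesgue_on {a..b}) f"
proof -
  have "integrable lborel (\<lambda>x. indicator {a..b} x *\<^sub>R f x)"
    using borel_integrable_compact[OF compact_Icc assms] .
  then have "integrable lebesgue (\<lambda>x. indicator {a..b} x *\<^sub>R f x)"
    by (subst integrable_completion) auto
  then show ?thesis by (subst integrable_restrict_space) auto
qed

text \<open>The weak derivative is the limit of the forward quotients \<open>Q n\<close>, Borel as a
  limit of continuous functions. The weak formula is paired with a vector \<open>h\<close>, which
  reduces it to the integration of the derivative of the real function
  \<open>\<phi> t * (u t \<bullet> h)\<close>, zero at both ends.\<close>

lemma lipschitz_imp_W1inf:
  fixes u :: "real \<Rightarrow> 'h::{real_inner,banach,second_countable_topology}"
  assumes "T > 0" and lip: "\<And>s t. s \<in> {0..T} \<Longrightarrow> t \<in> {0..T} \<Longrightarrow> norm (u t - u s) \<le> M * \<bar>t - s\<bar>"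
  shows "W1inf T u"
proof -
  have M0: "M \<ge> 0" by (rule lipschitz_clamp_time(1)[OF \<open>T > 0\<close>]) (rule lip)
  define w where "w t = u (clamp_time T t)" for t
  have wu: "w t = u t" if "t \<in> {0..T}" for t using clamp_time(3)[OF \<open>T > 0\<close> that] by (simp add: w_def)
  have lip': "norm (w t - w s) \<le> M * \<bar>t - s\<bar>" for s t
    unfolding w_def by (rule lipschitz_clamp_time(2)[OF \<open>T > 0\<close>]) (rule lip)
  have wcont: "continuous_on X w" for X
    by (rule continuous_on_subset[OF lipschitz_on_continuous_on[of M UNIV]])
       (use lip' M0 in \<open>auto simp: lipschitz_on_def dist_norm\<close>)
  have ucont: "continuous_on {0..T} u"
    using wcont[of "{0..T}"] by (rule continuous_on_eq) (simp add: wu)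
  define Q where "Q n t = real (Suc n) *\<^sub>R (w (t + 1 / real (Suc n)) - w t)" for n t
  have Qcont: "continuous_on UNIV (Q n)" for n
    unfolding Q_def by (intro continuous_intros continuous_on_compose2[OF wcont[of UNIV]] wcont) auto
  \<comment> \<open>Where the quotients diverge, \<open>lim\<close> has an unspecified value but
    \<open>v\<close> stays measurable; in \<open>[0, T]\<close> such points lie in the null set
    \<open>N\<close> below.\<close>
  define v where "v t = lim (\<lambda>n. Q n t)" for t
  have vm: "v \<in> borel_measurable borel"
    unfolding v_def by (intro borel_measurable_lim_metric borel_measurable_continuous_onI Qcont)
  then have vm': "v \<in> borel_measurable (lebesgue_on {0..T})"
    by (simp add: measurable_restrict_space1 measurable_completion)
  have Qlim: "(\<lambda>n. Q n t) \<longlonglongrightarrow> l" if "(w has_vector_derivative l) (at t)" for t l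
    using filterlim_compose[OF that[unfolded has_vector_derivative_at_iff_quotient] filterlim_add_inverse_Suc_at]
    by (simp add: Q_def)
  have Qbd: "norm (Q n t) \<le> M" for n t
  proof -
    have "norm (Q n t) = real (Suc n) * norm (w (t + 1 / real (Suc n)) - w t)" unfolding Q_def by simp
    also have "\<dots> \<le> real (Suc n) * (M * (1 / real (Suc n)))"
      using lip'[of "t + 1 / real (Suc n)" t] by (intro mult_left_mono) auto
    finally show ?thesis by simp
  qed
  define N where "N = {t \<in> {0..T}. \<not> (t \<in> {0<..<T} \<and> (\<exists>l. (u has_vector_derivative l) (at t)))}"
  have N: "negligible N"
  proof -
    have "AE t in lebesgue_on {0..T}. t \<in> {0<..<T} \<and> (\<exists>l. (u has_vector_derivative l) (at t))"
      by (rule lipschitz_on_interval_differentiable_ae[OF \<open>T > 0\<close>]) (rule lip)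
    then show ?thesis unfolding N_def by (subst (asm) AE_lebesgue_on_iff_negligible) auto
  qed
  have v: "(w has_vector_derivative v t) (at t)" "norm (v t) \<le> M" if "t \<in> {0..T} - N" for t
  proof -
    have t: "t \<in> {0<..<T}" using that by (auto simp: N_def)
    have "\<exists>l. (u has_vector_derivative l) (at t)" using that by (auto simp: N_def)
    then obtain l where l: "(w has_vector_derivative l) (at t)"
      unfolding has_vector_derivative_clamp_iff[OF t, of u, symmetric] w_def[abs_def] by blast
    then have "v t = l" using limI[OF Qlim[OF l]] by (simp add: v_def)
    then show "(w has_vector_derivative v t) (at t)" "norm (v t) \<le> M"
      using l Lim_bounded[OF tendsto_norm[OF Qlim[OF l]]] Qbd by auto
  qed
  have AEv: "AE t in lebesgue_on {0..T}. norm (v t) \<le> M"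
    by (subst AE_lebesgue_on_iff_negligible) (use v in \<open>auto intro: negligible_subset[OF N]\<close>)
  have "(\<integral>t. deriv \<phi> t *\<^sub>R u t \<partial>lebesgue_on {0..T}) = - (\<integral>t. \<phi> t *\<^sub>R v t \<partial>lebesgue_on {0..T})"
    if \<phi>: "test_fun T \<phi>" for \<phi>
  proof -
    note \<phi>p = test_fun_properties[OF \<phi>]
    have \<phi>c: "continuous_on X \<phi>" for X
      using \<phi>p(1) by (meson DERIV_isCont continuous_at_imp_continuous_on)
    have \<phi>'c: "continuous_on X (deriv \<phi>)" for X using \<phi>p(2) continuous_on_subset by blast
    obtain K where K: "\<And>t. t \<in> {0..T} \<Longrightarrow> \<bar>\<phi> t\<bar> \<le> K" "\<And>t. t \<in> {0..T} \<Longrightarrow> \<bar>deriv \<phi> t\<bar> \<le> K" "\<And>t. t \<in> {0..T} \<Longrightarrow> norm (u t) \<le> K"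
    proof -
      have "bounded (\<phi> ` {0..T})" "bounded (deriv \<phi> ` {0..T})" "bounded (u ` {0..T})"
        using \<phi>c \<phi>'c ucont by (auto intro!: compact_imp_bounded compact_continuous_image)
      then obtain K1 K2 K3 where "\<forall>t\<in>{0..T}. \<bar>\<phi> t\<bar> \<le> K1" "\<forall>t\<in>{0..T}. \<bar>deriv \<phi> t\<bar> \<le> K2" "\<forall>t\<in>{0..T}. norm (u t) \<le> K3"
        by (auto simp: bounded_iff)
      then show ?thesis by (intro that[of "max K1 (max K2 K3)"]) fastforce+
    qed
    have K0: "K \<ge> 0" using K(1)[of 0] \<open>T > 0\<close> by simp
    have i1: "integrable (lebesgue_on {0..T}) (\<lambda>t. deriv \<phi> t *\<^sub>R u t)"
      by (intro integrable_lebesgue_on_interval_continuous continuous_intros \<phi>'c ucont)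
    have \<phi>m: "\<phi> \<in> borel_measurable (lebesgue_on {0..T})"
      by (intro continuous_imp_measurable_on_sets_lebesgue \<phi>c) auto
    have i2: "integrable (lebesgue_on {0..T}) (\<lambda>t. \<phi> t *\<^sub>R v t)"
    proof (rule Bochner_Integration.integrable_bound[of _ "\<lambda>_. K * M"])
      show "integrable (lebesgue_on {0..T}) (\<lambda>_. K * M)" by (intro integrable_lebesgue_on_interval_continuous continuous_intros)
      show "(\<lambda>t. \<phi> t *\<^sub>R v t) \<in> borel_measurable (lebesgue_on {0..T})" using \<phi>m vm' by (intro borel_measurable_scaleR)
      show "AE t in lebesgue_on {0..T}. norm (\<phi> t *\<^sub>R v t) \<le> norm (K * M)"
        using AEv AE_space[of "lebesgue_on {0..T}"]
        by eventually_elim (use K K0 M0 in \<open>auto intro!: mult_mono simp: abs_mult\<close>)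
    qed
    have "((\<integral>t. deriv \<phi> t *\<^sub>R u t \<partial>lebesgue_on {0..T}) + (\<integral>t. \<phi> t *\<^sub>R v t \<partial>lebesgue_on {0..T})) \<bullet> h = 0" for h
    proof -
      define r where "r t = \<phi> (clamp_time T t) * (w t \<bullet> h)" for t
      define D where "D t = (deriv \<phi> t *\<^sub>R u t + \<phi> t *\<^sub>R v t) \<bullet> h" for t
      have \<phi>lip: "\<bar>\<phi> t - \<phi> s\<bar> \<le> K * \<bar>t - s\<bar>" if "s \<in> {0..T}" "t \<in> {0..T}" for s t
        using field_differentiable_bound[of "{0..T}" \<phi> "deriv \<phi>" K t s] has_field_derivative_at_within[OF \<phi>p(1)] K(2) that
        by auto
      have rlip: "\<bar>r t - r s\<bar> \<le> (K * (K * norm h) + K * (M * norm h)) * \<bar>t - s\<bar>" for s t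
      proof -
        let ?c = "clamp_time T"
        have c: "?c s \<in> {0..T}" "?c t \<in> {0..T}" "\<bar>?c t - ?c s\<bar> \<le> \<bar>t - s\<bar>" using clamp_time[OF \<open>T > 0\<close>] by auto
        have "\<bar>\<phi> (?c t) - \<phi> (?c s)\<bar> \<le> K * \<bar>t - s\<bar>"
          using \<phi>lip[OF c(1,2)] c(3) K0 by (meson mult_left_mono order_trans)
        moreover have "\<bar>w t \<bullet> h\<bar> \<le> K * norm h"
          using Cauchy_Schwarz_ineq2[of "w t" h] K(3)[OF c(2)] mult_right_mono[of "norm (w t)" K "norm h"] by (simp add: w_def)
        ultimately have 1: "\<bar>(\<phi> (?c t) - \<phi> (?c s)) * (w t \<bullet> h)\<bar> \<le> (K * \<bar>t - s\<bar>) * (K * norm h)"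
          unfolding abs_mult using K0 by (intro mult_mono) auto
        have "\<bar>(w t - w s) \<bullet> h\<bar> \<le> M * \<bar>t - s\<bar> * norm h"
          using Cauchy_Schwarz_ineq2[of "w t - w s" h] mult_right_mono[OF lip'[of t s], of "norm h"] by simp
        then have 2: "\<bar>\<phi> (?c s) * ((w t - w s) \<bullet> h)\<bar> \<le> K * (M * \<bar>t - s\<bar> * norm h)"
          unfolding abs_mult using K(1)[OF c(1)] K0 by (intro mult_mono) auto
        have "r t - r s = (\<phi> (?c t) - \<phi> (?c s)) * (w t \<bullet> h) + \<phi> (?c s) * ((w t - w s) \<bullet> h)"
          by (simp add: r_def algebra_simps inner_diff_left)
        then have "\<bar>r t - r s\<bar> \<le> (K * \<bar>t - s\<bar>) * (K * norm h) + K * (M * \<bar>t - s\<bar> * norm h)"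
          using 1 2 by linarith
        then show ?thesis by (simp add: algebra_simps)
      qed
      have rD: "(r has_vector_derivative D t) (at t)" if "t \<in> {0..T} - N" for t
      proof -
        have t: "t \<in> {0<..<T}" using that by (auto simp: N_def)
        have "((\<lambda>t. w t \<bullet> h) has_vector_derivative (v t \<bullet> h)) (at t)"
          using bounded_linear.has_vector_derivative[OF bounded_linear_inner_left v(1)[OF that]] .
        then have "((\<lambda>t. \<phi> t * (w t \<bullet> h)) has_vector_derivative (\<phi> t * (v t \<bullet> h) + deriv \<phi> t * (w t \<bullet> h))) (at t)"
          using \<phi>p(1)[of t] by (intro has_vector_derivative_mult) (simp_all add: has_real_derivative_iff_has_vector_derivative)
        moreover have "\<forall>\<^sub>F s in nhds t. clamp_time T s = s"
          using eventually_nhds_in_open[of "{0<..<T}" t] t by (auto simp: clamp_time_def elim: eventually_mono)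
        ultimately have "(r has_vector_derivative (\<phi> t * (v t \<bullet> h) + deriv \<phi> t * (w t \<bullet> h))) (at t)"
          by (subst has_vector_derivative_cong_ev[where g = "\<lambda>t. \<phi> t * (w t \<bullet> h)"])
            (use t clamp_time(3)[OF \<open>T > 0\<close>, of t] in \<open>auto simp: r_def elim: eventually_mono\<close>)
        then show ?thesis using t wu[of t] by (simp add: D_def inner_add_left add.commute)
      qed
      have "r T = 0" "r 0 = 0"
        using \<phi>p(3)[of 0] \<phi>p(3)[of T] clamp_time(3)[OF \<open>T > 0\<close>] \<open>T > 0\<close> by (auto simp: r_def)
      then have D0: "(D has_integral 0) {0..T}"
        using lipschitz_has_integral_derivative[of r _ 0 T N D, OF rlip _ N rD] \<open>T > 0\<close> by simp
      have iD: "integrable (lebesgue_on {0..T}) D"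
        unfolding D_def by (intro integrable_inner_left Bochner_Integration.integrable_add i1 i2)
      have "(\<integral>t. D t \<partial>lebesgue_on {0..T}) = 0"
        using has_integral_integral_lebesgue_on[OF iD] D0 has_integral_unique by auto
      moreover have "(\<integral>t. D t \<partial>lebesgue_on {0..T}) = (\<integral>t. deriv \<phi> t *\<^sub>R u t + \<phi> t *\<^sub>R v t \<partial>lebesgue_on {0..T}) \<bullet> h"
        unfolding D_def by (intro integral_inner_left Bochner_Integration.integrable_add i1 i2)
      ultimately show ?thesis by (simp only: Bochner_Integration.integral_add[OF i1 i2])
    qed
    \<comment> \<open>Taking \<open>h\<close> to be the vector itself forces it to vanish.\<close>
    from this[of "(\<integral>t. deriv \<phi> t *\<^sub>R u t \<partial>lebesgue_on {0..T}) + (\<integral>t. \<phi> t *\<^sub>R v t \<partial>lebesgue_on {0..T})"]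
    show ?thesis by (simp add: eq_neg_iff_add_eq_0)
  qed
  then show ?thesis unfolding W1inf_def using ucont vm' AEv by blast
qed


section \<open>Bounded weak derivatives give Lipschitz bounds\<close>

lemma DERIV_max0_square: "((\<lambda>x::real. (max 0 x)\<^sup>2) has_real_derivative 2 * max 0 x) (at x)"
proof (cases x "0::real" rule: linorder_cases)
  case less
  have "\<forall>\<^sub>F y in nhds x. (max 0 y)\<^sup>2 = 0"
    using eventually_nhds_in_open[of "{..<0}" x] less by (auto elim: eventually_mono)
  from DERIV_cong_ev[OF refl this refl, of 0] show ?thesis using less by simp
next
  case greater
  have "\<forall>\<^sub>F y in nhds x. (max 0 y)\<^sup>2 = y\<^sup>2"
    using eventually_nhds_in_open[of "{0<..}" x] greater by (auto elim: eventually_mono)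
  from DERIV_cong_ev[OF refl this refl, of "2 * x"] show ?thesis
    using greater DERIV_power[OF DERIV_ident, of 2 x] by simp
next
  case equal
  have "((\<lambda>h::real. (max 0 h)\<^sup>2 / h) \<longlongrightarrow> 0) (at 0)"
  proof (rule Lim_null_comparison)
    show "\<forall>\<^sub>F h in at (0::real). norm ((max 0 h)\<^sup>2 / h) \<le> \<bar>h\<bar>"
      by (intro always_eventually) (auto simp: max_def power2_eq_square)
    show "((\<lambda>h::real. \<bar>h\<bar>) \<longlongrightarrow> 0) (at 0)" by (rule tendsto_eq_intros refl | simp)+
  qed
  then show ?thesis using equal by (simp add: DERIV_def)
qed

text \<open>\<open>smooth_step \<delta>\<close> is the second difference of \<open>x\<^sub>+\<^sup>2 / (2 \<delta>\<^sup>2)\<close>: a \<open>C\<^sup>1\<close> step from 0 to 1 whose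
  derivative is the hat function on \<open>[-\<delta>, \<delta>]\<close>.\<close>

definition smooth_step :: "real \<Rightarrow> real \<Rightarrow> real" where
  "smooth_step \<delta> x = ((max 0 (x + \<delta>))\<^sup>2 - 2 * (max 0 x)\<^sup>2 + (max 0 (x - \<delta>))\<^sup>2) / (2 * \<delta>\<^sup>2)"

definition hat_fun :: "real \<Rightarrow> real \<Rightarrow> real" where
  "hat_fun \<delta> x = (max 0 (x + \<delta>) - 2 * max 0 x + max 0 (x - \<delta>)) / \<delta>\<^sup>2"

lemma smooth_step:
  assumes "\<delta> > 0"
  shows "(smooth_step \<delta> has_real_derivative hat_fun \<delta> x) (at x)"
    "continuous_on X (hat_fun \<delta>)" "hat_fun \<delta> x \<ge> 0" "\<bar>x\<bar> \<ge> \<delta> \<Longrightarrow> hat_fun \<delta> x = 0"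
    "x \<le> - \<delta> \<Longrightarrow> smooth_step \<delta> x = 0" "x \<ge> \<delta> \<Longrightarrow> smooth_step \<delta> x = 1"
    "x \<le> y \<Longrightarrow> smooth_step \<delta> x \<le> smooth_step \<delta> y"
proof -
  have shift: "((\<lambda>x. (max 0 (x + c))\<^sup>2) has_real_derivative 2 * max 0 (x + c)) (at x)" for x c :: real
    by (rule DERIV_shift[THEN iffD1]) (rule DERIV_max0_square)
  have *: "(smooth_step \<delta> has_real_derivative hat_fun \<delta> x) (at x)" for x
  proof (rule DERIV_cong)
    show "(smooth_step \<delta> has_real_derivative
        (2 * max 0 (x + \<delta>) - 2 * (2 * max 0 x) + 2 * max 0 (x + - \<delta>)) / (2 * \<delta>\<^sup>2)) (at x)"
      unfolding smooth_step_def[abs_def] diff_conv_add_uminus[of _ \<delta>]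
      by (intro DERIV_cdivide DERIV_add DERIV_diff DERIV_cmult shift DERIV_max0_square)
  qed (use assms in \<open>simp add: hat_fun_def field_simps\<close>)
  then show "(smooth_step \<delta> has_real_derivative hat_fun \<delta> x) (at x)" .
  show "continuous_on X (hat_fun \<delta>)" unfolding hat_fun_def[abs_def] using assms by (intro continuous_intros) auto
  have nn: "hat_fun \<delta> x \<ge> 0" for x unfolding hat_fun_def using assms by (auto simp: max_def intro!: divide_nonneg_nonneg)
  then show "hat_fun \<delta> x \<ge> 0" .
  show "\<bar>x\<bar> \<ge> \<delta> \<Longrightarrow> hat_fun \<delta> x = 0" using assms by (auto simp: hat_fun_def max_def abs_if split: if_splits)
  show "x \<le> - \<delta> \<Longrightarrow> smooth_step \<delta> x = 0" using assms by (simp add: smooth_step_def)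
  show "smooth_step \<delta> x = 1" if "x \<ge> \<delta>"
  proof -
    have "smooth_step \<delta> x = ((x + \<delta>)\<^sup>2 - 2 * x\<^sup>2 + (x - \<delta>)\<^sup>2) / (2 * \<delta>\<^sup>2)" using assms that by (simp add: smooth_step_def)
    also have "(x + \<delta>)\<^sup>2 - 2 * x\<^sup>2 + (x - \<delta>)\<^sup>2 = 2 * \<delta>\<^sup>2" by (simp add: power2_eq_square algebra_simps)
    finally show ?thesis using assms by simp
  qed
  show "x \<le> y \<Longrightarrow> smooth_step \<delta> x \<le> smooth_step \<delta> y"
    by (rule DERIV_nonneg_imp_nondecreasing) (use * nn in blast)+
qed

text \<open>The hat functions form an approximate identity: nonnegative, supported within distance
  \<open>\<delta>\<close>, and of integral 1 because they are derivatives of a step from 0 to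
  1.\<close>

lemma integral_hat_fun_average:
  fixes w :: "real \<Rightarrow> real"
  assumes "\<delta> > 0" "\<delta> \<le> s" "s + \<delta> \<le> T" and w: "continuous_on {0..T} w"
    and close: "\<And>x. \<bar>x - s\<bar> \<le> \<delta> \<Longrightarrow> \<bar>w x - w s\<bar> \<le> \<epsilon>"
  shows "\<bar>integral {0..T} (\<lambda>x. hat_fun \<delta> (x - s) * w x) - w s\<bar> \<le> \<epsilon>"
proof -
  have hc: "continuous_on X (\<lambda>x. hat_fun \<delta> (x - s))" for X
    by (intro continuous_on_compose2[OF smooth_step(2)[OF \<open>\<delta> > 0\<close>, of UNIV]] continuous_intros) auto
  have "((\<lambda>x. hat_fun \<delta> (x - s)) has_integral (smooth_step \<delta> (T - s) - smooth_step \<delta> (0 - s))) {0..T}"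
  proof (rule fundamental_theorem_of_calculus)
    fix x
    have "((\<lambda>x. smooth_step \<delta> (x + - s)) has_real_derivative hat_fun \<delta> (x + - s)) (at x)"
      by (rule DERIV_shift[THEN iffD1]) (rule smooth_step(1)[OF \<open>\<delta> > 0\<close>])
    then show "((\<lambda>x. smooth_step \<delta> (x - s)) has_vector_derivative hat_fun \<delta> (x - s)) (at x within {0..T})"
      by (simp add: has_real_derivative_iff_has_vector_derivative has_vector_derivative_at_within)
  qed (use assms in auto)
  then have one: "((\<lambda>x. hat_fun \<delta> (x - s)) has_integral 1) {0..T}"
    using smooth_step(5,6)[OF \<open>\<delta> > 0\<close>] assms by simp
  have "integral {0..T} (\<lambda>x. hat_fun \<delta> (x - s) * w x) - w s
      = integral {0..T} (\<lambda>x. hat_fun \<delta> (x - s) * w x) - integral {0..T} (\<lambda>x. hat_fun \<delta> (x - s) * w s)"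
    using integral_unique[OF has_integral_mult_left[OF one, of "w s"]] by simp
  also have "\<dots> = integral {0..T} (\<lambda>x. hat_fun \<delta> (x - s) * (w x - w s))"
    by (subst Henstock_Kurzweil_Integration.integral_diff[symmetric])
      (auto intro!: integrable_continuous_real continuous_intros hc w simp: algebra_simps)
  also have "norm \<dots> \<le> integral {0..T} (\<lambda>x. hat_fun \<delta> (x - s) * \<epsilon>)"
  proof (rule integral_norm_bound_integral)
    fix x
    show "norm (hat_fun \<delta> (x - s) * (w x - w s)) \<le> hat_fun \<delta> (x - s) * \<epsilon>"
    proof (cases "\<bar>x - s\<bar> \<le> \<delta>")
      case True
      then show ?thesis
        using smooth_step(3)[OF \<open>\<delta> > 0\<close>, of "x - s"] close[OF True] by (simp add: abs_mult mult_left_mono)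
    next
      case False
      then show ?thesis using smooth_step(4)[OF \<open>\<delta> > 0\<close>, of "x - s"] by simp
    qed
  qed (auto intro!: integrable_continuous_real continuous_intros hc w)
  also have "\<dots> = \<epsilon>" using integral_unique[OF has_integral_mult_left[OF one, of "\<epsilon>"]] by simp
  finally show ?thesis by simp
qed

text \<open>A \<open>C\<^sup>1\<close> version of the indicator of \<open>[s, t]\<close>. Its
  derivative being a difference of two hats, the weak formula applied to it compares the averages of
  \<open>w\<close> near \<open>s\<close> and near \<open>t\<close>.\<close>

lemma smooth_step_difference_test_fun:
  assumes "\<delta> > 0" "\<delta> < s" "s < t" "t + \<delta> < T"
  defines "\<phi> \<equiv> \<lambda>x. smooth_step \<delta> (x - s) - smooth_step \<delta> (x - t)"
  shows "test_fun T \<phi>" "deriv \<phi> x = hat_fun \<delta> (x - s) - hat_fun \<delta> (x - t)"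
    "0 \<le> \<phi> x" "\<phi> x \<le> indicator {s - \<delta>..t + \<delta>} x"
proof -
  have d: "(\<phi> has_real_derivative (hat_fun \<delta> (x - s) - hat_fun \<delta> (x - t))) (at x)" for x
  proof -
    have "((\<lambda>x. smooth_step \<delta> (x + - c)) has_real_derivative hat_fun \<delta> (x + - c)) (at x)" for c
      by (rule DERIV_shift[THEN iffD1]) (rule smooth_step(1)[OF \<open>\<delta> > 0\<close>])
    from DERIV_diff[OF this[of s] this[of t]] show ?thesis by (simp add: \<phi>_def)
  qed
  then show "deriv \<phi> x = hat_fun \<delta> (x - s) - hat_fun \<delta> (x - t)" by (rule DERIV_imp_deriv)
  have hc: "continuous_on UNIV (\<lambda>x. hat_fun \<delta> (x - c))" for c
    by (intro continuous_on_compose2[OF smooth_step(2)[OF \<open>\<delta> > 0\<close>, of UNIV]] continuous_intros) auto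
  have C1: "\<phi> C1_differentiable_on UNIV"
    unfolding C1_differentiable_on_def
    by (intro exI[of _ "\<lambda>x. hat_fun \<delta> (x - s) - hat_fun \<delta> (x - t)"] conjI ballI continuous_intros hc)
      (use d in \<open>simp add: has_real_derivative_iff_has_vector_derivative\<close>)
  have out: "\<phi> x = 0" if "x \<notin> {s - \<delta>..t + \<delta>}" for x
    using that assms(1-4) smooth_step(5,6)[OF \<open>\<delta> > 0\<close>, of "x - s"] smooth_step(5,6)[OF \<open>\<delta> > 0\<close>, of "x - t"]
    by (auto simp: \<phi>_def not_le)
  have "closure {x. \<phi> x \<noteq> 0} \<subseteq> {s - \<delta>..t + \<delta>}" by (intro closure_minimal) (use out in blast)+
  then show "test_fun T \<phi>" using C1 assms(1-4) by (auto simp: test_fun_def)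
  show "0 \<le> \<phi> x" using smooth_step(7)[OF \<open>\<delta> > 0\<close>, of "x - t" "x - s"] \<open>s < t\<close> by (simp add: \<phi>_def)
  have "smooth_step \<delta> (x - s) \<le> smooth_step \<delta> (max \<delta> (x - s))" "smooth_step \<delta> (min (- \<delta>) (x - t)) \<le> smooth_step \<delta> (x - t)"
    by (intro smooth_step(7)[OF \<open>\<delta> > 0\<close>]; simp)+
  then have "\<phi> x \<le> 1"
    using smooth_step(6)[OF \<open>\<delta> > 0\<close>, of "max \<delta> (x - s)"] smooth_step(5)[OF \<open>\<delta> > 0\<close>, of "min (- \<delta>) (x - t)"] by (simp add: \<phi>_def)
  then show "\<phi> x \<le> indicator {s - \<delta>..t + \<delta>} x" using out[of x] by (auto simp: indicator_def)
qed

text \<open>The Bochner integral of a non-integrable function is 0, so the right-hand side of the weak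
  formula is controlled even if \<open>\<phi> v\<close> is not integrable.\<close>

lemma bounded_weak_derivative_imp_lipschitz:
  fixes w v :: "real \<Rightarrow> real"
  assumes "T > 0" and w: "continuous_on {0..T} w" and B: "B \<ge> 0" "AE t in lebesgue_on {0..T}. \<bar>v t\<bar> \<le> B"
    and weak: "\<And>\<phi>. test_fun T \<phi> \<Longrightarrow>
      (\<integral>t. deriv \<phi> t * w t \<partial>lebesgue_on {0..T}) = - (\<integral>t. \<phi> t * v t \<partial>lebesgue_on {0..T})"
    and st: "s \<in> {0..T}" "t \<in> {0..T}"
  shows "\<bar>w t - w s\<bar> \<le> B * \<bar>t - s\<bar>"
proof -
  have inner: "\<bar>w t - w s\<bar> \<le> B * (t - s)" if "0 < s" "s < t" "t < T" for s t
  proof (rule field_le_epsilon)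
    fix e :: real assume "e > 0"
    \<comment> \<open>A quarter: two shares for the overhang of the support beyond
      \<open>[s, t]\<close>, one for each of the two hat averages.\<close>
    define \<epsilon> where "\<epsilon> = e / 4"
    have "\<epsilon> > 0" using \<open>e > 0\<close> by (simp add: \<epsilon>_def)
    have "isCont w s" "isCont w t" using w that by (auto intro!: continuous_on_interior)
    then obtain d1 d2 where d: "d1 > 0" "d2 > 0" "\<And>x. \<bar>x - s\<bar> < d1 \<Longrightarrow> \<bar>w x - w s\<bar> < \<epsilon>"
      "\<And>x. \<bar>x - t\<bar> < d2 \<Longrightarrow> \<bar>w x - w t\<bar> < \<epsilon>"
      using \<open>\<epsilon> > 0\<close> unfolding continuous_at_eps_delta dist_real_def by metis
    \<comment> \<open>The halves make the later inequalities strict; the last entry keeps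
      \<open>B * \<delta>\<close> below \<open>\<epsilon>\<close>, with \<open>B + 1\<close>
      avoiding a division by 0.\<close>
    define \<delta> where "\<delta> = min (min (d1 / 2) (d2 / 2)) (min (min (s / 2) ((T - t) / 2)) (\<epsilon> / (B + 1)))"
    have \<delta>: "\<delta> > 0" "\<delta> < d1" "\<delta> < d2" "\<delta> < s" "t + \<delta> < T" "\<delta> \<le> \<epsilon> / (B + 1)"
    proof -
      have "\<delta> \<le> d1 / 2" "\<delta> \<le> d2 / 2" "\<delta> \<le> s / 2" and Tt: "\<delta> \<le> (T - t) / 2" and eB: "\<delta> \<le> \<epsilon> / (B + 1)"
        unfolding \<delta>_def by (meson min.cobounded1 min.cobounded2 order_trans)+
      then show "\<delta> < d1" "\<delta> < d2" "\<delta> < s" using d(1,2) that by linarith+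
      show "t + \<delta> < T" using Tt \<open>t < T\<close> by (simp add: field_simps)
      show "\<delta> \<le> \<epsilon> / (B + 1)" by (rule eB)
      show "\<delta> > 0" using d that \<open>\<epsilon> > 0\<close> B by (simp add: \<delta>_def)
    qed
    have "B * \<delta> \<le> (B + 1) * \<delta>" using \<delta> by (simp add: algebra_simps)
    also have "\<dots> \<le> \<epsilon>" using \<delta>(6) B by (simp add: pos_le_divide_eq mult.commute)
    finally have B\<delta>: "B * \<delta> \<le> \<epsilon>" .
    define \<phi> where "\<phi> = (\<lambda>x. smooth_step \<delta> (x - s) - smooth_step \<delta> (x - t))"
    note \<phi> = smooth_step_difference_test_fun[OF \<delta>(1) \<delta>(4) \<open>s < t\<close> \<delta>(5), folded \<phi>_def]
    have \<phi>b: "0 \<le> \<phi> x" "\<phi> x \<le> indicator {s - \<delta>..t + \<delta>} x" for x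
      using \<phi>(3,4)[of x] by (simp_all add: \<phi>_def)
    have hc: "continuous_on {0..T} (\<lambda>x. hat_fun \<delta> (x - c) * w x)" for c
      by (intro continuous_intros w continuous_on_compose2[OF smooth_step(2)[OF \<delta>(1), of UNIV]]) auto
    let ?J = "\<lambda>c. integral {0..T} (\<lambda>x. hat_fun \<delta> (x - c) * w x)"
    have "(\<integral>x. deriv \<phi> x * w x \<partial>lebesgue_on {0..T}) = ?J s - ?J t"
    proof -
      have "continuous_on {0..T} (\<lambda>x. deriv \<phi> x * w x)"
        using continuous_on_diff[OF hc[of s] hc[of t]] by (simp add: \<phi>(2) left_diff_distrib)
      then have "(\<integral>x. deriv \<phi> x * w x \<partial>lebesgue_on {0..T}) = integral {0..T} (\<lambda>x. deriv \<phi> x * w x)"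
        by (intro lebesgue_integral_eq_integral integrable_lebesgue_on_interval_continuous) auto
      also have "\<dots> = ?J s - ?J t"
        unfolding \<phi>(2) left_diff_distrib
        by (intro Henstock_Kurzweil_Integration.integral_diff integrable_continuous_real hc)
      finally show ?thesis .
    qed
    then have JJ: "?J s - ?J t = - (\<integral>x. \<phi> x * v x \<partial>lebesgue_on {0..T})" using weak[OF \<phi>(1)] by simp
    have "\<bar>\<integral>x. \<phi> x * v x \<partial>lebesgue_on {0..T}\<bar> \<le> B * (t - s + 2 * \<delta>)"
    proof (cases "integrable (lebesgue_on {0..T}) (\<lambda>x. \<phi> x * v x)")
      case False
      then show ?thesis using B that \<delta> by (simp add: not_integrable_integral_eq)
    next
      case True
      have sub: "{s - \<delta>..t + \<delta>} \<subseteq> {0..T}" using \<delta> that by auto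
      have em: "emeasure lborel {s - \<delta>..t + \<delta>} < top" using \<delta> that by simp
      have "\<bar>\<integral>x. \<phi> x * v x \<partial>lebesgue_on {0..T}\<bar> \<le> (\<integral>x. \<bar>\<phi> x * v x\<bar> \<partial>lebesgue_on {0..T})"
        by (rule integral_abs_bound)
      also have "\<dots> \<le> (\<integral>x. B * indicator {s - \<delta>..t + \<delta>} x \<partial>lebesgue_on {0..T})"
      proof (rule integral_mono_AE)
        show "integrable (lebesgue_on {0..T}) (\<lambda>x. \<bar>\<phi> x * v x\<bar>)" using True by (rule integrable_abs)
        show "integrable (lebesgue_on {0..T}) (\<lambda>x. B * indicator {s - \<delta>..t + \<delta>} x)"
          by (intro integrable_mult_right integrable_real_indicator)
            (use sub em in \<open>auto simp: sets_restrict_space_iff emeasure_restrict_space\<close>)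
        show "AE x in lebesgue_on {0..T}. \<bar>\<phi> x * v x\<bar> \<le> B * indicator {s - \<delta>..t + \<delta>} x"
          using B(2)
        proof eventually_elim
          case (elim x)
          have "\<bar>\<phi> x\<bar> * \<bar>v x\<bar> \<le> indicator {s - \<delta>..t + \<delta>} x * B"
            using \<phi>b[of x] elim by (intro mult_mono) auto
          then show ?case by (simp add: abs_mult mult.commute)
        qed
      qed
      also have "\<dots> = B * measure (lebesgue_on {0..T}) {s - \<delta>..t + \<delta>}" 
      proof -
        have "max (s - \<delta>) 0 = s - \<delta>" "min (t + \<delta>) T = t + \<delta>" using \<delta> that by auto
        then show ?thesis by simp
      qed
      also have "measure (lebesgue_on {0..T}) {s - \<delta>..t + \<delta>} = t - s + 2 * \<delta>"
        using sub \<delta> that by (simp add: measure_restrict_space)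
      finally show ?thesis .
    qed
    then have "\<bar>?J s - ?J t\<bar> \<le> B * (t - s) + 2 * \<epsilon>" using JJ B\<delta> by (simp add: algebra_simps)
    moreover have "\<bar>?J s - w s\<bar> \<le> \<epsilon>" "\<bar>?J t - w t\<bar> \<le> \<epsilon>"
      using \<delta> that d by (intro integral_hat_fun_average w less_imp_le[OF d(3)] less_imp_le[OF d(4)]; force)+
    ultimately show "\<bar>w t - w s\<bar> \<le> B * (t - s) + e" unfolding \<epsilon>_def by linarith
  qed
  have inner': "\<bar>w t - w s\<bar> \<le> B * \<bar>t - s\<bar>" if "s \<in> {0<..<T}" "t \<in> {0<..<T}" for s t
    using inner[of s t] inner[of t s] that by (cases s t rule: linorder_cases) (auto simp: abs_minus_commute)
  \<comment> \<open>Points are pulled towards the midpoint, so that the ends of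
    \<open>[0, T]\<close> are reached by continuity.\<close>
  define c where "c k x = x + (T / 2 - x) * (1 / real (Suc (Suc k)))" for k :: nat and x
  have cin: "c k x \<in> {0<..<T}" if "x \<in> {0..T}" for k x
  proof -
    define \<theta> where "\<theta> = 1 / real (Suc (Suc k))"
    have \<theta>: "0 < \<theta>" "\<theta> < 1" by (auto simp: \<theta>_def)
    have "c k x = x + (T / 2 - x) * \<theta>" by (simp only: c_def \<theta>_def)
    then have ck: "c k x = (1 - \<theta>) * x + \<theta> * T / 2" by (simp add: algebra_simps)
    have "0 \<le> (1 - \<theta>) * x" "(1 - \<theta>) * x \<le> (1 - \<theta>) * T" "0 < \<theta> * T"
      using that \<theta> \<open>T > 0\<close> by (auto intro!: mult_left_mono)
    moreover have "(1 - \<theta>) * T + \<theta> * T = T" by (simp add: algebra_simps)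
    ultimately show ?thesis unfolding ck greaterThanLessThan_iff by linarith
  qed
  have clim: "(\<lambda>k. c k x) \<longlonglongrightarrow> x" for x
  proof -
    have "(\<lambda>k. x + (T / 2 - x) * (1 / real (Suc (Suc k)))) \<longlonglongrightarrow> x + (T / 2 - x) * 0"
      by (intro tendsto_intros LIMSEQ_Suc[OF LIMSEQ_Suc[OF lim_1_over_n]])
    then show ?thesis by (simp add: c_def)
  qed
  have wlim: "(\<lambda>k. w (c k x)) \<longlonglongrightarrow> w x" if "x \<in> {0..T}" for x
    using w that cin[OF that]
    by (intro continuous_on_tendsto_compose[OF w clim that]) (auto intro!: always_eventually less_imp_le)
  show ?thesis
  proof (rule LIMSEQ_le)
    show "(\<lambda>k. \<bar>w (c k t) - w (c k s)\<bar>) \<longlonglongrightarrow> \<bar>w t - w s\<bar>" by (intro tendsto_intros wlim st)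
    show "(\<lambda>k. B * \<bar>c k t - c k s\<bar>) \<longlonglongrightarrow> B * \<bar>t - s\<bar>" by (intro tendsto_intros clim)
  qed (use inner' cin st in blast)
qed

text \<open>The scalar result is applied to the pairing with \<open>h = u t - u s\<close>; one
  factor \<open>norm h\<close> then cancels.\<close>

lemma W1inf_imp_lipschitz:
  fixes u :: "real \<Rightarrow> 'h::{real_inner,banach,second_countable_topology}"
  assumes "T > 0" "W1inf T u"
  shows "\<exists>B\<ge>0. \<forall>s\<in>{0..T}. \<forall>t\<in>{0..T}. norm (u t - u s) \<le> B * \<bar>t - s\<bar>"
proof -
  obtain v B0 where uc: "continuous_on {0..T} u" and vm: "v \<in> borel_measurable (lebesgue_on {0..T})"
    and B0: "AE t in lebesgue_on {0..T}. norm (v t) \<le> B0"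
    and weak: "\<And>\<phi>. test_fun T \<phi> \<Longrightarrow> (\<integral>t. deriv \<phi> t *\<^sub>R u t \<partial>lebesgue_on {0..T}) = - (\<integral>t. \<phi> t *\<^sub>R v t \<partial>lebesgue_on {0..T})"
    using assms(2) unfolding W1inf_def by blast
  define B where "B = max B0 0"
  have B: "B \<ge> 0" "AE t in lebesgue_on {0..T}. norm (v t) \<le> B"
    using B0 by (auto simp: B_def elim: eventually_mono)
  have "norm (u t - u s) \<le> B * \<bar>t - s\<bar>" if st: "s \<in> {0..T}" "t \<in> {0..T}" for s t
  proof -
    define h where "h = u t - u s"
    have "\<bar>u t \<bullet> h - u s \<bullet> h\<bar> \<le> (B * norm h) * \<bar>t - s\<bar>"
    proof (rule bounded_weak_derivative_imp_lipschitz[OF \<open>T > 0\<close> _ _ _ _ st])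
      show "continuous_on {0..T} (\<lambda>t. u t \<bullet> h)" by (intro continuous_intros uc)
      show "0 \<le> B * norm h" using B by simp
      show "AE t in lebesgue_on {0..T}. \<bar>v t \<bullet> h\<bar> \<le> B * norm h"
        using B(2) by eventually_elim (meson Cauchy_Schwarz_ineq2 mult_right_mono norm_ge_zero order_trans)
      fix \<phi> assume \<phi>: "test_fun T \<phi>"
      note \<phi>p = test_fun_properties[OF \<phi>]
      have \<phi>c: "continuous_on X \<phi>" for X
        using \<phi>p(1) by (meson DERIV_isCont continuous_at_imp_continuous_on)
      have i1: "integrable (lebesgue_on {0..T}) (\<lambda>t. deriv \<phi> t *\<^sub>R u t)"
        by (intro integrable_lebesgue_on_interval_continuous continuous_intros continuous_on_subset[OF \<phi>p(2)] uc) auto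
      have i2: "integrable (lebesgue_on {0..T}) (\<lambda>t. \<phi> t *\<^sub>R v t)"
      proof (rule Bochner_Integration.integrable_bound[of _ "\<lambda>t. B * \<phi> t"])
        show "integrable (lebesgue_on {0..T}) (\<lambda>t. B * \<phi> t)"
          by (intro integrable_lebesgue_on_interval_continuous continuous_intros \<phi>c)
        show "(\<lambda>t. \<phi> t *\<^sub>R v t) \<in> borel_measurable (lebesgue_on {0..T})"
          by (intro borel_measurable_scaleR vm continuous_imp_measurable_on_sets_lebesgue \<phi>c) auto
        show "AE t in lebesgue_on {0..T}. norm (\<phi> t *\<^sub>R v t) \<le> norm (B * \<phi> t)"
          using B(2)
        proof eventually_elim
          case (elim t)
          then have "\<bar>\<phi> t\<bar> * norm (v t) \<le> \<bar>\<phi> t\<bar> * B" by (intro mult_left_mono) auto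
          then show ?case using B(1) by (simp add: abs_mult mult.commute)
        qed
      qed
      have "(\<integral>t. (deriv \<phi> t *\<^sub>R u t) \<bullet> h \<partial>lebesgue_on {0..T}) = (\<integral>t. deriv \<phi> t *\<^sub>R u t \<partial>lebesgue_on {0..T}) \<bullet> h"
        using i1 by (intro integral_inner_left) auto
      moreover have "(\<integral>t. (\<phi> t *\<^sub>R v t) \<bullet> h \<partial>lebesgue_on {0..T}) = (\<integral>t. \<phi> t *\<^sub>R v t \<partial>lebesgue_on {0..T}) \<bullet> h"
        using i2 by (intro integral_inner_left) auto
      ultimately show "(\<integral>t. deriv \<phi> t * (u t \<bullet> h) \<partial>lebesgue_on {0..T}) = - (\<integral>t. \<phi> t * (v t \<bullet> h) \<partial>lebesgue_on {0..T})"
        using weak[OF \<phi>] by simp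
    qed
    then have "norm h * norm h \<le> norm h * (B * \<bar>t - s\<bar>)"
    proof -
      have "u t \<bullet> h - u s \<bullet> h = norm h * norm h" by (simp add: h_def inner_diff_left[symmetric] dot_square_norm power2_eq_square)
      then show ?thesis using \<open>\<bar>u t \<bullet> h - u s \<bullet> h\<bar> \<le> (B * norm h) * \<bar>t - s\<bar>\<close> by (simp add: mult_ac)
    qed
    then show ?thesis unfolding h_def using B(1)
      by (cases "norm (u t - u s) = 0") (auto simp: mult_le_cancel_left)
  qed
  then show ?thesis using B(1) by blast
qed

section \<open>The catching-up algorithm\<close>

text \<open>Linear regularity of \<open>V\<close> and a translate of \<open>\<Sigma>\<close>. The
  segment from \<open>y\<close> to the Slater point \<open>x0\<close> stays in \<open>V\<close>; its
  point \<open>c\<close> is, up to the shift by \<open>s\<close>, also a convex combination of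
  \<open>a\<close> and a point of the Slater ball, hence admissible. The weight
  \<open>\<theta>\<close> balances the gap \<open>d\<close> against the radius
  \<open>r\<close>.\<close>

lemma slater_distance_estimate:
  fixes V \<Sigma> :: "'h::real_normed_vector set"
  assumes V: "subspace V" and \<Sigma>: "convex \<Sigma>" "\<And>a b. a \<in> \<Sigma> \<Longrightarrow> b \<in> \<Sigma> \<Longrightarrow> norm (a - b) \<le> D"
    and r: "0 < r" "r \<le> D" and x0: "x0 \<in> V" "cball (x0 + s) r \<subseteq> \<Sigma>"
    and y: "y \<in> V" and a: "a + s \<in> \<Sigma>"
  shows "\<exists>c\<in>V. c + s \<in> \<Sigma> \<and> norm (y - c) \<le> (D / r) * norm (y - a)"
proof (cases "y = a")
  case True
  then show ?thesis using y a by auto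
next
  case False
  define d where "d = norm (y - a)"
  have d: "d > 0" using False by (simp add: d_def)
  define \<theta> where "\<theta> = d / (r + d)"
  have \<theta>: "0 < \<theta>" "\<theta> < 1" using d r by (auto simp: \<theta>_def)
  define c where "c = (1 - \<theta>) *\<^sub>R y + \<theta> *\<^sub>R x0"
  have "c \<in> V" unfolding c_def using V y x0 by (intro subspace_add subspace_scale)
  \<comment> \<open>The point of the Slater ball furthest in the direction \<open>y - a\<close>; in
    the convex combination it turns \<open>a\<close> into \<open>y\<close>.\<close>
  define b where "b = x0 + s + (r / d) *\<^sub>R (y - a)"
  have "norm ((r / d) *\<^sub>R (y - a)) = r" using d r by (simp add: d_def)
  then have "b \<in> \<Sigma>" using x0(2) by (auto simp: b_def dist_norm norm_minus_commute)
  have "(1 - \<theta>) = r / (r + d)" using d r by (simp add: \<theta>_def field_simps)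
  then have eq: "\<theta> * (r / d) = 1 - \<theta>" using d r by (simp add: \<theta>_def)
  have "(1 - \<theta>) *\<^sub>R (a + s) + \<theta> *\<^sub>R b = (1 - \<theta>) *\<^sub>R (a + s) + \<theta> *\<^sub>R (x0 + s) + (\<theta> * (r / d)) *\<^sub>R (y - a)"
    by (simp add: b_def scaleR_add_right)
  also have "\<dots> = c + s" unfolding eq c_def by (simp add: algebra_simps)
  finally have "c + s \<in> \<Sigma>"
    using convexD[OF \<Sigma>(1) a \<open>b \<in> \<Sigma>\<close>, of "1 - \<theta>" \<theta>] \<theta> by simp
  moreover have "norm (y - c) \<le> (D / r) * d"
  proof -
    have "x0 + s \<in> \<Sigma>" using x0(2) r by auto
    then have "norm (a - x0) \<le> D" using \<Sigma>(2)[OF a] by fastforce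
    then have "norm (y - x0) \<le> d + D" using norm_triangle_ineq[of "y - a" "a - x0"] by (simp add: d_def)
    moreover have "y - c = \<theta> *\<^sub>R (y - x0)" by (simp add: c_def algebra_simps)
    ultimately have "norm (y - c) \<le> \<theta> * (d + D)" using \<theta> by simp
    also have "\<dots> = d * ((d + D) / (r + d))" by (simp add: \<theta>_def)
    also have "\<dots> \<le> d * (D / r)"
    proof (intro mult_left_mono)
      have "(d + D) * r \<le> D * (r + d)" using r d by (simp add: algebra_simps mult_left_mono)
      then show "(d + D) / (r + d) \<le> D / r" using r d by (simp add: field_simps)
    qed (use d in simp)
    finally show ?thesis by (simp add: mult.commute)
  qed
  ultimately show ?thesis using \<open>c \<in> V\<close> by (auto simp: d_def)
qed

text \<open>The variational inequality characterises \<open>x'\<close> as a projection of \<open>x\<close> only for \<open>x' \<in> B\<close>; here \<open>x'\<close> may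
  lie outside \<open>B\<close>.\<close>

lemma variational_inequality_perturbation:
  fixes w x x' :: "'h::real_inner"
  assumes VI: "(x - x') \<bullet> (b - x') \<le> 0" and "norm (w - b) \<le> d" "norm (x - x') \<le> e"
  shows "(norm (w - x'))\<^sup>2 \<le> (norm (w - x))\<^sup>2 + 2 * d * e"
proof -
  have "(norm (w - x'))\<^sup>2 = (norm (w - x))\<^sup>2 - (norm (x - x'))\<^sup>2 + 2 * ((w - b) \<bullet> (x - x')) + 2 * ((x - x') \<bullet> (b - x'))"
    unfolding power2_norm_eq_inner by (simp add: algebra_simps inner_commute)
  moreover have "(w - b) \<bullet> (x - x') \<le> d * e"
  proof -
    have "(w - b) \<bullet> (x - x') \<le> norm (w - b) * norm (x - x')" by (rule norm_cauchy_schwarz)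
    also have "\<dots> \<le> d * e" using assms norm_ge_zero order_trans by (intro mult_mono) blast+
    finally show ?thesis .
  qed
  moreover have "0 \<le> (norm (x - x'))\<^sup>2" by simp
  ultimately show ?thesis using VI by linarith
qed

text \<open>The problem in the plain Hilbert space, after transport by the isometry.
  \<open>s\<close> is given for all real times, which the clamped stress provides, and the Slater
  radius \<open>r\<close> does not depend on time.\<close>

locale sweeping_data =
  fixes V \<Sigma> :: "'h::{real_inner,banach} set" and s :: "real \<Rightarrow> 'h" and D r Ls :: real
  assumes V: "subspace V" "closed V" and \<Sigma>: "closed \<Sigma>" "convex \<Sigma>"
    and D: "\<And>a b. a \<in> \<Sigma> \<Longrightarrow> b \<in> \<Sigma> \<Longrightarrow> norm (a - b) \<le> D"
    and r: "0 < r" "r \<le> D" and slater: "\<And>t. \<exists>x\<in>V. cball (x + s t) r \<subseteq> \<Sigma>"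
    and Ls: "\<And>t t'. norm (s t - s t') \<le> Ls * \<bar>t - t'\<bar>"
begin

section \<open>Moving sets and their constants\<close>

definition A :: "real \<Rightarrow> 'h set" where "A t = {x. x + s t \<in> \<Sigma>}"
definition K :: "real \<Rightarrow> 'h set" where "K t = V \<inter> A t"
text \<open>Linear regularity constant of \<open>V\<close> and \<open>A t\<close>: diameter bound
  over Slater radius.\<close>

definition \<kappa> :: real where "\<kappa> = D / r"
definition L :: real where "L = \<kappa> * Ls"

lemma \<kappa>: "1 \<le> \<kappa>" using r by (simp add: \<kappa>_def)

lemma Ls0: "0 \<le> Ls" using order_trans[OF norm_ge_zero Ls[of 1 0]] by simp

lemma L0: "0 \<le> L" using \<kappa> Ls0 by (simp add: L_def)

lemma A_props: "closed (A t)" "convex (A t)" "A t \<noteq> {}"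
proof -
  have eq: "A t = (\<lambda>x. - s t + x) ` \<Sigma>"
    by (auto simp: A_def image_iff intro!: bexI[of _ "_ + s t"])
  show "convex (A t)" unfolding eq by (intro convex_translation \<Sigma>)
  have "A t = (\<lambda>x. x + s t) -` \<Sigma>" by (auto simp: A_def)
  then show "closed (A t)" using \<Sigma>(1) by (auto intro!: closed_vimage continuous_intros)
  obtain x where x: "x \<in> V" "cball (x + s t) r \<subseteq> \<Sigma>" using slater by blast
  then have "x + s t \<in> \<Sigma>" using r by auto
  then show "A t \<noteq> {}" by (auto simp: A_def)
qed

lemma K_props: "closed (K t)" "convex (K t)" "K t \<noteq> {}"
proof -
  show "closed (K t)" "convex (K t)"
    unfolding K_def using A_props V by (auto intro: convex_Int subspace_imp_convex)
  obtain x where x: "x \<in> V" "cball (x + s t) r \<subseteq> \<Sigma>" using slater by blast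
  then have "x + s t \<in> \<Sigma>" using r by auto
  then show "K t \<noteq> {}" using x by (auto simp: A_def K_def)
qed

lemma K_near: 
  assumes "y \<in> V" "a \<in> A t"
  shows "\<exists>c\<in>K t. norm (y - c) \<le> \<kappa> * norm (y - a)"
proof -
  obtain x where "x \<in> V" "cball (x + s t) r \<subseteq> \<Sigma>" using slater by blast
  from slater_distance_estimate[OF V(1) \<Sigma>(2) D r this assms(1), of a] show ?thesis
    using assms(2) by (auto simp: K_def A_def \<kappa>_def)
qed

text \<open>Moving \<open>y\<close> by \<open>s t - s t'\<close> reaches \<open>A t'\<close> but may
  leave \<open>V\<close>; linear regularity repairs this at the price of the factor
  \<open>\<kappa>\<close>.\<close>

lemma K_lipschitz:
  assumes "y \<in> K t"
  shows "\<exists>c\<in>K t'. norm (y - c) \<le> L * \<bar>t - t'\<bar>"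
proof -
  have "y + s t - s t' \<in> A t'" "y \<in> V" using assms by (auto simp: K_def A_def)
  then obtain c where c: "c \<in> K t'" "norm (y - c) \<le> \<kappa> * norm (y - (y + s t - s t'))" using K_near by blast
  have "norm (y - (y + s t - s t')) \<le> Ls * \<bar>t - t'\<bar>" using Ls[of t' t] by (simp add: abs_minus_commute)
  then have "\<kappa> * norm (y - (y + s t - s t')) \<le> L * \<bar>t - t'\<bar>"
    using \<kappa> by (simp add: L_def mult.assoc mult_left_mono)
  then show ?thesis using c order_trans by blast
qed

text \<open>Contraction factor of one alternating projection, measured by the distance to
  \<open>K t\<close>.\<close>

definition rate :: real where "rate = sqrt (1 - 1 / \<kappa>\<^sup>2)"
text \<open>Fixed point of the map from x to \<open>rate * x + L\<close>: the distance to
  \<open>K\<close>, per unit of step size, at which contraction and drift balance.\<close>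

definition M :: real where "M = L / (1 - rate)"

lemma rate: "0 \<le> rate" "rate < 1" "rate\<^sup>2 = 1 - 1 / \<kappa>\<^sup>2"
proof -
  have "1 \<le> \<kappa>\<^sup>2" using \<kappa> by (simp add: one_le_power)
  then have "0 < 1 / \<kappa>\<^sup>2" "1 / \<kappa>\<^sup>2 \<le> 1" by (auto simp: divide_le_eq_1)
  then show "0 \<le> rate" "rate < 1" "rate\<^sup>2 = 1 - 1 / \<kappa>\<^sup>2" by (auto simp: rate_def)
qed

lemma M: "0 \<le> M" "rate * M + L = M"
proof -
  show "0 \<le> M" using L0 rate by (simp add: M_def)
  show "rate * M + L = M" using rate by (simp add: M_def field_simps)
qed

text \<open>One step is the alternating projection \<open>y \<mapsto> P\<^sub>V (P\<^sub>A y)\<close>: unlike the projection on \<open>K = V \<inter> A\<close> it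
  comes with an explicit normal vector \<open>y - P\<^sub>A y\<close> of \<open>A\<close>, and it still satisfies the variational
  inequality for \<open>K\<close>.\<close>

definition step :: "real \<Rightarrow> 'h \<Rightarrow> 'h" where "step t y = cproj V (cproj (A t) y)"

text \<open>For the last clause, projecting onto \<open>A t\<close> lowers the squared distance to
  \<open>c\<close>, the point of \<open>K t\<close> nearest to \<open>y\<close>, by the square of
  \<open>norm n\<close>. Linear regularity bounds \<open>norm (y - c)\<close> by
  \<open>\<kappa> * norm n\<close>, so a fixed fraction is lost, and projecting back onto
  \<open>V\<close> does not increase the distance.\<close>

lemma step:
  assumes y: "y \<in> V" and near: "c0 \<in> K t" "norm (y - c0) \<le> M * \<tau>" and "0 \<le> \<tau>"
  defines "n \<equiv> y - cproj (A t) y"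
  shows "step t y \<in> V" "norm n \<le> M * \<tau>" "norm (y - step t y) \<le> M * \<tau>"
    "c \<in> K t \<Longrightarrow> (y - step t y) \<bullet> (c - step t y) \<le> 0"
    "v \<in> V \<Longrightarrow> n \<bullet> v = (y - step t y) \<bullet> v"
    "\<exists>c\<in>K t. norm (step t y - c) \<le> rate * (M * \<tau>)"
proof -
  let ?a = "cproj (A t) y" let ?z = "step t y"
  note A = A_props[of t]
  show zV: "?z \<in> V" unfolding step_def by (rule cproj_subspace_in[OF V])
  have orth: "(?a - ?z) \<bullet> v = 0" if "v \<in> V" for v
    unfolding step_def by (rule cproj_subspace_orth[OF V that])
  then show nv: "n \<bullet> v = (y - ?z) \<bullet> v" if "v \<in> V" for v
    using that by (simp add: n_def inner_diff_left)
  show "norm n \<le> M * \<tau>"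
    unfolding n_def using cproj_nearest[OF A(1,2), of c0 y] near by (auto simp: K_def)
  then have "norm (y - ?z) \<le> M * \<tau>"
  proof -
    have yz: "y - ?z \<in> V" using V y zV by (simp add: subspace_diff)
    have "norm (y - ?z) * norm (y - ?z) = n \<bullet> (y - ?z)" unfolding nv[OF yz] by (simp add: dot_square_norm power2_eq_square)
    also have "\<dots> \<le> norm n * norm (y - ?z)" by (rule norm_cauchy_schwarz)
    finally have "norm (y - ?z) \<le> norm n" by (cases "norm (y - ?z) = 0") auto
    then show ?thesis using \<open>norm n \<le> M * \<tau>\<close> by simp
  qed
  then show "norm (y - step t y) \<le> M * \<tau>" .
  have P: "n \<bullet> (c - ?a) \<le> 0" if "c \<in> A t" for c
    unfolding n_def by (rule cproj_le[OF A that])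
  show "(y - ?z) \<bullet> (c - ?z) \<le> 0" if "c \<in> K t" for c
  proof -
    have "c - ?z \<in> V" "y - ?z \<in> V" using that y zV V by (auto simp: K_def subspace_diff)
    then have "(y - ?z) \<bullet> (c - ?z) = n \<bullet> (c - ?z)" using nv by simp
    also have "\<dots> = n \<bullet> (c - ?a) + n \<bullet> (?a - ?z)" by (simp add: inner_diff_right)
    \<comment> \<open>The second projection contributes a term of favourable sign, by orthogonality,
      so the variational inequality holds although \<open>step t y\<close> may lie outside
      \<open>K t\<close>.\<close>
    also have "n \<bullet> (?a - ?z) = - (norm (?a - ?z))\<^sup>2"
    proof -
      have "(?a - ?z) \<bullet> (y - ?z) = 0" using orth \<open>y - ?z \<in> V\<close> by blast
      moreover have "n \<bullet> (?a - ?z) = (y - ?z) \<bullet> (?a - ?z) - (?a - ?z) \<bullet> (?a - ?z)"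
        unfolding n_def inner_diff_left[symmetric] by simp
      ultimately show ?thesis by (simp only: inner_commute[of "?a - ?z" "y - ?z"] power2_norm_eq_inner)
    qed
    finally have "(y - ?z) \<bullet> (c - ?z) = n \<bullet> (c - ?a) - (norm (?a - ?z))\<^sup>2" by simp
    moreover have "n \<bullet> (c - ?a) \<le> 0" using P that by (auto simp: K_def)
    moreover have "0 \<le> (norm (?a - ?z))\<^sup>2" by simp
    ultimately show ?thesis by linarith
  qed
  define c where "c = cproj (K t) y"
  note K = K_props[of t]
  have c: "c \<in> K t" unfolding c_def by (rule cproj_in[OF K])
  obtain c' where "c' \<in> K t" "norm (y - c') \<le> \<kappa> * norm n"
    using K_near[OF y cproj_in[OF A]] unfolding n_def by blast
  then have 1: "norm (y - c) \<le> \<kappa> * norm n"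
    using cproj_nearest[OF K(1,2), of c' y] unfolding c_def by linarith
  have 2: "norm (y - c) \<le> M * \<tau>" using cproj_nearest[OF K(1,2) near(1), of y] near(2) by (simp add: c_def)
  have "norm (?z - c) \<le> rate * (M * \<tau>)"
  proof (rule power2_le_imp_le)
    have "(norm (?a - c))\<^sup>2 = (norm (?a - ?z))\<^sup>2 + (norm (?z - c))\<^sup>2"
    proof -
      have "?z - c \<in> V" using c zV V by (auto simp: K_def subspace_diff)
      then have "(?a - ?z) \<bullet> (?z - c) = 0" by (rule orth)
      then show ?thesis
        using norm_add_Pythagorean[of "?a - ?z" "?z - c"] by (simp add: orthogonal_def)
    qed
    then have "(norm (?z - c))\<^sup>2 \<le> (norm (?a - c))\<^sup>2" by simp
    also have "\<dots> \<le> (norm (y - c))\<^sup>2 - (norm n)\<^sup>2"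
      unfolding n_def using c by (intro cproj_dist_sq[OF A(1,2)]) (simp add: K_def)
    also have "\<dots> \<le> (norm (y - c))\<^sup>2 - (norm (y - c))\<^sup>2 / \<kappa>\<^sup>2"
    proof -
      have "(norm (y - c))\<^sup>2 \<le> (\<kappa> * norm n)\<^sup>2" using 1 by (intro power_mono) auto
      then show ?thesis using \<kappa> by (simp add: power_mult_distrib pos_divide_le_eq mult.commute)
    qed
    also have "\<dots> = (rate * norm (y - c))\<^sup>2" by (simp add: power_mult_distrib rate algebra_simps)
    also have "\<dots> \<le> (rate * (M * \<tau>))\<^sup>2" using 2 rate by (intro power_mono mult_left_mono) auto
    finally show "(norm (?z - c))\<^sup>2 \<le> (rate * (M * \<tau>))\<^sup>2" .
  qed (use rate M \<open>0 \<le> \<tau>\<close> in simp)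
  then show "\<exists>c\<in>K t. norm (?z - c) \<le> rate * (M * \<tau>)" using c by blast
qed

section \<open>The discrete scheme with a fixed step size\<close>

fun Y :: "'h \<Rightarrow> real \<Rightarrow> nat \<Rightarrow> 'h" where
  "Y y0 \<tau> 0 = y0"
| "Y y0 \<tau> (Suc i) = step (\<tau> * real (Suc i)) (Y y0 \<tau> i)"

text \<open>Index \<open>i\<close> refers to the iterate before the step, whereas normality is with
  respect to \<open>A\<close> at the time \<open>\<tau> * real (Suc i)\<close> after it, at the
  point \<open>Y y0 \<tau> i - normal_vec y0 \<tau> i\<close>.\<close>

definition normal_vec :: "'h \<Rightarrow> real \<Rightarrow> nat \<Rightarrow> 'h" where
  "normal_vec y0 \<tau> i = Y y0 \<tau> i - cproj (A (\<tau> * real (Suc i))) (Y y0 \<tau> i)"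

context
  fixes y0 assumes y0: "y0 \<in> K 0"
begin

abbreviation "Z \<equiv> Y y0"
abbreviation "nv \<equiv> normal_vec y0"

text \<open>The contracted distance and the motion of \<open>K\<close> during one step fit together
  into \<open>M * \<tau>\<close> by the choice of \<open>M\<close>.\<close>

lemma near_next:
  assumes "0 \<le> \<tau>" "c \<in> K (\<tau> * real i)" "norm (x - c) \<le> rate * (M * \<tau>)"
  shows "\<exists>c0\<in>K (\<tau> * real (Suc i)). norm (x - c0) \<le> M * \<tau>"
proof -
  obtain c0 where c0: "c0 \<in> K (\<tau> * real (Suc i))" "norm (c - c0) \<le> L * \<bar>\<tau> * real i - \<tau> * real (Suc i)\<bar>"
    using K_lipschitz[OF assms(2)] by blast
  have "norm (x - c0) \<le> rate * (M * \<tau>) + L * \<tau>"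
    using norm_triangle_ineq[of "x - c" "c - c0"] c0 assms by (simp add: algebra_simps)
  also have "\<dots> = (rate * M + L) * \<tau>" by (simp add: algebra_simps)
  finally show ?thesis using c0 by (auto simp only: M)
qed

text \<open>The invariant carries the contracted bound, with \<open>rate * M\<close> in place of
  \<open>M\<close>, which leaves room for the motion of \<open>K\<close> in the next step. Hence the
  distances do not accumulate.\<close>

lemma Z_invariant:
  assumes "0 \<le> \<tau>"
  shows "Z \<tau> i \<in> V \<and> (\<exists>c\<in>K (\<tau> * real i). norm (Z \<tau> i - c) \<le> rate * (M * \<tau>))"
proof (induction i)
  case 0
  have "0 \<le> rate * (M * \<tau>)" using rate M assms by simp
  then show ?case using y0 by (auto simp: K_def intro!: bexI[of _ y0])
next
  case (Suc i)
  then obtain c where c: "c \<in> K (\<tau> * real i)" "norm (Z \<tau> i - c) \<le> rate * (M * \<tau>)" by blast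
  from near_next[OF assms c] obtain c0 where c0: "c0 \<in> K (\<tau> * real (Suc i))" "norm (Z \<tau> i - c0) \<le> M * \<tau>" ..
  from step[OF _ c0 assms] Suc show ?case by simp
qed

lemma Z_V: "0 \<le> \<tau> \<Longrightarrow> Z \<tau> i \<in> V"
  using Z_invariant by blast

lemma Z_near: assumes "0 \<le> \<tau>" shows "\<exists>c\<in>K (\<tau> * real i). norm (Z \<tau> i - c) \<le> M * \<tau>"
proof -
  have "rate * (M * \<tau>) \<le> 1 * (M * \<tau>)" using rate M assms by (intro mult_right_mono) auto
  then show ?thesis using Z_invariant[OF assms, of i] by force
qed

lemma Z_near_Suc:
  assumes "0 \<le> \<tau>" shows "\<exists>c\<in>K (\<tau> * real (Suc i)). norm (Z \<tau> i - c) \<le> M * \<tau>"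
  using Z_invariant[OF assms] near_next[OF assms] by blast

lemma Z_step:
  assumes "0 \<le> \<tau>"
  shows "norm (nv \<tau> i) \<le> M * \<tau>" "norm (Z \<tau> i - Z \<tau> (Suc i)) \<le> M * \<tau>"
    "c \<in> K (\<tau> * real (Suc i)) \<Longrightarrow> (Z \<tau> i - Z \<tau> (Suc i)) \<bullet> (c - Z \<tau> (Suc i)) \<le> 0"
    "v \<in> V \<Longrightarrow> nv \<tau> i \<bullet> v = (Z \<tau> i - Z \<tau> (Suc i)) \<bullet> v"
    "c \<in> A (\<tau> * real (Suc i)) \<Longrightarrow> nv \<tau> i \<bullet> (c - (Z \<tau> i - nv \<tau> i)) \<le> 0"
proof -
  obtain c0 where c0: "c0 \<in> K (\<tau> * real (Suc i))" "norm (Z \<tau> i - c0) \<le> M * \<tau>" using Z_near_Suc[OF assms] by blast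
  note st = step[OF Z_V[OF assms] c0 assms, folded normal_vec_def]
  show "norm (nv \<tau> i) \<le> M * \<tau>" "norm (Z \<tau> i - Z \<tau> (Suc i)) \<le> M * \<tau>"
    "c \<in> K (\<tau> * real (Suc i)) \<Longrightarrow> (Z \<tau> i - Z \<tau> (Suc i)) \<bullet> (c - Z \<tau> (Suc i)) \<le> 0"
    "v \<in> V \<Longrightarrow> nv \<tau> i \<bullet> v = (Z \<tau> i - Z \<tau> (Suc i)) \<bullet> v"
    using st by simp_all
  show "c \<in> A (\<tau> * real (Suc i)) \<Longrightarrow> nv \<tau> i \<bullet> (c - (Z \<tau> i - nv \<tau> i)) \<le> 0"
    using cproj_le[OF A_props, of c "\<tau> * real (Suc i)" "Z \<tau> i"] by (simp add: normal_vec_def)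
qed

lemma Z_lipschitz:
  assumes "0 \<le> \<tau>" "i \<le> j"
  shows "norm (Z \<tau> j - Z \<tau> i) \<le> M * \<tau> * (real j - real i)"
  using \<open>i \<le> j\<close>
proof (induction j rule: dec_induct)
  case (step j)
  have "norm (Z \<tau> (Suc j) - Z \<tau> i) \<le> norm (Z \<tau> (Suc j) - Z \<tau> j) + norm (Z \<tau> j - Z \<tau> i)"
    using norm_triangle_ineq[of "Z \<tau> (Suc j) - Z \<tau> j" "Z \<tau> j - Z \<tau> i"] by simp
  also have "\<dots> \<le> M * \<tau> + M * \<tau> * (real j - real i)"
    using Z_step(2)[OF assms(1), of j] step by (simp only: norm_minus_commute[of "Z \<tau> (Suc j)"])
  finally show ?case by (simp add: algebra_simps)
qed simp

text \<open>Iterates need not be in \<open>K\<close>, so each variational inequality is tested with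
  a nearby point of \<open>K\<close>. A coarse interval costs
  \<open>2 * M * (M + L) * \<tau>\<^sup>2\<close> for its \<open>N\<close> fine steps and
  \<open>2 * M * M * \<tau>\<^sup>2\<close> for the coarse step, which add up to the stated
  constant.\<close>

lemma Z_compare:
  assumes "0 \<le> \<tau>" "N > 0"
  shows "(norm (Z \<tau> i - Z (\<tau> / real N) (N * i)))\<^sup>2 \<le> real i * (2 * M * (2 * M + L)) * \<tau>\<^sup>2"
proof (induction i)
  case (Suc i)
  let ?\<tau> = "\<tau> / real N" and ?w = "Z \<tau> i"
  have \<tau>': "0 \<le> ?\<tau>" using assms by simp
  obtain c where c: "c \<in> K (\<tau> * real i)" "norm (?w - c) \<le> M * \<tau>" using Z_near[OF assms(1)] by blast
  \<comment> \<open>The coarse iterate is frozen at time \<open>\<tau> * real i\<close> while the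
    fine scheme runs through the interval.\<close>
  have fine: "(norm (?w - Z ?\<tau> (N * i + j)))\<^sup>2 \<le> (norm (?w - Z ?\<tau> (N * i)))\<^sup>2 + real j * (2 * ((M + L) * \<tau>) * (M * ?\<tau>))"
    if "j \<le> N" for j
    using that
  proof (induction j)
    case (Suc j)
    let ?t = "?\<tau> * real (Suc (N * i + j))"
    have "real N * real i \<le> real (Suc (N * i + j))" "real (Suc (N * i + j)) \<le> real N * real i + real N"
      using Suc.prems by (simp_all add: of_nat_mult[symmetric] of_nat_add[symmetric] del: of_nat_mult of_nat_add of_nat_Suc)
    then have "?\<tau> * (real N * real i) \<le> ?t" "?t \<le> ?\<tau> * (real N * real i + real N)"
      using \<tau>' by (intro mult_left_mono; simp)+
    moreover have "?\<tau> * (real N * real i) = \<tau> * real i" "?\<tau> * (real N * real i + real N) = \<tau> * real i + \<tau>"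
      using \<open>N > 0\<close> by (simp_all add: field_simps)
    ultimately have tt: "\<bar>\<tau> * real i - ?t\<bar> \<le> \<tau>" by linarith
    obtain c' where c': "c' \<in> K ?t" "norm (c - c') \<le> L * \<bar>\<tau> * real i - ?t\<bar>" using K_lipschitz[OF c(1)] by blast
    have "norm (?w - c') \<le> M * \<tau> + L * \<tau>"
      using norm_triangle_ineq[of "?w - c" "c - c'"] c(2) c'(2) mult_left_mono[OF tt L0] by simp
    then have "norm (?w - c') \<le> (M + L) * \<tau>" by (simp add: algebra_simps)
    from variational_inequality_perturbation[OF Z_step(3)[OF \<tau>' c'(1)] this Z_step(2)[OF \<tau>']]
    have "(norm (?w - Z ?\<tau> (Suc (N * i + j))))\<^sup>2 \<le> (norm (?w - Z ?\<tau> (N * i + j)))\<^sup>2 + 2 * ((M + L) * \<tau>) * (M * ?\<tau>)" .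
    moreover have "(norm (?w - Z ?\<tau> (N * i + j)))\<^sup>2 \<le> (norm (?w - Z ?\<tau> (N * i)))\<^sup>2 + real j * (2 * ((M + L) * \<tau>) * (M * ?\<tau>))"
      using Suc by simp
    moreover have "real (Suc j) * (2 * ((M + L) * \<tau>) * (M * ?\<tau>)) = real j * (2 * ((M + L) * \<tau>) * (M * ?\<tau>)) + 2 * ((M + L) * \<tau>) * (M * ?\<tau>)"
      by (simp only: of_nat_Suc distrib_right mult_1_left)
    ultimately show ?case unfolding add_Suc_right by linarith
  qed simp
  \<comment> \<open>The roles are exchanged: the coarse step is now tested with a point of
    \<open>K\<close> near the fine iterate at the end of the interval.\<close>
  let ?W = "Z ?\<tau> (N * Suc i)"
  have fineN: "(norm (?W - ?w))\<^sup>2 \<le> (norm (?w - Z ?\<tau> (N * i)))\<^sup>2 + 2 * M * (M + L) * \<tau>\<^sup>2"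
  proof -
    have "real N * (2 * ((M + L) * \<tau>) * (M * ?\<tau>)) = 2 * M * (M + L) * \<tau>\<^sup>2"
      using \<open>N > 0\<close> by (simp add: power2_eq_square)
    moreover have "N * i + N = N * Suc i" by simp
    ultimately show ?thesis using fine[OF order_refl] by (simp only: norm_minus_commute[of ?W])
  qed
  have "\<tau> / real N * (real N * x) = \<tau> * x" for x using \<open>N > 0\<close> by simp
  then have "?\<tau> * real (N * Suc i) = \<tau> * real (Suc i)" by (simp only: of_nat_mult)
  then obtain b where b: "b \<in> K (\<tau> * real (Suc i))" "norm (?W - b) \<le> M * ?\<tau>" using Z_near[OF \<tau>', of "N * Suc i"] by metis
  have "?\<tau> \<le> \<tau>" using assms by (simp add: divide_le_eq mult_le_cancel_left1)
  then have "norm (?W - b) \<le> M * \<tau>" using b(2) M(1) mult_left_mono order_trans by blast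
  from variational_inequality_perturbation[OF Z_step(3)[OF assms(1) b(1)] this Z_step(2)[OF assms(1)]]
  have "(norm (?W - Z \<tau> (Suc i)))\<^sup>2 \<le> (norm (?W - ?w))\<^sup>2 + 2 * (M * \<tau>) * (M * \<tau>)" .
  then have "(norm (Z \<tau> (Suc i) - ?W))\<^sup>2 \<le> real i * (2 * M * (2 * M + L)) * \<tau>\<^sup>2 + 2 * M * (M + L) * \<tau>\<^sup>2 + 2 * (M * \<tau>) * (M * \<tau>)"
    using fineN Suc by (simp only: norm_minus_commute[of ?W])
  also have "\<dots> = real (Suc i) * (2 * M * (2 * M + L)) * \<tau>\<^sup>2" by (simp add: algebra_simps power2_eq_square)
  finally show ?case .
qed simp

section \<open>Convergence along dyadic grids\<close>

definition grid :: "nat \<Rightarrow> real \<Rightarrow> nat" where "grid n t = nat \<lfloor>2^n * t\<rfloor>"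
text \<open>Dyadic sizes make the grids nested: the point with index i at level n has index
  \<open>i * 2^(m - n)\<close> at a finer level m, so \<open>Z_compare\<close> applies.\<close>

definition \<tau> :: "nat \<Rightarrow> real" where "\<tau> n = (1/2)^n"
definition Yn :: "nat \<Rightarrow> real \<Rightarrow> 'h" where "Yn n t = Z (\<tau> n) (grid n t)"

lemma \<tau>: "0 < \<tau> n" "\<tau> \<longlonglongrightarrow> 0" "\<tau> n * 2^n = 1"
proof -
  show "\<tau> \<longlonglongrightarrow> 0" unfolding \<tau>_def[abs_def] by (rule LIMSEQ_power_zero) simp
qed (simp_all add: \<tau>_def power_divide)

lemma grid:
  assumes "0 \<le> t"
  shows "\<tau> n * real (grid n t) \<le> t" "t < \<tau> n * real (Suc (grid n t))" "a \<le> t \<Longrightarrow> grid n a \<le> grid n t"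
proof -
  have g: "real (grid n t) \<le> 2^n * t" "2^n * t < real (Suc (grid n t))" 
  proof -
    have "2^n * t < real_of_int \<lfloor>2^n * t\<rfloor> + 1" by (rule real_of_int_floor_add_one_gt)
    moreover have "real (grid n t) = real_of_int \<lfloor>2^n * t\<rfloor>" using assms by (simp add: grid_def)
    moreover have "real_of_int \<lfloor>2^n * t\<rfloor> \<le> 2^n * t" by (rule of_int_floor_le)
    ultimately show "real (grid n t) \<le> 2^n * t" "2^n * t < real (Suc (grid n t))" by linarith+
  qed
  have eq: "\<tau> n * (2^n * t) = t" using \<tau>(3)[of n] by (simp add: mult.assoc[symmetric])
  show "\<tau> n * real (grid n t) \<le> t" "t < \<tau> n * real (Suc (grid n t))"
    using mult_left_mono[OF g(1), of "\<tau> n"] mult_strict_left_mono[OF g(2), of "\<tau> n"] \<tau>(1)[of n] unfolding eq by auto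
  show "grid n a \<le> grid n t" if "a \<le> t"
    unfolding grid_def using that by (intro nat_mono floor_mono) simp
qed

lemma grid_diff:
  assumes "0 \<le> a" "a \<le> t"
  shows "\<tau> n * (real (grid n t) - real (grid n a)) \<le> t - a + \<tau> n"
  using grid(1)[of t n] grid(2)[of a n] assms by (simp add: algebra_simps)

lemma Yn_lipschitz:
  assumes "0 \<le> a" "a \<le> t"
  shows "norm (Yn n t - Yn n a) \<le> M * (t - a + \<tau> n)"
proof -
  have "norm (Yn n t - Yn n a) \<le> M * \<tau> n * (real (grid n t) - real (grid n a))"
    unfolding Yn_def using \<tau>(1)[of n] grid(3)[of t] assms by (intro Z_lipschitz) auto
  also have "\<dots> \<le> M * (t - a + \<tau> n)"
    using mult_left_mono[OF grid_diff[OF assms] M(1)] by (simp add: mult.assoc)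
  finally show ?thesis .
qed

text \<open>The first term is the motion of the finer scheme since the last coarse grid point; the
  second is the root of the bound in \<open>Z_compare\<close>, with the elapsed grid time estimated
  by \<open>t\<close>.\<close>

definition err :: "real \<Rightarrow> nat \<Rightarrow> real" where
  "err t n = M * \<tau> n + sqrt (t * (2 * M * (2 * M + L)) * \<tau> n)"

lemma err_tendsto: "err t \<longlonglongrightarrow> 0"
proof -
  have "(\<lambda>n. M * \<tau> n + sqrt (t * (2 * M * (2 * M + L)) * \<tau> n)) \<longlonglongrightarrow> M * 0 + sqrt (t * (2 * M * (2 * M + L)) * 0)"
    by (intro tendsto_intros \<tau>)
  then show ?thesis by (simp add: err_def[abs_def])
qed

lemma Yn_Cauchy_estimate:
  assumes "0 \<le> t" "n \<le> m"
  shows "norm (Yn m t - Yn n t) \<le> err t n"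
proof -
  define N :: nat where "N = 2^(m - n)"
  have N: "N > 0" "real N * \<tau> m = \<tau> n"
  proof -
    obtain k where "m = n + k" using assms(2) le_Suc_ex by blast
    then show "N > 0" "real N * \<tau> m = \<tau> n" by (simp_all add: N_def \<tau>_def power_add power_divide)
  qed
  then have \<tau>m: "\<tau> m = \<tau> n / real N" by (simp add: field_simps)
  let ?i = "grid n t" and ?j = "grid m t"
  have "real (N * ?i) < real (Suc ?j)"
  proof -
    have "\<tau> m * real (N * ?i) = \<tau> n * real ?i" using N by (simp add: mult_ac)
    also have "\<dots> < \<tau> m * real (Suc ?j)" using grid(1)[OF assms(1), of n] grid(2)[OF assms(1), of m] by linarith
    finally show ?thesis using \<tau>(1)[of m] by simp
  qed
  then have le: "N * ?i \<le> ?j" by (simp only: of_nat_less_iff less_Suc_eq_le)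
  have "norm (Z (\<tau> m) ?j - Z (\<tau> m) (N * ?i)) \<le> M * \<tau> m * (real ?j - real (N * ?i))"
    using \<tau>(1)[of m] le by (intro Z_lipschitz) auto
  also have "\<tau> m * (real ?j - real (N * ?i)) \<le> \<tau> n"
  proof -
    have "\<tau> m * real (N * ?i) = \<tau> n * real ?i" using N by (simp add: mult_ac)
    then show ?thesis using grid(1)[OF assms(1), of m] grid(2)[OF assms(1), of n]
      unfolding right_diff_distrib of_nat_Suc distrib_left by linarith
  qed
  then have "M * \<tau> m * (real ?j - real (N * ?i)) \<le> M * \<tau> n" using M(1) by (simp add: mult.assoc mult_left_mono)
  finally have 1: "norm (Z (\<tau> m) ?j - Z (\<tau> m) (N * ?i)) \<le> M * \<tau> n" .
  have "(norm (Z (\<tau> n) ?i - Z (\<tau> m) (N * ?i)))\<^sup>2 \<le> real ?i * (2 * M * (2 * M + L)) * (\<tau> n)\<^sup>2"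
    unfolding \<tau>m using \<tau>(1)[of n] N by (intro Z_compare) auto
  also have "\<dots> = (\<tau> n * real ?i) * ((2 * M * (2 * M + L)) * \<tau> n)" by (simp add: power2_eq_square)
  also have "\<dots> \<le> t * ((2 * M * (2 * M + L)) * \<tau> n)"
    using grid(1)[OF assms(1)] M(1) L0 \<tau>(1)[of n] by (intro mult_right_mono) auto
  finally have "norm (Z (\<tau> n) ?i - Z (\<tau> m) (N * ?i)) \<le> sqrt (t * (2 * M * (2 * M + L)) * \<tau> n)"
    by (intro real_le_rsqrt) (simp add: mult.assoc)
  then have "norm (Z (\<tau> m) ?j - Z (\<tau> n) ?i) \<le> M * \<tau> n + sqrt (t * (2 * M * (2 * M + L)) * \<tau> n)"
    using 1 norm_triangle_ineq[of "Z (\<tau> m) ?j - Z (\<tau> m) (N * ?i)" "Z (\<tau> m) (N * ?i) - Z (\<tau> n) ?i"]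
    by (simp add: norm_minus_commute[of "Z (\<tau> n) ?i"])
  then show ?thesis by (simp add: Yn_def err_def)
qed

definition y :: "real \<Rightarrow> 'h" where "y t = lim (\<lambda>n. Yn n t)"

lemma y_lim: assumes "0 \<le> t" shows "(\<lambda>n. Yn n t) \<longlonglongrightarrow> y t"
proof -
  have "Cauchy (\<lambda>n. Yn n t)" by (rule Cauchy_tail_bound[OF Yn_Cauchy_estimate[OF assms] err_tendsto])
  then show ?thesis unfolding y_def using Cauchy_convergent_iff convergent_LIMSEQ_iff by blast
qed

lemma y_err: assumes "0 \<le> t" shows "norm (y t - Yn n t) \<le> err t n"
proof (rule Lim_bounded)
  show "(\<lambda>m. norm (Yn m t - Yn n t)) \<longlonglongrightarrow> norm (y t - Yn n t)" by (intro tendsto_intros y_lim assms)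
  show "\<forall>m\<ge>n. norm (Yn m t - Yn n t) \<le> err t n" using Yn_Cauchy_estimate[OF assms] by blast
qed

lemma y_0: "y 0 = y0"
proof -
  have "(\<lambda>n. Yn n 0) \<longlonglongrightarrow> y0" by (simp add: Yn_def grid_def)
  then show ?thesis using y_lim[of 0] LIMSEQ_unique by blast
qed

lemma y_lipschitz: assumes "0 \<le> a" "a \<le> t" shows "norm (y t - y a) \<le> M * (t - a)"
proof (rule LIMSEQ_le)
  show "(\<lambda>n. norm (Yn n t - Yn n a)) \<longlonglongrightarrow> norm (y t - y a)" using assms by (intro tendsto_intros y_lim) auto
  have "(\<lambda>n. M * (t - a + \<tau> n)) \<longlonglongrightarrow> M * (t - a + 0)" by (intro tendsto_intros \<tau>)
  then show "(\<lambda>n. M * (t - a + \<tau> n)) \<longlonglongrightarrow> M * (t - a)" by simp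
qed (use Yn_lipschitz[OF assms] in blast)

text \<open>The approximations lie within \<open>(M + L) * \<tau> n\<close> of \<open>K t\<close>:
  their distance to \<open>K\<close> at the last grid point plus the motion of \<open>K\<close>
  since then.\<close>

lemma y_in_K: assumes "0 \<le> t" shows "y t \<in> K t"
proof -
  have "\<exists>c\<in>K t. norm (Yn n t - c) \<le> (M + L) * \<tau> n" for n
  proof -
    have t0: "0 \<le> \<tau> n" using \<tau>(1)[of n] by simp
    obtain c where c: "c \<in> K (\<tau> n * real (grid n t))" "norm (Yn n t - c) \<le> M * \<tau> n"
      using Z_near[OF t0] unfolding Yn_def by blast
    obtain c' where c': "c' \<in> K t" "norm (c - c') \<le> L * \<bar>\<tau> n * real (grid n t) - t\<bar>" using K_lipschitz[OF c(1)] by blast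
    have "\<bar>\<tau> n * real (grid n t) - t\<bar> \<le> \<tau> n" using grid(1,2)[OF assms, of n] by (simp add: algebra_simps)
    then have "norm (c - c') \<le> L * \<tau> n" using c' L0 mult_left_mono order_trans by blast
    then have "norm (Yn n t - c') \<le> M * \<tau> n + L * \<tau> n" using norm_triangle_ineq[of "Yn n t - c" "c - c'"] c by simp
    then show ?thesis using c' by (auto simp: algebra_simps)
  qed
  then obtain c where c: "\<And>n. c n \<in> K t" "\<And>n. norm (Yn n t - c n) \<le> (M + L) * \<tau> n" by metis
  have "(\<lambda>n. (M + L) * \<tau> n) \<longlonglongrightarrow> (M + L) * 0" by (intro tendsto_intros \<tau>)
  then have "(\<lambda>n. Yn n t - c n) \<longlonglongrightarrow> 0"
    by (intro Lim_null_comparison[OF always_eventually[OF allI[OF c(2)]]]) simp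
  then have "c \<longlonglongrightarrow> y t" using tendsto_diff[OF y_lim[OF assms], of "\<lambda>n. Yn n t - c n" 0] by simp
  then show ?thesis using closed_sequentially[OF K_props(1)] c(1) by blast
qed

section \<open>Partial sums of the normal vectors and their weak limit\<close>

definition Pn :: "nat \<Rightarrow> real \<Rightarrow> 'h" where "Pn n t = (\<Sum>j<grid n t. nv (\<tau> n) j)"

lemma Pn_diff:
  assumes "0 \<le> a" "a \<le> t"
  shows "Pn n t - Pn n a = (\<Sum>j\<in>{grid n a..<grid n t}. nv (\<tau> n) j)"
proof -
  have "0 \<le> t" using assms by simp
  from grid(3)[OF this assms(2)] show ?thesis
    unfolding Pn_def by (simp add: lessThan_atLeast0 sum_diff_nat_ivl)
qed

lemma Pn_lipschitz:
  assumes "0 \<le> a" "a \<le> t"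
  shows "norm (Pn n t - Pn n a) \<le> M * (t - a + \<tau> n)"
proof -
  have t0: "0 \<le> \<tau> n" using \<tau>(1)[of n] by simp
  have g: "grid n a \<le> grid n t" using grid(3)[of t a n] assms by simp
  have "norm (Pn n t - Pn n a) \<le> (\<Sum>j\<in>{grid n a..<grid n t}. M * \<tau> n)"
    unfolding Pn_diff[OF assms] by (intro order_trans[OF norm_sum] sum_mono Z_step(1) t0)
  also have "\<dots> = M * (\<tau> n * (real (grid n t) - real (grid n a)))" using g by (simp add: of_nat_diff algebra_simps)
  also have "\<dots> \<le> M * (t - a + \<tau> n)" by (intro mult_left_mono grid_diff assms M)
  finally show ?thesis .
qed

lemma Pn_bound: "0 \<le> t \<Longrightarrow> norm (Pn n t) \<le> M * (t + 1)"
proof -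
  assume "0 \<le> t"
  have "norm (Pn n t) \<le> M * (t + \<tau> n)" using Pn_lipschitz[of 0 t n] \<open>0 \<le> t\<close> by (simp add: Pn_def grid_def)
  also have "\<dots> \<le> M * (t + 1)" using M(1) by (intro mult_left_mono) (auto simp: \<tau>_def power_le_one)
  finally show ?thesis .
qed

text \<open>Paired with \<open>V\<close>, the normal vectors act like the decrements of the
  iterates, which telescope.\<close>

lemma Pn_orth: assumes "v \<in> V" "0 \<le> t" shows "Pn n t \<bullet> v = (y0 - Yn n t) \<bullet> v"
proof -
  have t0: "0 \<le> \<tau> n" using \<tau>(1)[of n] by simp
  have "Pn n t \<bullet> v = (\<Sum>j<grid n t. (Z (\<tau> n) j - Z (\<tau> n) (Suc j)) \<bullet> v)"
    unfolding Pn_def inner_sum_left using Z_step(4)[OF t0 assms(1)] by simp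
  also have "\<dots> = (\<Sum>j<grid n t. Z (\<tau> n) j - Z (\<tau> n) (Suc j)) \<bullet> v" by (simp add: inner_sum_left)
  also have "(\<Sum>j<grid n t. Z (\<tau> n) j - Z (\<tau> n) (Suc j)) = y0 - Yn n t"
    unfolding sum_lessThan_telescope' Yn_def by simp
  finally show ?thesis .
qed

text \<open>Each summand is normal to \<open>A\<close> at another time and another point. Moving the
  base point to \<open>y t\<close> at time \<open>t\<close> costs at most the last factor, while the
  norms of the summands add up to at most \<open>M * (t' - t + \<tau> n)\<close>. The limit of the
  bound is quadratic in \<open>t' - t\<close>.\<close>

lemma Pn_normal:
  assumes "0 \<le> t" "t \<le> t'" "c \<in> \<Sigma>"
  shows "(Pn n t' - Pn n t) \<bullet> (c - s t - y t)
    \<le> M * (t' - t + \<tau> n) * (Ls * (t' - t) + M * \<tau> n + M * (t' - t + \<tau> n) + err t n)"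
proof -
  have t0: "0 \<le> \<tau> n" using \<tau>(1)[of n] by simp
  define R where "R = Ls * (t' - t) + M * \<tau> n + M * (t' - t + \<tau> n) + err t n"
  have g: "grid n t \<le> grid n t'" using grid(3)[of t' t n] assms by simp
  have e0: "0 \<le> err t n" using order_trans[OF norm_ge_zero y_err[OF assms(1)]] .
  have R0: "0 \<le> R" unfolding R_def using assms M Ls0 t0 e0 by (intro add_nonneg_nonneg mult_nonneg_nonneg) auto
  have each: "nv (\<tau> n) j \<bullet> (c - s t - y t) \<le> M * \<tau> n * R" if j: "j \<in> {grid n t..<grid n t'}" for j
  proof -
    let ?tj = "\<tau> n * real (Suc j)" and ?n = "nv (\<tau> n) j" and ?z = "Z (\<tau> n) j"
    have "\<tau> n * real (Suc (grid n t)) \<le> ?tj" "?tj \<le> \<tau> n * real (grid n t')"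
      using j t0 by (intro mult_left_mono; simp)+
    then have tj: "t \<le> ?tj" "?tj \<le> t'" using grid(2)[of t n] grid(1)[of t' n] assms by linarith+
    have "c - s ?tj \<in> A ?tj" using assms by (simp add: A_def)
    then have 1: "?n \<bullet> (c - s ?tj - (?z - ?n)) \<le> 0" by (rule Z_step(5)[OF t0])
    \<comment> \<open>The change of base point: motion of \<open>s\<close>, gap between the iterate
      and its projection, motion of the iterate, discretisation error.\<close>
    define e where "e = (s ?tj - s t) + (- ?n) + (?z - Yn n t) + (Yn n t - y t)"
    have "norm (s ?tj - s t) \<le> Ls * (t' - t)"
    proof -
      have "norm (s ?tj - s t) \<le> Ls * \<bar>?tj - t\<bar>" by (rule Ls)
      also have "\<dots> \<le> Ls * (t' - t)" using tj Ls0 by (intro mult_left_mono) auto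
      finally show ?thesis .
    qed
    moreover have "norm (- ?n) \<le> M * \<tau> n" using Z_step(1)[OF t0] by simp
    moreover have "norm (?z - Yn n t) \<le> M * (t' - t + \<tau> n)"
    proof -
      have "norm (?z - Yn n t) \<le> M * \<tau> n * (real j - real (grid n t))"
        unfolding Yn_def using j t0 by (intro Z_lipschitz) auto
      also have "\<dots> \<le> M * \<tau> n * (real (grid n t') - real (grid n t))"
        using j t0 M(1) by (intro mult_left_mono) auto
      also have "\<dots> \<le> M * (t' - t + \<tau> n)"
        using mult_left_mono[OF grid_diff[OF assms(1,2), of n] M(1)] by (simp add: mult.assoc)
      finally show ?thesis .
    qed
    moreover have "norm (Yn n t - y t) \<le> err t n" using y_err[OF assms(1)] by (simp add: norm_minus_commute)
    ultimately have "norm e \<le> R" unfolding e_def R_def by (intro norm_triangle_mono)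
    then have "?n \<bullet> e \<le> M * \<tau> n * R"
      by (intro order_trans[OF norm_cauchy_schwarz] mult_mono Z_step(1) t0) (use M(1) t0 in simp_all)
    moreover have "c - s t - y t = (c - s ?tj - (?z - ?n)) + e" by (simp add: e_def)
    ultimately show ?thesis using 1 by (simp only: inner_add_right)
  qed
  have "(Pn n t' - Pn n t) \<bullet> (c - s t - y t) \<le> (\<Sum>j\<in>{grid n t..<grid n t'}. M * \<tau> n * R)"
    unfolding Pn_diff[OF assms(1,2)] inner_sum_left by (intro sum_mono each)
  also have "\<dots> = M * (\<tau> n * (real (grid n t') - real (grid n t))) * R" using g by (simp add: of_nat_diff algebra_simps)
  also have "\<dots> \<le> M * (t' - t + \<tau> n) * R" by (intro mult_right_mono mult_left_mono grid_diff assms M R0)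
  finally show ?thesis unfolding R_def .
qed

text \<open>For each \<open>t\<close> the generalized limit of the pairings is a bounded linear
  functional of \<open>h\<close>, represented by \<open>p t\<close>. Because the same functional
  \<open>\<Lambda>\<close> serves all \<open>t\<close> and \<open>h\<close>, inequalities that
  involve two times survive the limit.\<close>

lemma weak_limit_ex:
  "\<exists>p. p 0 = 0 \<and> (\<forall>t t'. 0 \<le> t \<longrightarrow> t \<le> t' \<longrightarrow> norm (p t' - p t) \<le> M * (t' - t)) \<and>
     (\<forall>t\<ge>0. \<forall>v\<in>V. (p t + y t - y0) \<bullet> v = 0) \<and>
     (\<forall>t t'. \<forall>c\<in>\<Sigma>. 0 \<le> t \<longrightarrow> t \<le> t' \<longrightarrow> (p t' - p t) \<bullet> (c - s t - y t) \<le> M * (Ls + M) * (t' - t)\<^sup>2)"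
proof (rule generalized_limit)
  fix \<Lambda> :: "(nat \<Rightarrow> real) \<Rightarrow> real"
  assume add: "\<And>x y. Bseq x \<Longrightarrow> Bseq y \<Longrightarrow> \<Lambda> (\<lambda>n. x n + y n) = \<Lambda> x + \<Lambda> y"
    and scale: "\<And>c x. Bseq x \<Longrightarrow> \<Lambda> (\<lambda>n. c * x n) = c * \<Lambda> x"
    and le: "\<And>x y l. Bseq x \<Longrightarrow> (\<And>n. x n \<le> y n) \<Longrightarrow> y \<longlonglongrightarrow> l \<Longrightarrow> \<Lambda> x \<le> l"
  have bs: "Bseq (\<lambda>n. Pn n t \<bullet> h)" if "0 \<le> t" for t h
  proof (rule BseqI')
    fix n
    show "norm (Pn n t \<bullet> h) \<le> M * (t + 1) * norm h"
      using Cauchy_Schwarz_ineq2[of "Pn n t" h] mult_right_mono[OF Pn_bound[OF that, of n], of "norm h"] by simp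
  qed
  have bound: "\<Lambda> (\<lambda>n. Pn n t \<bullet> h) \<le> norm h * (M * (t + 1))" if "0 \<le> t" for t h
  proof (rule le[OF bs[OF that] _ tendsto_const])
    fix n
    show "Pn n t \<bullet> h \<le> norm h * (M * (t + 1))"
      using norm_cauchy_schwarz[of "Pn n t" h] mult_right_mono[OF Pn_bound[OF that, of n], of "norm h"] by (simp add: mult.commute)
  qed
  have scale': "\<Lambda> (\<lambda>n. Pn n t \<bullet> (c *\<^sub>R h)) = c * \<Lambda> (\<lambda>n. Pn n t \<bullet> h)" if "0 \<le> t" for t c h
    using scale[OF bs[OF that], of c h] by simp
  have "bounded_linear (\<lambda>h. \<Lambda> (\<lambda>n. Pn n t \<bullet> h))" if "0 \<le> t" for t
  proof (rule bounded_linear_intro[where K = "M * (t + 1)"])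
    show "\<Lambda> (\<lambda>n. Pn n t \<bullet> (x + z)) = \<Lambda> (\<lambda>n. Pn n t \<bullet> x) + \<Lambda> (\<lambda>n. Pn n t \<bullet> z)" for x z
      unfolding inner_add_right by (intro add bs that)
    show "\<Lambda> (\<lambda>n. Pn n t \<bullet> (c *\<^sub>R x)) = c *\<^sub>R \<Lambda> (\<lambda>n. Pn n t \<bullet> x)" for c x
      using scale'[OF that] by simp
    show "norm (\<Lambda> (\<lambda>n. Pn n t \<bullet> x)) \<le> norm x * (M * (t + 1))" for x
      using bound[OF that, of x] bound[OF that, of "(-1) *\<^sub>R x"] scale'[OF that, of "-1" x] by (simp add: abs_le_iff)
  qed
  then have "\<exists>z. \<forall>h. \<Lambda> (\<lambda>n. Pn n t \<bullet> h) = z \<bullet> h" if "0 \<le> t" for t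
    using Riesz_representation that by blast
  then obtain p where p: "\<And>t h. 0 \<le> t \<Longrightarrow> \<Lambda> (\<lambda>n. Pn n t \<bullet> h) = p t \<bullet> h" by metis
  \<comment> \<open>The limit passage for increments tested against a fixed vector; the Lipschitz
    bound uses it with \<open>h = p t' - p t\<close>.\<close>
  have p_le: "(p t' - p t) \<bullet> h \<le> l" if "0 \<le> t" "0 \<le> t'" "\<And>n. (Pn n t' - Pn n t) \<bullet> h \<le> x n" "x \<longlonglongrightarrow> l" for t t' h x l
  proof -
    have b': "Bseq (\<lambda>n. Pn n t' \<bullet> h)" by (rule bs[OF that(2)])
    have b: "Bseq (\<lambda>n. (-1) * (Pn n t \<bullet> h))" using Bseq_mult[OF Bfun_const bs[OF that(1)], of "-1" h] .
    have "(p t' - p t) \<bullet> h = \<Lambda> (\<lambda>n. Pn n t' \<bullet> h) + (-1) * \<Lambda> (\<lambda>n. Pn n t \<bullet> h)"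
      using that p by (simp add: inner_diff_left)
    also have "\<dots> = \<Lambda> (\<lambda>n. Pn n t' \<bullet> h + (-1) * (Pn n t \<bullet> h))"
      unfolding scale[OF bs[OF that(1)], symmetric] using add[OF bs[OF that(2)] b] by simp
    also have "\<dots> \<le> l"
    proof (rule le[OF _ _ that(4)])
      show "Bseq (\<lambda>n. Pn n t' \<bullet> h + (-1) * (Pn n t \<bullet> h))"
      proof -
        obtain B1 B2 where "\<And>n. norm (Pn n t' \<bullet> h) \<le> B1" "\<And>n. norm ((-1) * (Pn n t \<bullet> h)) \<le> B2"
          using b' b by (auto simp: Bseq_def)
        then show ?thesis by (intro BseqI'[of _ "B1 + B2"] norm_triangle_mono)
      qed
      show "Pn n t' \<bullet> h + (-1) * (Pn n t \<bullet> h) \<le> x n" for n using that(3)[of n] by (simp add: inner_diff_left)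
    qed
    finally show ?thesis .
  qed
  have Pn0: "Pn n 0 = 0" for n by (simp add: Pn_def grid_def)
  have "norm (p t' - p t) \<le> M * (t' - t)" if "0 \<le> t" "t \<le> t'" for t t'
  proof -
    let ?h = "p t' - p t"
    have "?h \<bullet> ?h \<le> M * (t' - t + 0) * norm ?h"
    proof (rule p_le)
      show "(Pn n t' - Pn n t) \<bullet> ?h \<le> M * (t' - t + \<tau> n) * norm ?h" for n
        using norm_cauchy_schwarz[of "Pn n t' - Pn n t" ?h] mult_right_mono[OF Pn_lipschitz[OF that, of n], of "norm ?h"] by simp
      show "(\<lambda>n. M * (t' - t + \<tau> n) * norm ?h) \<longlonglongrightarrow> M * (t' - t + 0) * norm ?h" by (intro tendsto_intros \<tau>)
    qed (use that in auto)
    then have "norm ?h * norm ?h \<le> (M * (t' - t)) * norm ?h" by (simp add: dot_square_norm power2_eq_square)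
    then show ?thesis using M(1) that by (cases "norm ?h = 0") auto
  qed
  moreover have "p 0 = 0"
  proof -
    have "p 0 \<bullet> p 0 = \<Lambda> (\<lambda>n. Pn n 0 \<bullet> p 0)" using p[of 0 "p 0"] by simp
    also have "\<dots> \<le> 0" by (rule le[OF bs _ tendsto_const]) (auto simp: Pn0)
    finally show ?thesis by (metis inner_gt_zero_iff not_less)
  qed
  moreover have "(p t + y t - y0) \<bullet> v = 0" if "0 \<le> t" "v \<in> V" for t v
  proof -
    have "p t \<bullet> v \<le> (y0 - y t) \<bullet> v" if "v \<in> V" for v
      unfolding p[OF \<open>0 \<le> t\<close>, symmetric]
    proof (rule le[OF bs[OF \<open>0 \<le> t\<close>]])
      show "Pn n t \<bullet> v \<le> (y0 - Yn n t) \<bullet> v" for n using Pn_orth[OF that \<open>0 \<le> t\<close>] by simp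
      show "(\<lambda>n. (y0 - Yn n t) \<bullet> v) \<longlonglongrightarrow> (y0 - y t) \<bullet> v" by (intro tendsto_intros y_lim \<open>0 \<le> t\<close>)
    qed
    from this[OF that(2)] this[OF subspace_neg[OF V(1) that(2)]] show ?thesis
      by (simp add: inner_add_left inner_diff_left)
  qed
  moreover have "(p t' - p t) \<bullet> (c - s t - y t) \<le> M * (Ls + M) * (t' - t)\<^sup>2" if "c \<in> \<Sigma>" "0 \<le> t" "t \<le> t'" for c t t'
  proof -
    have "(p t' - p t) \<bullet> (c - s t - y t) \<le> M * (t' - t + 0) * (Ls * (t' - t) + M * 0 + M * (t' - t + 0) + 0)"
    proof (rule p_le[OF that(2) _ Pn_normal[OF that(2,3,1)]])
      show "(\<lambda>n. M * (t' - t + \<tau> n) * (Ls * (t' - t) + M * \<tau> n + M * (t' - t + \<tau> n) + err t n))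
        \<longlonglongrightarrow> M * (t' - t + 0) * (Ls * (t' - t) + M * 0 + M * (t' - t + 0) + 0)"
        by (intro tendsto_intros \<tau> err_tendsto)
    qed (use that in simp)
    also have "\<dots> = M * (Ls + M) * (t' - t)\<^sup>2" by (simp add: power2_eq_square algebra_simps)
    finally show ?thesis .
  qed
  ultimately show ?thesis by blast
qed

end

end

section \<open>The adjoint operator and the weighted space\<close>

lemma linear_on_subspace_diff:
  assumes "subspace S" "linear_on_subspace S h" "x \<in> S" "y \<in> S"
  shows "h (x - y) = h x - h y"
proof -
  have "h (x + (-1) *\<^sub>R y) = h x + h ((-1) *\<^sub>R y)"
    using assms(2,3) subspace_scale[OF assms(1,4), of "-1"] unfolding linear_on_subspace_def by blast
  also have "h ((-1) *\<^sub>R y) = (-1) *\<^sub>R h y" using assms(2,4) unfolding linear_on_subspace_def by blast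
  finally show ?thesis by simp
qed

lemma linear_on_subspace_image:
  assumes "subspace S" "linear_on_subspace S h"
  shows "subspace (h ` S)"
  unfolding subspace_def
proof (intro conjI ballI allI)
  have "h (0 *\<^sub>R 0) = 0 *\<^sub>R h 0" using assms(2) subspace_0[OF assms(1)] unfolding linear_on_subspace_def by blast
  then have "h 0 = 0" by simp
  then show "0 \<in> h ` S" using subspace_0[OF assms(1)] by (metis image_eqI)
  show "x + y \<in> h ` S" if xy: "x \<in> h ` S" "y \<in> h ` S" for x y
  proof -
    obtain a b where ab: "a \<in> S" "b \<in> S" "x = h a" "y = h b" using xy by blast
    then have "x + y = h (a + b)" using assms(2) unfolding linear_on_subspace_def by metis
    then show ?thesis using ab subspace_add[OF assms(1)] by blast
  qed
  show "c *\<^sub>R x \<in> h ` S" if x: "x \<in> h ` S" for x c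
  proof -
    obtain a where a: "a \<in> S" "x = h a" using x by blast
    then have "c *\<^sub>R x = h (c *\<^sub>R a)" using assms(2) by (simp add: linear_on_subspace_def)
    then show ?thesis using a subspace_scale[OF assms(1)] by blast
  qed
qed

lemma subspace_closure:
  assumes "subspace (S :: 'a::real_normed_vector set)"
  shows "subspace (closure S)"
  unfolding subspace_def
proof (intro conjI ballI allI)
  show "0 \<in> closure S" using closure_subset subspace_0[OF assms] by blast
  show "x + y \<in> closure S" if xy: "x \<in> closure S" "y \<in> closure S" for x y
  proof -
    obtain a b where "\<And>n. a n \<in> S" "a \<longlonglongrightarrow> x" "\<And>n. b n \<in> S" "b \<longlonglongrightarrow> y"
      using xy by (auto simp: closure_sequential)
    then have "(\<lambda>n. a n + b n) \<longlonglongrightarrow> x + y" "\<And>n. a n + b n \<in> S"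
      using subspace_add[OF assms] by (auto intro: tendsto_add)
    then show ?thesis by (auto simp: closure_sequential intro!: exI[of _ "\<lambda>n. a n + b n"])
  qed
  show "c *\<^sub>R x \<in> closure S" if x: "x \<in> closure S" for x c
  proof -
    obtain a where "\<And>n. a n \<in> S" "a \<longlonglongrightarrow> x" using x by (auto simp: closure_sequential)
    then have "(\<lambda>n. c *\<^sub>R a n) \<longlonglongrightarrow> c *\<^sub>R x" "\<And>n. c *\<^sub>R a n \<in> S"
      using subspace_scale[OF assms] by (auto intro: tendsto_scaleR)
    then show ?thesis by (auto simp: closure_sequential intro!: exI[of _ "\<lambda>n. c *\<^sub>R a n"])
  qed
qed

lemma dual_space_lipschitz:
  assumes "subspace S" "l \<in> dual_space S"
  shows "\<exists>K. \<forall>x\<in>S. \<forall>y\<in>S. \<bar>l x - l y\<bar> \<le> K * norm (x - y)"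
proof -
  obtain K where "\<forall>x\<in>S. \<bar>l x\<bar> \<le> K * norm x" using assms(2) by (auto simp: dual_space_def)
  moreover have "linear_on_subspace S l" using assms(2) by (simp add: dual_space_def)
  ultimately have "\<bar>l x - l y\<bar> \<le> K * norm (x - y)" if "x \<in> S" "y \<in> S" for x y
    using linear_on_subspace_diff[OF assms(1), of l x y] that subspace_diff[OF assms(1)] by metis
  then show ?thesis by blast
qed

lemma dual_space_eq_on_closure:
  assumes "subspace W" "l \<in> dual_space (closure W)" "m \<in> dual_space (closure W)"
    and eq: "\<And>w. w \<in> W \<Longrightarrow> l w = m w" and x: "x \<in> closure W"
  shows "l x = m x"
proof -
  note S = subspace_closure[OF assms(1)]
  obtain w where w: "\<And>n. w n \<in> W" "w \<longlonglongrightarrow> x" using x by (auto simp: closure_sequential)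
  have wc: "w n \<in> closure W" for n using w(1) closure_subset by blast
  have lim: "(\<lambda>n. k (w n)) \<longlonglongrightarrow> k x" if k: "k \<in> dual_space (closure W)" for k
  proof -
    obtain K where K: "\<forall>x\<in>closure W. \<forall>y\<in>closure W. \<bar>k x - k y\<bar> \<le> K * norm (x - y)"
      using dual_space_lipschitz[OF S k] by blast
    have "(\<lambda>n. K * norm (w n - x)) \<longlonglongrightarrow> K * norm (x - x)" by (intro tendsto_intros w)
    then have "(\<lambda>n. K * norm (w n - x)) \<longlonglongrightarrow> 0" by simp
    moreover have "\<forall>\<^sub>F n in sequentially. norm (k (w n) - k x) \<le> K * norm (w n - x)"
      using K wc x by simp
    ultimately show ?thesis by (rule Lim_null_comparison[THEN LIM_zero_cancel, rotated])
  qed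
  have "(\<lambda>n. l (w n)) = (\<lambda>n. m (w n))" using eq w by simp
  then show ?thesis using lim[OF assms(2)] lim[OF assms(3)] LIMSEQ_unique by metis
qed

text \<open>Density of \<open>W0\<close> in its closure and the convention of
  \<open>extensional\<close> make the functional in the definite description unique.\<close>

lemma adj_op_spec:
  assumes "subspace W0" "\<sigma> \<in> adj_dom W0 E"
  shows "adj_op W0 E \<sigma> \<in> dual_space (closure W0)" "w \<in> W0 \<Longrightarrow> adj_op W0 E \<sigma> w = \<sigma> \<bullet> E w"
proof -
  obtain l where l: "l \<in> dual_space (closure W0)" "\<forall>w\<in>W0. l w = \<sigma> \<bullet> E w"
    using assms(2) by (auto simp: adj_dom_def)
  have "m = l" if m: "m \<in> dual_space (closure W0)" "\<forall>w\<in>W0. m w = \<sigma> \<bullet> E w" for m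
  proof (rule extensionalityI[of _ "closure W0"])
    show "m \<in> extensional (closure W0)" using m(1) by (simp add: dual_space_def)
    show "l \<in> extensional (closure W0)" using l(1) by (simp add: dual_space_def)
    show "m x = l x" if "x \<in> closure W0" for x
      by (rule dual_space_eq_on_closure[OF assms(1) m(1) l(1) _ that]) (use m l in simp)
  qed
  then have "adj_op W0 E \<sigma> = l" unfolding adj_op_def using l by (intro the_equality) blast+
  then show "adj_op W0 E \<sigma> \<in> dual_space (closure W0)" "w \<in> W0 \<Longrightarrow> adj_op W0 E \<sigma> w = \<sigma> \<bullet> E w"
    using l by auto
qed

text \<open>The adjoint sees its argument only through pairings with the range of \<open>E\<close>;
  this allows a stress to be replaced by its component in the stress range.\<close>

lemma adj_cong:
  assumes "\<And>w. w \<in> W0 \<Longrightarrow> \<sigma> \<bullet> E w = \<tau> \<bullet> E w"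
  shows "\<sigma> \<in> adj_dom W0 E \<longleftrightarrow> \<tau> \<in> adj_dom W0 E" "adj_op W0 E \<sigma> = adj_op W0 E \<tau>"
  using assms by (simp_all add: adj_dom_def adj_op_def cong: ball_cong conj_cong)

text \<open>Annihilator form of the kernel: the functionals have disappeared from it, and closedness
  and orthogonality become elementary.\<close>

lemma adj_ker_eq:
  assumes "subspace W0"
  shows "adj_ker W0 E = {\<sigma>. \<forall>w\<in>W0. \<sigma> \<bullet> E w = 0}"
proof (intro set_eqI iffI)
  fix \<sigma> assume "\<sigma> \<in> adj_ker W0 E"
  then show "\<sigma> \<in> {\<sigma>. \<forall>w\<in>W0. \<sigma> \<bullet> E w = 0}"
    using adj_op_spec[OF assms, of \<sigma> E] closure_subset[of W0] unfolding adj_ker_def by fastforce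
next
  fix \<sigma> assume \<sigma>: "\<sigma> \<in> {\<sigma>. \<forall>w\<in>W0. \<sigma> \<bullet> E w = 0}"
  define z :: "'a \<Rightarrow> real" where "z = (\<lambda>x\<in>closure W0. 0)"
  note S = subspace_closure[OF assms]
  have z: "z \<in> dual_space (closure W0)"
    using S by (auto simp: dual_space_def z_def linear_on_subspace_def subspace_add subspace_scale intro: exI[of _ 0])
  have zw: "z w = 0" if "w \<in> closure W0" for w using that by (simp add: z_def)
  have dom: "\<sigma> \<in> adj_dom W0 E"
    unfolding adj_dom_def using z zw \<sigma> closure_subset[of W0] by (auto intro!: bexI[of _ z])
  have "adj_op W0 E \<sigma> x = 0" if x: "x \<in> closure W0" for x
  proof -
    have "adj_op W0 E \<sigma> x = z x"
      by (rule dual_space_eq_on_closure[OF assms adj_op_spec(1)[OF assms dom] z _ x])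
        (use adj_op_spec(2)[OF assms dom] \<sigma> zw closure_subset[of W0] in auto)
    then show ?thesis using zw[OF x] by simp
  qed
  then show "\<sigma> \<in> adj_ker W0 E" using dom by (simp add: adj_ker_def)
qed

text \<open>The scalar result is applied at each fixed \<open>x\<close>, where the dual norm of the
  weak derivative supplies the constant \<open>B * norm x\<close>.\<close>

lemma W1inf_dual_imp_lipschitz:
  fixes f :: "real \<Rightarrow> 'x::real_normed_vector \<Rightarrow> real"
  assumes "T > 0" "subspace S" "A \<subseteq> dual_space S" and f: "W1inf_dual S A T f"
  shows "\<exists>B\<ge>0. \<forall>s\<in>{0..T}. \<forall>t\<in>{0..T}. \<forall>x\<in>S. \<bar>f t x - f s x\<bar> \<le> B * norm x * \<bar>t - s\<bar>"
proof -
  have fA: "f t \<in> A" if "t \<in> {0..T}" for t using f that by (simp add: W1inf_dual_def)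
  have fcont: "((\<lambda>s. dual_dist S (f s) (f t)) \<longlongrightarrow> 0) (at t within {0..T})" if "t \<in> {0..T}" for t
    using f that by (simp add: W1inf_dual_def)
  obtain v B0 where vA: "\<And>t. t \<in> {0..T} \<Longrightarrow> v t \<in> A"
    and B0: "AE t in lebesgue_on {0..T}. dual_norm S (v t) \<le> B0"
    and weak: "\<And>\<phi> x. test_fun T \<phi> \<Longrightarrow> x \<in> S \<Longrightarrow> (\<integral>t. deriv \<phi> t * f t x \<partial>lebesgue_on {0..T}) = - (\<integral>t. \<phi> t * v t x \<partial>lebesgue_on {0..T})"
    using f unfolding W1inf_dual_def by (elim conjE exE) (rule that, blast, assumption, blast)
  have S0: "0 \<in> S" using subspace_0[OF assms(2)] .
  \<comment> \<open>Stated for bounded linear functions and not for members of the dual, since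
    pointwise differences need not be \<open>extensional\<close>.\<close>
  have bound: "\<bar>l x\<bar> \<le> dual_norm S l * norm x"
    if l: "linear_on_subspace S l" "\<exists>K. \<forall>x\<in>S. \<bar>l x\<bar> \<le> K * norm x" and x: "x \<in> S" for l x
  proof -
    obtain K where K: "\<forall>x\<in>S. \<bar>l x\<bar> \<le> K * norm x" using l by blast
    have "bdd_above ((\<lambda>x. \<bar>l x\<bar>) ` {x\<in>S. norm x \<le> 1})"
    proof (rule bdd_aboveI2)
      fix x assume x: "x \<in> {x\<in>S. norm x \<le> 1}"
      then have "\<bar>l x\<bar> \<le> K * norm x" using K by blast
      also have "\<dots> \<le> \<bar>K\<bar> * norm x" by (intro mult_right_mono) auto
      also have "\<dots> \<le> \<bar>K\<bar> * 1" using x by (intro mult_left_mono) auto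
      finally show "\<bar>l x\<bar> \<le> \<bar>K\<bar>" by simp
    qed
    then have le: "\<bar>l x\<bar> \<le> dual_norm S l" if "x \<in> S" "norm x \<le> 1" for x
      unfolding dual_norm_def using that by (intro cSUP_upper) auto
    have sc: "l (c *\<^sub>R x) = c * l x" if "x \<in> S" for c x using l(1) that by (simp add: linear_on_subspace_def)
    show ?thesis
    proof (cases "x = 0")
      case True
      then show ?thesis using K S0 by auto
    next
      case False
      have "(1 / norm x) *\<^sub>R x \<in> S" using x assms(2) by (simp add: subspace_scale)
      from le[OF this] have "\<bar>(1 / norm x) * l x\<bar> \<le> dual_norm S l" using sc[OF x] False by simp
      then show ?thesis using False by (simp add: abs_mult pos_divide_le_eq)
    qed
  qed
  have dualD: "linear_on_subspace S l" "\<exists>K. \<forall>x\<in>S. \<bar>l x\<bar> \<le> K * norm x" if "l \<in> A" for l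
    using that assms(3) by (auto simp: dual_space_def)
  have diffD: "linear_on_subspace S (\<lambda>x. l x - m x)" "\<exists>K. \<forall>x\<in>S. \<bar>l x - m x\<bar> \<le> K * norm x" if "l \<in> A" "m \<in> A" for l m
  proof -
    show "linear_on_subspace S (\<lambda>x. l x - m x)"
      using dualD(1)[OF that(1)] dualD(1)[OF that(2)] by (simp add: linear_on_subspace_def algebra_simps)
    obtain K1 K2 where K: "\<forall>x\<in>S. \<bar>l x\<bar> \<le> K1 * norm x" "\<forall>x\<in>S. \<bar>m x\<bar> \<le> K2 * norm x"
      using dualD(2)[OF \<open>l \<in> A\<close>] dualD(2)[OF \<open>m \<in> A\<close>] by blast
    have "\<bar>l x - m x\<bar> \<le> (K1 + K2) * norm x" if "x \<in> S" for x
      using abs_triangle_ineq4[of "l x" "m x"] K that by (fastforce simp: distrib_right)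
    then show "\<exists>K. \<forall>x\<in>S. \<bar>l x - m x\<bar> \<le> K * norm x" by blast
  qed
  define B where "B = max B0 0"
  have B: "B \<ge> 0" "AE t in lebesgue_on {0..T}. dual_norm S (v t) \<le> B"
    using B0 by (auto simp: B_def elim: eventually_mono)
  have "\<bar>f t x - f s x\<bar> \<le> B * norm x * \<bar>t - s\<bar>" if st: "s \<in> {0..T}" "t \<in> {0..T}" and x: "x \<in> S" for s t x
  proof (rule bounded_weak_derivative_imp_lipschitz[OF \<open>T > 0\<close> _ _ _ _ st])
    show "continuous_on {0..T} (\<lambda>t. f t x)"
      unfolding continuous_on_def
    proof
      fix t assume t: "t \<in> {0..T}"
      have "\<forall>\<^sub>F s in at t within {0..T}. norm (f s x - f t x) \<le> dual_dist S (f s) (f t) * norm x"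
        unfolding eventually_at_filter dual_dist_def
        using bound[OF diffD[OF fA fA[OF t]] x] by (auto intro!: always_eventually)
      moreover have "((\<lambda>s. dual_dist S (f s) (f t) * norm x) \<longlongrightarrow> 0) (at t within {0..T})"
        by (rule tendsto_mult_left_zero[OF fcont[OF t]])
      ultimately show "((\<lambda>t. f t x) \<longlongrightarrow> f t x) (at t within {0..T})"
        by (rule Lim_null_comparison[THEN LIM_zero_cancel])
    qed
    show "0 \<le> B * norm x" using B by simp
    show "AE t in lebesgue_on {0..T}. \<bar>v t x\<bar> \<le> B * norm x"
      using B(2) AE_space[of "lebesgue_on {0..T}"]
    proof eventually_elim
      case (elim t)
      then have "v t \<in> A" using vA by auto
      from bound[OF dualD[OF this] x] have "\<bar>v t x\<bar> \<le> dual_norm S (v t) * norm x" .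
      also have "\<dots> \<le> B * norm x" using elim by (intro mult_right_mono) auto
      finally show ?case .
    qed
  qed (use weak x in blast)
  then show ?thesis using B(1) by blast
qed

text \<open>\<open>R\<close> is the inverse of the square root \<open>S\<close>. Coercivity gives
  \<open>sqrt c0 * norm x \<le> norm (S x)\<close>, hence injectivity of \<open>S\<close> and
  boundedness of \<open>R\<close>; symmetry turns the weighted product into
  \<open>R x \<bullet> R y\<close>.\<close>

lemma weighted_space_isometry:
  fixes C :: "'h::{real_inner,banach} \<Rightarrow> 'h"
  assumes lin: "bounded_linear C" and sym: "\<And>x y. C x \<bullet> y = x \<bullet> C y"
    and coer: "\<exists>c0>0. \<forall>x. C x \<bullet> x \<ge> c0 * (norm x)\<^sup>2"
  obtains S R where "bounded_linear S" "bounded_linear R" "\<And>x. S (R x) = x" "\<And>x. R (S x) = x"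
    "\<And>x. C x = S (S x)" "\<And>x. inv C x = R (R x)" "\<And>x y. R x \<bullet> y = x \<bullet> R y"
    "\<And>x y. inner_C C x y = R x \<bullet> R y" "\<And>x. norm_C C x = norm (R x)"
proof -
  obtain c0 where c0: "c0 > 0" "\<And>x. C x \<bullet> x \<ge> c0 * (norm x)\<^sup>2" using coer by blast
  obtain S where S: "bounded_linear S" "\<And>x y. S x \<bullet> y = x \<bullet> S y" "\<And>x. S (S x) = C x" "surj S"
    using coercive_square_root[OF lin sym c0] by blast
  interpret S: bounded_linear S by fact
  have lower: "sqrt c0 * norm x \<le> norm (S x)" for x
  proof (rule power2_le_imp_le)
    have "(norm (S x))\<^sup>2 = C x \<bullet> x" using S(2)[of "S x" x] S(3) by (simp add: power2_norm_eq_inner)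
    then show "(sqrt c0 * norm x)\<^sup>2 \<le> (norm (S x))\<^sup>2" using c0 by (simp add: power_mult_distrib)
  qed simp
  have "inj S"
  proof (rule injI)
    fix x y assume "S x = S y"
    then have "sqrt c0 * norm (x - y) \<le> 0" using lower[of "x - y"] by (simp add: S.diff)
    then show "x = y" using c0 by (simp add: mult_le_0_iff)
  qed
  define R where "R = inv S"
  have SR: "S (R x) = x" for x unfolding R_def using S(4) by (rule surj_f_inv_f)
  have RS: "R (S x) = x" for x unfolding R_def using \<open>inj S\<close> by (rule inv_f_f)
  have R: "bounded_linear R"
  proof (rule bounded_linear_intro[where K = "1 / sqrt c0"])
    show "R (x + y) = R x + R y" for x y using RS[of "R x + R y"] by (simp add: S.add SR)
    show "R (c *\<^sub>R x) = c *\<^sub>R R x" for c x using RS[of "c *\<^sub>R R x"] by (simp add: S.scaleR SR)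
    show "norm (R x) \<le> norm x * (1 / sqrt c0)" for x
      using lower[of "R x"] c0 by (simp add: SR field_simps)
  qed
  have invC: "inv C x = R (R x)" for x
  proof (rule inv_f_eq)
    show "inj C" using \<open>inj S\<close> S(3) by (metis injD injI)
    show "C (R (R x)) = x" using S(3)[of "R (R x)"] SR by simp
  qed
  have Rsym: "R x \<bullet> y = x \<bullet> R y" for x y using S(2)[of "R x" "R y"] by (simp add: SR)
  have ip: "inner_C C x y = R x \<bullet> R y" for x y by (simp add: inner_C_def invC Rsym)
  then have "norm_C C x = norm (R x)" for x by (simp add: norm_C_def norm_eq_sqrt_inner)
  then show thesis using S(1,3) R SR RS invC Rsym ip by (intro that[of S R]) auto
qed

lemma closed_image_isomorphism:
  assumes "bounded_linear S" "\<And>x. S (R x) = x" "\<And>x. R (S x) = x" "closed X"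
  shows "closed (R ` X)"
proof -
  have "R ` X = S -` X" using assms(2,3) by (auto simp: image_iff) metis
  then show ?thesis
    using assms(4) bounded_linear.continuous_on[OF assms(1) continuous_on_id, of UNIV] by (simp add: closed_vimage)
qed

text \<open>Compactness: a point \<open>x\<close> whose ball has radius \<open>2 * \<rho> t\<close>
  at time \<open>t\<close> still has a ball of radius \<open>\<rho> t\<close> at all times closer
  than \<open>\<rho> t / (L + 1)\<close>, and finitely many of these time intervals cover
  \<open>{0..T}\<close>.\<close>

lemma uniform_slater_radius:
  fixes s :: "real \<Rightarrow> 'h::real_normed_vector"
  assumes L: "L \<ge> 0" "\<And>t t'. t \<in> {0..T} \<Longrightarrow> t' \<in> {0..T} \<Longrightarrow> norm (s t - s t') \<le> L * \<bar>t - t'\<bar>"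
    and slater: "\<And>t. t \<in> {0..T} \<Longrightarrow> \<exists>x\<in>V. x + s t \<in> interior \<Sigma>"
  shows "\<exists>r>0. \<forall>t\<in>{0..T}. \<exists>x\<in>V. cball (x + s t) r \<subseteq> \<Sigma>"
proof -
  have "\<exists>\<rho>>0. \<exists>x\<in>V. cball (x + s t) (2 * \<rho>) \<subseteq> \<Sigma>" if t: "t \<in> {0..T}" for t
  proof -
    obtain x where "x \<in> V" "x + s t \<in> interior \<Sigma>" using slater[OF t] by blast
    then obtain e where "e > 0" "cball (x + s t) e \<subseteq> \<Sigma>" by (auto simp: mem_interior_cball)
    then show ?thesis using \<open>x \<in> V\<close> by (intro exI[of _ "e / 2"]) auto
  qed
  then obtain \<rho> where \<rho>: "\<And>t. t \<in> {0..T} \<Longrightarrow> \<rho> t > 0" "\<And>t. t \<in> {0..T} \<Longrightarrow> \<exists>x\<in>V. cball (x + s t) (2 * \<rho> t) \<subseteq> \<Sigma>"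
    by metis
  define d where "d t = \<rho> t / (L + 1)" for t
  have "{0..T} \<subseteq> (\<Union>t\<in>{0..T}. ball t (d t))"
  proof
    fix t assume "t \<in> {0..T}"
    then have "t \<in> ball t (d t)" using \<rho>(1) L(1) by (simp add: d_def)
    then show "t \<in> (\<Union>t\<in>{0..T}. ball t (d t))" using \<open>t \<in> {0..T}\<close> by blast
  qed
  then obtain I where I: "I \<subseteq> {0..T}" "finite I" "{0..T} \<subseteq> (\<Union>t\<in>I. ball t (d t))"
    using compactE_image[OF compact_Icc, of "{0..T}" "\<lambda>t. ball t (d t)" 0 T] by auto
  \<comment> \<open>Inserting 1 makes the minimum meaningful without an argument about
    \<open>I\<close>.\<close>
  define r where "r = Min (insert 1 (\<rho> ` I))"
  have r: "r > 0" "\<And>t. t \<in> I \<Longrightarrow> r \<le> \<rho> t" using I \<rho>(1) by (auto simp: r_def)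
  have "\<exists>x\<in>V. cball (x + s t) r \<subseteq> \<Sigma>" if t: "t \<in> {0..T}" for t
  proof -
    obtain t' where t': "t' \<in> I" "t \<in> ball t' (d t')" using I(3) t by blast
    then have "t' \<in> {0..T}" using I by blast
    then obtain x where x: "x \<in> V" "cball (x + s t') (2 * \<rho> t') \<subseteq> \<Sigma>" using \<rho>(2) by blast
    have "norm (s t - s t') \<le> L * \<bar>t - t'\<bar>" using L(2) t \<open>t' \<in> {0..T}\<close> by blast
    also have "\<dots> \<le> (L + 1) * d t'" using t'(2) L(1) by (intro mult_mono) (auto simp: dist_real_def abs_minus_commute)
    also have "\<dots> = \<rho> t'" using L(1) by (simp add: d_def)
    finally have "dist (x + s t) (x + s t') \<le> \<rho> t'" by (simp add: dist_norm)
    then have "dist (x + s t') z \<le> 2 * \<rho> t'" if "dist (x + s t) z \<le> r" for z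
      using that r(2)[OF t'(1)] dist_triangle[of "x + s t'" z "x + s t"] dist_commute[of "x + s t" "x + s t'"] by linarith
    then have "cball (x + s t) r \<subseteq> cball (x + s t') (2 * \<rho> t')" by auto
    then show ?thesis using x by blast
  qed
  then show ?thesis using r(1) by blast
qed

text \<open>By uniform boundedness on the closed subspace \<open>Im E\<close>; this replaces the closed range and open
  mapping theorems in the boundedness of \<open>Q\<close>.\<close>

lemma stress_range_coercive:
  fixes E :: "'x::real_normed_vector \<Rightarrow> 'h::{real_inner,banach}" and C :: "'h \<Rightarrow> 'h"
  assumes W0: "subspace W0" and E: "linear_on_subspace W0 E" and "closed (E ` W0)"
    and C: "bounded_linear C" and coer: "\<exists>c0>0. \<forall>x. C x \<bullet> x \<ge> c0 * (norm x)\<^sup>2"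
  shows "\<exists>k\<ge>0. \<forall>\<tau>\<in>stress_range W0 E C. \<forall>b\<ge>0. (\<forall>w\<in>W0. \<bar>\<tau> \<bullet> E w\<bar> \<le> b * norm w) \<longrightarrow> norm \<tau> \<le> k * b"
proof -
  obtain c0 where c0: "c0 > 0" "\<And>x. C x \<bullet> x \<ge> c0 * (norm x)\<^sup>2" using coer by blast
  obtain KC where KC: "KC > 0" "\<And>x. norm (C x) \<le> norm x * KC" using bounded_linear.pos_bounded[OF C] by blast
  define X where "X = E ` W0"
  have X: "subspace X" "closed X" using linear_on_subspace_image[OF W0 E] assms(3) by (auto simp: X_def)
  \<comment> \<open>For \<open>h = E w\<close> the pairings with this set are bounded by
    \<open>norm w\<close>, so it is pointwise bounded on the range of \<open>E\<close>.\<close>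
  define \<T> where "\<T> = {e \<in> X. \<forall>w\<in>W0. \<bar>e \<bullet> E w\<bar> \<le> norm w}"
  have "bounded \<T>"
  proof (rule uniform_boundedness_inner[OF X])
    show "\<T> \<subseteq> X" by (auto simp: \<T>_def)
    fix h assume "h \<in> X"
    then obtain w where "w \<in> W0" "h = E w" by (auto simp: X_def)
    then show "\<exists>K. \<forall>e\<in>\<T>. \<bar>e \<bullet> h\<bar> \<le> K" by (auto simp: \<T>_def)
  qed
  then obtain K0 where K0: "K0 > 0" "\<And>e. e \<in> \<T> \<Longrightarrow> norm e \<le> K0" by (auto simp: bounded_pos)
  have main: "norm \<tau> \<le> (K0 / c0 * KC) * b"
    if \<tau>: "\<tau> \<in> stress_range W0 E C" and "0 \<le> b" and bd: "\<forall>w\<in>W0. \<bar>\<tau> \<bullet> E w\<bar> \<le> b * norm w" for \<tau> b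
  proof -
    obtain w0 where w0: "w0 \<in> W0" "\<tau> = C (E w0)" using \<tau> by (auto simp: stress_range_def)
    let ?e = "E w0"
    have low: "c0 * (norm ?e)\<^sup>2 \<le> \<tau> \<bullet> ?e" using c0(2)[of ?e] w0 by simp
    have "\<tau> \<bullet> ?e \<le> b * K0 * norm ?e"
    proof (cases "b = 0")
      case True
      then show ?thesis using bd w0(1) by fastforce
    next
      case False
      \<comment> \<open>\<open>\<tau>\<close> itself may lie outside the range of \<open>E\<close>;
        projecting keeps all pairings with that range and brings
        \<open>(1 / b) *\<^sub>R \<tau>\<close> into \<open>\<T>\<close>.\<close>
      define e where "e = cproj X ((1 / b) *\<^sub>R \<tau>)"
      have ee: "e \<bullet> h = (1 / b) * (\<tau> \<bullet> h)" if "h \<in> X" for h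
        using cproj_subspace_orth[OF X that, of "(1 / b) *\<^sub>R \<tau>"] by (simp add: e_def inner_diff_left)
      have "e \<in> \<T>"
        unfolding \<T>_def
      proof (intro CollectI conjI ballI)
        show "e \<in> X" unfolding e_def by (rule cproj_subspace_in[OF X])
        fix w assume w: "w \<in> W0"
        then have "\<bar>\<tau> \<bullet> E w\<bar> \<le> b * norm w" using bd by blast
        then show "\<bar>e \<bullet> E w\<bar> \<le> norm w"
          using ee[of "E w"] w \<open>0 \<le> b\<close> False by (simp add: X_def abs_mult pos_divide_le_eq mult.commute)
      qed
      then have "e \<bullet> ?e \<le> K0 * norm ?e"
        using norm_cauchy_schwarz[of e ?e] mult_right_mono[OF K0(2), of e "norm ?e"] by simp
      moreover have "\<tau> \<bullet> ?e = b * (e \<bullet> ?e)" using ee[of ?e] w0(1) False by (simp add: X_def)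
      ultimately show ?thesis using \<open>0 \<le> b\<close> by (simp add: mult_left_mono mult.assoc)
    qed
    then have "(c0 * norm ?e) * norm ?e \<le> (b * K0) * norm ?e" using low by (simp add: power2_eq_square mult.assoc)
    then have "c0 * norm ?e \<le> b * K0" using K0(1) \<open>0 \<le> b\<close> by (cases "norm ?e = 0") auto
    then have "norm ?e \<le> K0 / c0 * b" using c0(1) by (simp add: field_simps)
    then show ?thesis using KC(2)[of ?e] mult_right_mono[of "norm ?e" "K0 / c0 * b" KC] KC(1) w0(2) by (simp add: mult_ac)
  qed
  have "0 \<le> K0 / c0 * KC" using K0 c0 KC by simp
  then show ?thesis using main by blast
qed

text \<open>The slack is of second order and disappears from the right difference quotients; this is
  how normality reaches the derivative of \<open>p\<close>.\<close>

lemma real_increment_square_imp_derivative_nonpos: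
  fixes \<phi> :: "real \<Rightarrow> real"
  assumes "(\<phi> has_vector_derivative l) (at t)" and "\<And>t'. t \<le> t' \<Longrightarrow> \<phi> t' - \<phi> t \<le> M * (t' - t)\<^sup>2"
  shows "l \<le> 0"
proof (rule LIMSEQ_le)
  define h where "h n = 1 / real (Suc n)" for n
  have h: "h n > 0" for n by (simp add: h_def)
  have hl: "h \<longlonglongrightarrow> 0" unfolding h_def by (intro LIMSEQ_Suc lim_1_over_n)
  show "(\<lambda>n. (\<phi> (t + h n) - \<phi> t) / h n) \<longlonglongrightarrow> l"
    using filterlim_compose[OF assms(1)[unfolded has_vector_derivative_at_iff_quotient] filterlim_add_inverse_Suc_at]
    by (simp add: h_def mult.commute)
  have "(\<lambda>n. M * h n) \<longlonglongrightarrow> M * 0" by (intro tendsto_intros hl)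
  then show "(\<lambda>n. M * h n) \<longlonglongrightarrow> 0" by simp
  have "(\<phi> (t + h n) - \<phi> t) / h n \<le> M * h n" for n
    using assms(2)[of "t + h n"] h[of n] by (simp add: pos_divide_le_eq power2_eq_square)
  then show "\<exists>N. \<forall>n\<ge>N. (\<phi> (t + h n) - \<phi> t) / h n \<le> M * h n" by blast
qed

text \<open>\<open>S\<close> and \<open>R\<close>, the square root of \<open>C\<close> and its
  inverse, are parameters, so that all facts about the weighted space can be expressed by the plain
  inner product.\<close>

locale elastoplastic_data =
  fixes W0 :: "'x::real_normed_vector set" and E :: "'x \<Rightarrow> 'h::{real_inner,banach,second_countable_topology}"
    and C S R :: "'h \<Rightarrow> 'h"
  assumes W0: "subspace W0" and E: "linear_on_subspace W0 E" "closed (E ` W0)"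
    and C: "bounded_linear C" "\<exists>c0>0. \<forall>x. C x \<bullet> x \<ge> c0 * (norm x)\<^sup>2"
    and S: "bounded_linear S" and R: "bounded_linear R" and SR: "\<And>x. S (R x) = x" and RS: "\<And>x. R (S x) = x"
    and C_eq: "\<And>x. C x = S (S x)" and invC_eq: "\<And>x. inv C x = R (R x)" and R_sym: "\<And>x y. R x \<bullet> y = x \<bullet> R y"
    and inner_C_eq: "\<And>x y. inner_C C x y = R x \<bullet> R y" and norm_C_eq: "\<And>x. norm_C C x = norm (R x)"
begin

section \<open>Orthogonality of the stress spaces; the operators G and Q\<close>

sublocale S: bounded_linear S by (rule S)
sublocale R: bounded_linear R by (rule R)

abbreviation "V \<equiv> adj_ker W0 E"
abbreviation "U \<equiv> stress_range W0 E C"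

lemma V_eq: "V = {\<sigma>. \<forall>w\<in>W0. \<sigma> \<bullet> E w = 0}" by (rule adj_ker_eq[OF W0])

lemma V: "subspace V" "closed V"
proof -
  show "subspace V" by (auto simp: V_eq subspace_def inner_add_left)
  have "V = (\<Inter>w\<in>W0. {\<sigma>. \<sigma> \<bullet> E w = 0})" by (auto simp: V_eq)
  then show "closed V" by (auto intro!: closed_INT closed_Collect_eq continuous_intros)
qed

lemma RV: "subspace (R ` V)" "closed (R ` V)"
  using linear_subspace_image[OF R.linear_axioms V(1)] closed_image_isomorphism[OF S SR RS V(2)] by auto

lemma image_E: "subspace (E ` W0)"
  by (rule linear_on_subspace_image[OF W0 E(1)])

text \<open>Weighted orthogonality to \<open>V\<close> says that \<open>inv C z\<close> is
  orthogonal to everything orthogonal to the range of \<open>E\<close>; as this range is a closed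
  subspace, it contains \<open>inv C z\<close>.\<close>

lemma in_U:
  assumes "\<And>v. v \<in> V \<Longrightarrow> R z \<bullet> R v = 0"
  shows "z \<in> U"
proof -
  have "inv C z \<in> E ` W0"
  proof (rule biorthogonal_in_closed_subspace[OF image_E E(2)])
    fix q assume "\<forall>v\<in>E ` W0. q \<bullet> v = 0"
    then have "q \<in> V" by (auto simp: V_eq)
    then show "inv C z \<bullet> q = 0" using assms by (simp add: invC_eq R_sym)
  qed
  then obtain w where "w \<in> W0" "inv C z = E w" by blast
  then show ?thesis unfolding stress_range_def by (intro image_eqI[of _ _ w]) (metis C_eq SR invC_eq)
qed

lemma U_orth: assumes "u \<in> U" "v \<in> V" shows "R u \<bullet> R v = 0"
proof -
  obtain w where w: "w \<in> W0" "u = C (E w)" using assms(1) by (auto simp: stress_range_def)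
  have "R u \<bullet> R v = v \<bullet> E w" using w R_sym[of v "S (E w)"] by (simp add: C_eq RS inner_commute)
  then show ?thesis using w assms(2) by (auto simp: V_eq)
qed

lemma U_diff: assumes "u \<in> U" "u' \<in> U" shows "u - u' \<in> U"
proof (rule in_U)
  fix v assume "v \<in> V"
  then show "R (u - u') \<bullet> R v = 0" using U_orth assms by (simp add: R.diff inner_diff_left)
qed

lemma U_eq_0:
  assumes "u \<in> U" "\<And>w. w \<in> W0 \<Longrightarrow> u \<bullet> E w = 0"
  shows "u = 0"
proof -
  have "u \<in> V" using assms by (simp add: V_eq)
  then have "R u \<bullet> R u = 0" using U_orth assms by blast
  then have "S (R u) = 0" using S.zero by simp
  then show ?thesis by (simp add: SR)
qed

text \<open>The weighted projection is the plain projection onto the image of \<open>V\<close> under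
  \<open>R\<close>, conjugated by \<open>R\<close>.\<close>

lemma G_op:
  shows "G_op W0 E C \<tau> \<in> V" "v \<in> V \<Longrightarrow> R (C \<tau> - G_op W0 E C \<tau>) \<bullet> R v = 0"
proof -
  define p where "p = S (cproj (R ` V) (R (C \<tau>)))"
  have Rp: "R p = cproj (R ` V) (R (C \<tau>))" by (simp add: p_def RS)
  then have "R p \<in> R ` V" using cproj_subspace_in[OF RV] by simp
  then have pV: "p \<in> V" using SR by (metis imageE)
  have orth: "inner_C C (C \<tau> - p) v = 0" if "v \<in> V" for v
    using cproj_subspace_orth[OF RV, of "R v" "R (C \<tau>)"] that by (simp add: inner_C_eq R.diff Rp)
  have "proj_C C V (C \<tau>) = p"
    unfolding proj_C_def
  proof (rule the_equality)
    show "p \<in> V \<and> (\<forall>v\<in>V. inner_C C (C \<tau> - p) v = 0)" using pV orth by blast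
    fix q assume q: "q \<in> V \<and> (\<forall>v\<in>V. inner_C C (C \<tau> - q) v = 0)"
    have d: "q - p \<in> V" using q pV V(1) by (simp add: subspace_diff)
    have "R (q - p) \<bullet> R (q - p) = inner_C C (C \<tau> - p) (q - p) - inner_C C (C \<tau> - q) (q - p)"
      by (simp add: inner_C_eq R.diff inner_diff_left)
    also have "\<dots> = 0" using q orth d by simp
    finally have "S (R (q - p)) = 0" using S.zero by simp
    then show "q = p" by (simp add: SR)
  qed
  then have "G_op W0 E C \<tau> = p" by (simp add: G_op_def)
  then show "G_op W0 E C \<tau> \<in> V" "v \<in> V \<Longrightarrow> R (C \<tau> - G_op W0 E C \<tau>) \<bullet> R v = 0"
    using pV orth by (auto simp: inner_C_eq)
qed

lemma G_op_lipschitz: "\<exists>k\<ge>0. \<forall>a b. norm (G_op W0 E C a - G_op W0 E C b) \<le> k * norm (a - b)"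
proof -
  obtain k1 where k1: "k1 > 0" "\<And>x. norm (S x) \<le> norm x * k1" using S.pos_bounded by blast
  obtain k2 where k2: "k2 > 0" "\<And>x. norm (R (C x)) \<le> norm x * k2"
    using bounded_linear.pos_bounded[OF bounded_linear_compose[OF R C(1)]] by blast
  have "norm (G_op W0 E C a - G_op W0 E C b) \<le> (k2 * k1) * norm (a - b)" for a b
  proof -
    let ?d = "G_op W0 E C a - G_op W0 E C b"
    have dV: "?d \<in> V" using G_op(1) V(1) by (simp add: subspace_diff)
    have "R ?d \<bullet> R ?d = R (C (a - b)) \<bullet> R ?d"
    proof -
      have "R (C a - G_op W0 E C a) \<bullet> R ?d = 0" "R (C b - G_op W0 E C b) \<bullet> R ?d = 0" by (intro G_op(2) dV)+
      then show ?thesis by (simp add: R.diff bounded_linear.linear[OF C(1), THEN linear_diff] inner_diff_left)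
    qed
    also have "\<dots> \<le> norm (R (C (a - b))) * norm (R ?d)" by (rule norm_cauchy_schwarz)
    finally have "norm (R ?d) * norm (R ?d) \<le> norm (R (C (a - b))) * norm (R ?d)"
      by (simp add: dot_square_norm power2_eq_square)
    then have "norm (R ?d) \<le> norm (R (C (a - b)))" by (cases "norm (R ?d) = 0") auto
    then have "norm (R ?d) * k1 \<le> (norm (a - b) * k2) * k1" using k2(2)[of "a - b"] k1(1) by (intro mult_right_mono) auto
    then show ?thesis using k1(2)[of "R ?d"] by (simp add: SR mult_ac)
  qed
  then show ?thesis using k1 k2 by (intro exI[of _ "k2 * k1"]) auto
qed

text \<open>The adjoint is injective here because the stress range meets \<open>V\<close> only in 0.
  For existence, a preimage of \<open>l\<close> is projected onto the stress range in the weighted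
  geometry; by \<open>adj_cong\<close> its value under the adjoint is unchanged.\<close>

lemma Q_op:
  assumes "l \<in> adj_im W0 E"
  shows "Q_op W0 E C l \<in> U" "w \<in> W0 \<Longrightarrow> Q_op W0 E C l \<bullet> E w = l w"
proof -
  let ?D = "U \<inter> adj_dom W0 E"
  have inj: "inj_on (adj_op W0 E) ?D"
  proof (rule inj_onI)
    fix a b assume ab: "a \<in> ?D" "b \<in> ?D" "adj_op W0 E a = adj_op W0 E b"
    have "a - b = 0"
    proof (rule U_eq_0)
      show "a - b \<in> U" using ab U_diff by blast
      fix w assume "w \<in> W0"
      then show "(a - b) \<bullet> E w = 0" using ab adj_op_spec(2)[OF W0, of _ E w] by (simp add: inner_diff_left) (metis IntD2)
    qed
    then show "a = b" by simp
  qed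
  obtain \<sigma> where \<sigma>: "\<sigma> \<in> adj_dom W0 E" "l = adj_op W0 E \<sigma>" using assms by (auto simp: adj_im_def)
  have SE: "subspace (S ` E ` W0)" "closed (S ` E ` W0)"
    using linear_subspace_image[OF S.linear_axioms image_E] closed_image_isomorphism[OF R RS SR E(2)] by auto
  obtain w0 where w0: "w0 \<in> W0" "cproj (S ` E ` W0) (R \<sigma>) = S (E w0)"
    using cproj_subspace_in[OF SE, of "R \<sigma>"] by blast
  have eq: "C (E w0) \<bullet> E w = \<sigma> \<bullet> E w" if "w \<in> W0" for w
  proof -
    have "(R \<sigma> - S (E w0)) \<bullet> S (E w) = 0"
      using cproj_subspace_orth[OF SE, of "S (E w)" "R \<sigma>"] that w0(2) by simp
    moreover have "R \<sigma> \<bullet> S (E w) = \<sigma> \<bullet> E w" by (simp add: R_sym RS)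
    moreover have "S (E w0) \<bullet> S (E w) = C (E w0) \<bullet> E w" using R_sym[of "S (S (E w0))" "S (E w)"] by (simp add: RS C_eq)
    ultimately show ?thesis by (simp add: inner_diff_left)
  qed
  have u: "C (E w0) \<in> ?D" "adj_op W0 E (C (E w0)) = l"
  proof -
    have "C (E w0) \<in> adj_dom W0 E \<longleftrightarrow> \<sigma> \<in> adj_dom W0 E" by (rule adj_cong(1)) (rule eq)
    moreover show "adj_op W0 E (C (E w0)) = l" unfolding \<sigma>(2) by (rule adj_cong(2)) (rule eq)
    ultimately show "C (E w0) \<in> ?D" using \<sigma>(1) w0(1) by (auto simp: stress_range_def)
  qed
  have "Q_op W0 E C l = C (E w0)"
    unfolding Q_op_def using the_inv_into_f_f[OF inj u(1)] u(2) by simp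
  then show "Q_op W0 E C l \<in> U" "w \<in> W0 \<Longrightarrow> Q_op W0 E C l \<bullet> E w = l w"
    using u \<sigma> adj_op_spec(2)[OF W0 \<sigma>(1)] eq by auto
qed

text \<open>The difference of the \<open>Q\<close> parts lies in the stress range and its pairing
  with \<open>E w\<close> is the load difference at \<open>w\<close>, so the coercivity estimate on
  that range bounds it.\<close>

lemma elastic_stress_lipschitz:
  assumes "T > 0" and g: "W1inf T g" and f: "W1inf_dual (closure W0) (adj_im W0 E) T f"
  shows "\<exists>L\<ge>0. \<forall>s\<in>{0..T}. \<forall>t\<in>{0..T}. norm (elastic_stress W0 E C g f t - elastic_stress W0 E C g f s) \<le> L * \<bar>t - s\<bar>"
proof -
  have im: "adj_im W0 E \<subseteq> dual_space (closure W0)"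
    using adj_op_spec(1)[OF W0] by (auto simp: adj_im_def)
  have fA: "f t \<in> adj_im W0 E" if "t \<in> {0..T}" for t using f that by (simp add: W1inf_dual_def)
  obtain Bg where Bg: "Bg \<ge> 0" "\<And>s t. s \<in> {0..T} \<Longrightarrow> t \<in> {0..T} \<Longrightarrow> norm (g t - g s) \<le> Bg * \<bar>t - s\<bar>"
    using W1inf_imp_lipschitz[OF \<open>T > 0\<close> g] by blast
  obtain Bf where Bf: "Bf \<ge> 0" "\<And>s t x. s \<in> {0..T} \<Longrightarrow> t \<in> {0..T} \<Longrightarrow> x \<in> closure W0 \<Longrightarrow> \<bar>f t x - f s x\<bar> \<le> Bf * norm x * \<bar>t - s\<bar>"
    using W1inf_dual_imp_lipschitz[OF \<open>T > 0\<close> subspace_closure[OF W0] im f] by blast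
  obtain kG where kG: "kG \<ge> 0" "\<And>a b. norm (G_op W0 E C a - G_op W0 E C b) \<le> kG * norm (a - b)"
    using G_op_lipschitz by blast
  obtain kQ where kQ: "kQ \<ge> 0" "\<And>\<tau> b. \<tau> \<in> U \<Longrightarrow> b \<ge> 0 \<Longrightarrow> (\<And>w. w \<in> W0 \<Longrightarrow> \<bar>\<tau> \<bullet> E w\<bar> \<le> b * norm w) \<Longrightarrow> norm \<tau> \<le> kQ * b"
    using stress_range_coercive[OF W0 E C] by blast
  have "norm (elastic_stress W0 E C g f t - elastic_stress W0 E C g f s) \<le> (kG * Bg + kQ * Bf) * \<bar>t - s\<bar>"
    if st: "s \<in> {0..T}" "t \<in> {0..T}" for s t
  proof -
    let ?q = "\<lambda>t. Q_op W0 E C (f t)"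
    have "norm (?q t - ?q s) \<le> kQ * (Bf * \<bar>t - s\<bar>)"
    proof (rule kQ(2))
      show "?q t - ?q s \<in> U" by (intro U_diff Q_op fA st)
      show "0 \<le> Bf * \<bar>t - s\<bar>" using Bf by simp
      fix w assume w: "w \<in> W0"
      then have "(?q t - ?q s) \<bullet> E w = f t w - f s w" using Q_op(2)[OF fA[OF st(1)] w] Q_op(2)[OF fA[OF st(2)] w] by (simp add: inner_diff_left)
      then show "\<bar>(?q t - ?q s) \<bullet> E w\<bar> \<le> Bf * \<bar>t - s\<bar> * norm w"
        using Bf(2)[OF st, of w] w closure_subset[of W0] by (auto simp: mult_ac)
    qed
    moreover have "norm (G_op W0 E C (g t) - G_op W0 E C (g s)) \<le> kG * (Bg * \<bar>t - s\<bar>)"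
      using kG(2)[of "g t" "g s"] mult_left_mono[OF Bg(2)[OF st] kG(1)] by linarith
    ultimately have "norm ((G_op W0 E C (g t) - G_op W0 E C (g s)) + (?q t - ?q s)) \<le> kG * (Bg * \<bar>t - s\<bar>) + kQ * (Bf * \<bar>t - s\<bar>)"
      by (intro norm_triangle_mono)
    then show ?thesis by (simp add: elastic_stress_def algebra_simps)
  qed
  then show ?thesis using kG Bg kQ Bf by (intro exI[of _ "kG * Bg + kQ * Bf"]) auto
qed

end

section \<open>The sweeping process and the strain\<close>

lemma hausdorff_C_le:
  assumes "A \<noteq> {}" "B \<noteq> {}" and nonneg: "\<And>x. 0 \<le> norm_C C x"
    and "\<And>a. a \<in> A \<Longrightarrow> \<exists>b\<in>B. norm_C C (a - b) \<le> r" "\<And>b. b \<in> B \<Longrightarrow> \<exists>a\<in>A. norm_C C (b - a) \<le> r"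
  shows "hausdorff_C C A B \<le> r"
proof -
  have "infdist_C C x D \<le> r" if "d \<in> D" "norm_C C (x - d) \<le> r" for x d D
    unfolding infdist_C_def by (rule cINF_lower2[where f = "\<lambda>a. norm_C C (x - a)", OF _ that], rule bdd_belowI2, rule nonneg)
  then have "infdist_C C a B \<le> r" "infdist_C C b A \<le> r" if "a \<in> A" "b \<in> B" for a b
    using assms(4)[OF that(1)] assms(5)[OF that(2)] by blast+
  then show ?thesis
    unfolding hausdorff_C_def using assms(1,2) by (auto intro!: cSUP_least)
qed

context elastoplastic_data
begin

context
  fixes T :: real and \<Sigma> :: "'h set" and \<sigma>t :: "real \<Rightarrow> 'h" and x0 :: 'h and \<C> :: "real \<Rightarrow> 'h set"
  assumes T: "T > 0" and \<Sigma>: "bounded \<Sigma>" "closed \<Sigma>" "convex \<Sigma>"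
    and \<sigma>t: "\<exists>L\<ge>0. \<forall>s\<in>{0..T}. \<forall>t\<in>{0..T}. norm (\<sigma>t t - \<sigma>t s) \<le> L * \<bar>t - s\<bar>"
    and slater: "\<forall>t\<in>{0..T}. ((\<lambda>\<tau>. \<tau> - \<sigma>t t) ` interior \<Sigma>) \<inter> V \<noteq> {}"
    and \<C>_eq: "\<C> = (\<lambda>t. ((\<lambda>\<tau>. \<tau> - \<sigma>t t) ` \<Sigma>) \<inter> V)"
begin

lemma weighted_sweeping_data:
  obtains D r L where "sweeping_data (R ` V) (R ` \<Sigma>) (\<lambda>t. R (\<sigma>t (clamp_time T t))) D r L"
proof -
  let ?s = "\<lambda>t. R (\<sigma>t (clamp_time T t))"
  obtain L0 where L0: "L0 \<ge> 0" "\<And>s t. s \<in> {0..T} \<Longrightarrow> t \<in> {0..T} \<Longrightarrow> norm (\<sigma>t t - \<sigma>t s) \<le> L0 * \<bar>t - s\<bar>"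
    using \<sigma>t by blast
  obtain k where k: "k > 0" "\<And>x. norm (R x) \<le> norm x * k" using R.pos_bounded by blast
  define L where "L = L0 * k"
  have L: "0 \<le> L" using L0 k by (simp add: L_def)
  have Rlip: "norm (R (\<sigma>t t) - R (\<sigma>t s)) \<le> L * \<bar>t - s\<bar>" if "s \<in> {0..T}" "t \<in> {0..T}" for s t
  proof -
    have "norm (R (\<sigma>t t) - R (\<sigma>t s)) \<le> norm (\<sigma>t t - \<sigma>t s) * k" using k(2)[of "\<sigma>t t - \<sigma>t s"] by (simp add: R.diff)
    also have "\<dots> \<le> (L0 * \<bar>t - s\<bar>) * k" using L0(2)[OF that] k(1) by (intro mult_right_mono) auto
    finally show ?thesis by (simp add: L_def mult_ac)
  qed
  have "\<exists>r>0. \<forall>t\<in>{0..T}. \<exists>x\<in>R ` V. cball (x + R (\<sigma>t t)) r \<subseteq> R ` \<Sigma>"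
  proof (rule uniform_slater_radius[OF L Rlip])
    fix t assume "t \<in> {0..T}"
    then obtain \<tau> where \<tau>: "\<tau> \<in> interior \<Sigma>" "\<tau> - \<sigma>t t \<in> V" using slater by blast
    have "R (\<tau> - \<sigma>t t) + R (\<sigma>t t) \<in> S -` interior \<Sigma>" using \<tau> by (simp add: R.diff SR)
    moreover have "open (S -` interior \<Sigma>)" by (intro open_vimage S.continuous_on continuous_on_id open_interior)
    moreover have "S -` interior \<Sigma> \<subseteq> R ` \<Sigma>"
    proof
      fix x assume "x \<in> S -` interior \<Sigma>"
      then have "S x \<in> \<Sigma>" using interior_subset by blast
      then show "x \<in> R ` \<Sigma>" by (intro image_eqI[of _ _ "S x"]) (simp_all add: RS)
    qed
    ultimately have "R (\<tau> - \<sigma>t t) + R (\<sigma>t t) \<in> interior (R ` \<Sigma>)" by (meson interior_maximal subsetD)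
    then show "\<exists>x\<in>R ` V. x + R (\<sigma>t t) \<in> interior (R ` \<Sigma>)" using \<tau>(2) by blast
  qed
  then obtain r where r: "r > 0" "\<And>t. t \<in> {0..T} \<Longrightarrow> \<exists>x\<in>R ` V. cball (x + R (\<sigma>t t)) r \<subseteq> R ` \<Sigma>" by blast
  have "bounded (R ` \<Sigma>)" by (rule bounded_linear_image[OF \<Sigma>(1) R])
  then obtain B where B: "\<And>a. a \<in> R ` \<Sigma> \<Longrightarrow> norm a \<le> B" by (auto simp: bounded_iff)
  \<comment> \<open>\<open>2 * B\<close> bounds the diameter; the maximum secures
    \<open>r \<le> D\<close> as the locale demands.\<close>
  have "sweeping_data (R ` V) (R ` \<Sigma>) ?s (max (2 * B) r) r L"
  proof
    show "subspace (R ` V)" "closed (R ` V)" by (rule RV)+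
    show "closed (R ` \<Sigma>)" by (rule closed_image_isomorphism[OF S SR RS \<Sigma>(2)])
    show "convex (R ` \<Sigma>)" by (rule convex_linear_image[OF R.linear_axioms \<Sigma>(3)])
    show "norm (a - b) \<le> max (2 * B) r" if "a \<in> R ` \<Sigma>" "b \<in> R ` \<Sigma>" for a b
      using norm_triangle_ineq4[of a b] B[OF that(1)] B[OF that(2)] by simp
    show "0 < r" "r \<le> max (2 * B) r" using r by auto
    show "\<exists>x\<in>R ` V. cball (x + ?s t) r \<subseteq> R ` \<Sigma>" for t
      using r(2) clamp_time(1)[OF T] by blast
    show "norm (?s t - ?s t') \<le> L * \<bar>t - t'\<bar>" for t t'
      using Rlip[OF clamp_time(1)[OF T] clamp_time(1)[OF T], of t t'] mult_left_mono[OF clamp_time(2)[OF T, of t t'] L] by linarith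
  qed
  then show thesis by (rule that)
qed

lemma \<C>_iff: "x \<in> \<C> t \<longleftrightarrow> x \<in> V \<and> x + \<sigma>t t \<in> \<Sigma>"
  unfolding \<C>_eq by (auto simp: image_iff intro: bexI[of _ "x + \<sigma>t t"])

lemma R_image_iff: "R x \<in> R ` X \<longleftrightarrow> x \<in> X"
  using RS SR by (metis imageE image_eqI)

lemma \<C>_properties:
  "\<forall>t\<in>{0..T}. closed (\<C> t) \<and> convex (\<C> t) \<and> \<C> t \<noteq> {}"
  "\<exists>L\<ge>0. \<forall>s\<in>{0..T}. \<forall>t\<in>{0..T}. hausdorff_C C (\<C> s) (\<C> t) \<le> L * \<bar>s - t\<bar>"
proof -
  obtain D r Ls where "sweeping_data (R ` V) (R ` \<Sigma>) (\<lambda>t. R (\<sigma>t (clamp_time T t))) D r Ls"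
    by (rule weighted_sweeping_data)
  then interpret sw: sweeping_data "R ` V" "R ` \<Sigma>" "\<lambda>t. R (\<sigma>t (clamp_time T t))" D r Ls .
  have K_iff: "R x \<in> sw.K t \<longleftrightarrow> x \<in> \<C> t" if "t \<in> {0..T}" for x t
    using clamp_time(3)[OF T that] R_image_iff[of "x + \<sigma>t t" \<Sigma>]
    by (simp add: sw.K_def sw.A_def \<C>_iff R_image_iff R.add)
  have ne: "\<C> t \<noteq> {}" if "t \<in> {0..T}" for t
  proof -
    obtain z where "z \<in> sw.K t" using sw.K_props(3) by blast
    then have "S z \<in> \<C> t" using K_iff[OF that, of "S z"] by (simp add: RS)
    then show ?thesis by blast
  qed
  show "\<forall>t\<in>{0..T}. closed (\<C> t) \<and> convex (\<C> t) \<and> \<C> t \<noteq> {}"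
  proof (intro ballI conjI ne)
    fix t assume t: "t \<in> {0..T}"
    have eq: "\<C> t = R -` sw.K t" using K_iff[OF t] by auto
    show "closed (\<C> t)" unfolding eq by (intro closed_vimage sw.K_props R.continuous_on continuous_on_id)
    show "convex (\<C> t)" unfolding eq by (rule convex_linear_vimage[OF R.linear_axioms sw.K_props(2)])
  qed
  have near: "\<exists>b\<in>\<C> t. norm_C C (a - b) \<le> sw.L * \<bar>s - t\<bar>" if "s \<in> {0..T}" "t \<in> {0..T}" "a \<in> \<C> s" for s t a
  proof -
    have "R a \<in> sw.K s" using K_iff[OF that(1)] that(3) by blast
    from sw.K_lipschitz[OF this, of t] obtain c where c: "c \<in> sw.K t" "norm (R a - c) \<le> sw.L * \<bar>s - t\<bar>" by blast
    have "S c \<in> \<C> t" using K_iff[OF that(2), of "S c"] c(1) by (simp add: RS)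
    moreover have "norm_C C (a - S c) = norm (R a - c)" by (simp add: norm_C_eq R.diff RS)
    ultimately show ?thesis using c(2) by (intro bexI[of _ "S c"]) auto
  qed
  have "hausdorff_C C (\<C> s) (\<C> t) \<le> sw.L * \<bar>s - t\<bar>" if st: "s \<in> {0..T}" "t \<in> {0..T}" for s t
  proof (rule hausdorff_C_le[OF ne[OF st(1)] ne[OF st(2)]])
    show "0 \<le> norm_C C x" for x by (simp add: norm_C_eq)
    show "\<exists>b\<in>\<C> t. norm_C C (a - b) \<le> sw.L * \<bar>s - t\<bar>" if "a \<in> \<C> s" for a by (rule near[OF st that])
    show "\<exists>a\<in>\<C> s. norm_C C (b - a) \<le> sw.L * \<bar>s - t\<bar>" if "b \<in> \<C> t" for b
      using near[OF st(2,1) that] by (simp add: abs_minus_commute)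
  qed
  then show "\<exists>L\<ge>0. \<forall>s\<in>{0..T}. \<forall>t\<in>{0..T}. hausdorff_C C (\<C> s) (\<C> t) \<le> L * \<bar>s - t\<bar>"
    using sw.L0 by blast
qed

text \<open>Monotonicity of the normal cone: testing each inclusion with the other solution makes
  the squared weighted distance nonincreasing.\<close>

lemma sweeping_solution_unique:
  assumes "W1inf T z1" "sweeping_solution C T \<C> x0 z1" "W1inf T z2" "sweeping_solution C T \<C> x0 z2"
    and t: "t \<in> {0..T}"
  shows "z1 t = z2 t"
proof -
  obtain B1 where B1: "B1 \<ge> 0" "\<And>s t. s \<in> {0..T} \<Longrightarrow> t \<in> {0..T} \<Longrightarrow> norm (z1 t - z1 s) \<le> B1 * \<bar>t - s\<bar>"
    using W1inf_imp_lipschitz[OF T assms(1)] by blast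
  obtain B2 where B2: "B2 \<ge> 0" "\<And>s t. s \<in> {0..T} \<Longrightarrow> t \<in> {0..T} \<Longrightarrow> norm (z2 t - z2 s) \<le> B2 * \<bar>t - s\<bar>"
    using W1inf_imp_lipschitz[OF T assms(3)] by blast
  obtain k where k: "k > 0" "\<And>x. norm (R x) \<le> norm x * k" using R.pos_bounded by blast
  define d where "d t = R (z1 t - z2 t)" for t
  define w where "w t = d t \<bullet> d t" for t
  define M where "M = (B1 + B2) * k"
  have M0: "0 \<le> M" using B1 B2 k by (simp add: M_def)
  have d0: "d 0 = 0" using assms(2,4) by (simp add: d_def sweeping_solution_def R.zero)
  have dlip: "norm (d t - d s) \<le> M * \<bar>t - s\<bar>" if "s \<in> {0..T}" "t \<in> {0..T}" for s t
  proof -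
    have "d t - d s = R ((z1 t - z1 s) - (z2 t - z2 s))" by (simp add: d_def R.diff)
    then have "norm (d t - d s) \<le> norm ((z1 t - z1 s) - (z2 t - z2 s)) * k" using k(2) by simp
    also have "\<dots> \<le> (B1 * \<bar>t - s\<bar> + B2 * \<bar>t - s\<bar>) * k"
      using k(1) B1(2)[OF that] B2(2)[OF that] norm_triangle_ineq4[of "z1 t - z1 s" "z2 t - z2 s"] by (intro mult_right_mono) auto
    finally show ?thesis by (simp add: M_def algebra_simps)
  qed
  have dbd: "norm (d t) \<le> M * T" if "t \<in> {0..T}" for t
  proof -
    have "norm (d t) \<le> M * \<bar>t\<bar>" using dlip[of 0 t] that T d0 by simp
    also have "\<dots> \<le> M * T" using that M0 by (intro mult_left_mono) auto
    finally show ?thesis .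
  qed
  have wlip: "\<bar>w t - w s\<bar> \<le> (M * (2 * (M * T))) * \<bar>t - s\<bar>" if "s \<in> {0..T}" "t \<in> {0..T}" for s t
  proof -
    have "w t - w s = (d t - d s) \<bullet> (d t + d s)" by (simp add: w_def inner_diff_left inner_add_right inner_commute[of "d s" "d t"])
    then have "\<bar>w t - w s\<bar> \<le> norm (d t - d s) * norm (d t + d s)" using Cauchy_Schwarz_ineq2 by metis
    also have "\<dots> \<le> (M * \<bar>t - s\<bar>) * (M * T + M * T)"
      using M0 by (intro mult_mono dlip[OF that] norm_triangle_mono dbd that) auto
    finally show ?thesis by (simp add: mult_ac)
  qed
  have "w t \<le> w 0"
  proof (rule lipschitz_derivative_nonpos_imp_le[OF T wlip _ t])
    have AE: "AE t in lebesgue_on {0..T}. \<exists>y'. (z has_vector_derivative y') (at t within {0..T}) \<and> - y' \<in> normal_cone_C C (\<C> t) (z t)"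
      if "sweeping_solution C T \<C> x0 z" for z
      using that by (simp add: sweeping_solution_def)
    show "AE t in lebesgue_on {0..T}. t \<in> {0<..<T} \<longrightarrow> (\<exists>l\<le>0. (w has_vector_derivative l) (at t))"
      using AE[OF assms(2)] AE[OF assms(4)]
    proof eventually_elim
      case (elim t)
      show ?case
      proof
        assume t: "t \<in> {0<..<T}"
        have at: "at t within {0..T} = at t" using t by (intro at_within_interior) simp
        obtain a b where a: "(z1 has_vector_derivative a) (at t)" "- a \<in> normal_cone_C C (\<C> t) (z1 t)"
          and b: "(z2 has_vector_derivative b) (at t)" "- b \<in> normal_cone_C C (\<C> t) (z2 t)"
          using elim unfolding at by blast
        have z: "z1 t \<in> \<C> t" "z2 t \<in> \<C> t" using assms(2,4) t by (auto simp: sweeping_solution_def)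
        have "((\<lambda>t. z1 t - z2 t) has_vector_derivative (a - b)) (at t)" using a(1) b(1) by (rule has_vector_derivative_diff)
        then have d': "(d has_vector_derivative R (a - b)) (at t)"
          unfolding d_def[abs_def] by (rule R.has_vector_derivative)
        have "(w has_vector_derivative (d t \<bullet> R (a - b) + R (a - b) \<bullet> d t)) (at t)"
          unfolding w_def[abs_def] by (rule bounded_bilinear.has_vector_derivative[OF bounded_bilinear_inner d' d'])
        moreover have "R (a - b) \<bullet> d t \<le> 0"
        proof -
          have "R (- a) \<bullet> R (z2 t - z1 t) \<le> 0" "R (- b) \<bullet> R (z1 t - z2 t) \<le> 0"
            using a(2) b(2) z by (auto simp: normal_cone_C_def inner_C_eq)
          moreover have "R (a - b) \<bullet> d t = R (- a) \<bullet> R (z2 t - z1 t) + R (- b) \<bullet> R (z1 t - z2 t)"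
            by (simp add: d_def R.diff R.neg inner_diff_left inner_diff_right)
          ultimately show ?thesis by linarith
        qed
        ultimately show "\<exists>l\<le>0. (w has_vector_derivative l) (at t)"
          by (intro exI[of _ "d t \<bullet> R (a - b) + R (a - b) \<bullet> d t"]) (simp add: inner_commute[of "d t"])
      qed
    qed
  qed
  then have "d t = 0" using d0 by (simp add: w_def) (metis inner_gt_zero_iff not_less)
  then have "S (d t) = 0" using S.zero by simp
  then show ?thesis by (simp add: d_def SR)
qed

text \<open>\<open>y\<close> and \<open>p\<close> are carried back from the plain space by
  \<open>S\<close>. Normality of \<open>p'\<close> to the translate of \<open>\<Sigma>\<close> comes
  first, and the sweeping inclusion follows from it, because in weighted pairings with
  \<open>V\<close> the vectors \<open>p'\<close> and \<open>- y'\<close> agree. The Lipschitz bound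
  for the sum prepares the regularity of the strain.\<close>

lemma sweeping_and_strain_solution:
  assumes x0: "x0 \<in> \<C> 0"
  shows "\<exists>y p. W1inf T y \<and> y 0 = x0 \<and> p 0 = 0 \<and> (\<forall>t\<in>{0..T}. y t \<in> \<C> t) \<and>
    (AE t in lebesgue_on {0..T}. \<exists>y' p' s'.
       (y has_vector_derivative y') (at t) \<and> (p has_vector_derivative p') (at t) \<and> (\<sigma>t has_vector_derivative s') (at t) \<and>
       - y' \<in> normal_cone_C C (\<C> t) (y t) \<and> p' \<in> normal_cone_C C ((\<lambda>\<tau>. \<tau> - \<sigma>t t) ` \<Sigma>) (y t) \<and> p' + y' \<in> U) \<and>
    (\<exists>B. \<forall>s\<in>{0..T}. \<forall>t\<in>{0..T}. norm ((p t + y t + \<sigma>t t) - (p s + y s + \<sigma>t s)) \<le> B * \<bar>t - s\<bar>)"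
proof -
  obtain D r Ls where "sweeping_data (R ` V) (R ` \<Sigma>) (\<lambda>t. R (\<sigma>t (clamp_time T t))) D r Ls"
    by (rule weighted_sweeping_data)
  then interpret sw: sweeping_data "R ` V" "R ` \<Sigma>" "\<lambda>t. R (\<sigma>t (clamp_time T t))" D r Ls .
  have K_iff: "z \<in> sw.K t \<longleftrightarrow> S z \<in> \<C> t" if "t \<in> {0..T}" for z t
    using clamp_time(3)[OF T that] R_image_iff[of "S z + \<sigma>t t" \<Sigma>] R_image_iff[of "S z" V]
    by (simp add: sw.K_def sw.A_def \<C>_iff R.add RS)
  have x0K: "R x0 \<in> sw.K 0" using K_iff[of 0 "R x0"] x0 T by (simp add: SR)
  define y1 where "y1 = sw.y (R x0)"
  obtain p1 where "p1 0 = 0" and p1_lip: "\<And>t t'. 0 \<le> t \<Longrightarrow> t \<le> t' \<Longrightarrow> norm (p1 t' - p1 t) \<le> sw.M * (t' - t)"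
    and orth1: "\<And>t v. t \<ge> 0 \<Longrightarrow> v \<in> R ` V \<Longrightarrow> (p1 t + y1 t - R x0) \<bullet> v = 0"
    and norm1: "\<And>t t' c. c \<in> R ` \<Sigma> \<Longrightarrow> 0 \<le> t \<Longrightarrow> t \<le> t' \<Longrightarrow>
       (p1 t' - p1 t) \<bullet> (c - R (\<sigma>t (clamp_time T t)) - y1 t) \<le> sw.M * (Ls + sw.M) * (t' - t)\<^sup>2"
    using sw.weak_limit_ex[OF x0K] unfolding y1_def by metis
  define y where "y t = S (y1 t)" for t
  define p where "p t = S (p1 t)" for t
  obtain k where k: "k > 0" "\<And>x. norm (S x) \<le> norm x * k" using S.pos_bounded by blast
  define M where "M = sw.M * k"
  have lip1': "norm (y1 t - y1 s) \<le> sw.M * \<bar>t - s\<bar>" "norm (p1 t - p1 s) \<le> sw.M * \<bar>t - s\<bar>" if "0 \<le> s" "0 \<le> t" for s t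
    using sw.y_lipschitz[OF x0K, of s t] sw.y_lipschitz[OF x0K, of t s] p1_lip[of s t] p1_lip[of t s] that
    by (cases "s \<le> t"; simp add: norm_minus_commute y1_def)+
  have ylip: "norm (y t - y s) \<le> M * \<bar>t - s\<bar>" and plip: "norm (p t - p s) \<le> M * \<bar>t - s\<bar>"
    if "s \<in> {0..T}" "t \<in> {0..T}" for s t
  proof -
    have "norm (y t - y s) \<le> norm (y1 t - y1 s) * k" "norm (p t - p s) \<le> norm (p1 t - p1 s) * k"
      using k(2)[of "y1 t - y1 s"] k(2)[of "p1 t - p1 s"] by (simp_all add: y_def p_def S.diff)
    moreover have "norm (y1 t - y1 s) * k \<le> (sw.M * \<bar>t - s\<bar>) * k" "norm (p1 t - p1 s) * k \<le> (sw.M * \<bar>t - s\<bar>) * k"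
      using lip1'[of s t] that k(1) by (auto intro!: mult_right_mono)
    ultimately show "norm (y t - y s) \<le> M * \<bar>t - s\<bar>" "norm (p t - p s) \<le> M * \<bar>t - s\<bar>"
      by (auto simp: M_def mult_ac intro: order_trans)
  qed
  obtain L0 where L0: "\<And>s t. s \<in> {0..T} \<Longrightarrow> t \<in> {0..T} \<Longrightarrow> norm (\<sigma>t t - \<sigma>t s) \<le> L0 * \<bar>t - s\<bar>"
    using \<sigma>t by blast
  have W: "W1inf T y"
    by (rule lipschitz_imp_W1inf[OF T]) (rule ylip)
  have AE: "AE t in lebesgue_on {0..T}. t \<in> {0<..<T} \<and> (\<exists>l. (y has_vector_derivative l) (at t))"
    "AE t in lebesgue_on {0..T}. t \<in> {0<..<T} \<and> (\<exists>l. (p has_vector_derivative l) (at t))"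
    "AE t in lebesgue_on {0..T}. t \<in> {0<..<T} \<and> (\<exists>l. (\<sigma>t has_vector_derivative l) (at t))"
    by (rule lipschitz_on_interval_differentiable_ae[OF T], erule (1) ylip plip L0)+
  have yC: "y t \<in> \<C> t" if "t \<in> {0..T}" for t
    using sw.y_in_K[OF x0K, of t] K_iff[OF that] that by (simp add: y_def y1_def)
  have "AE t in lebesgue_on {0..T}. \<exists>y' p' s'.
       (y has_vector_derivative y') (at t) \<and> (p has_vector_derivative p') (at t) \<and> (\<sigma>t has_vector_derivative s') (at t) \<and>
       - y' \<in> normal_cone_C C (\<C> t) (y t) \<and> p' \<in> normal_cone_C C ((\<lambda>\<tau>. \<tau> - \<sigma>t t) ` \<Sigma>) (y t) \<and> p' + y' \<in> U"
    using AE
  proof eventually_elim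
    case (elim t)
    then obtain y' p' s' where y': "(y has_vector_derivative y') (at t)" and p': "(p has_vector_derivative p') (at t)"
      and s': "(\<sigma>t has_vector_derivative s') (at t)" and t: "t \<in> {0<..<T}" by blast
    have tT: "t \<in> {0..T}" "0 \<le> t" using t by auto
    have y1': "((\<lambda>t. R (y t)) has_vector_derivative R y') (at t)" by (rule R.has_vector_derivative[OF y'])
    have p1': "((\<lambda>t. R (p t)) has_vector_derivative R p') (at t)" by (rule R.has_vector_derivative[OF p'])
    have orth: "R (p' + y') \<bullet> R v = 0" if v: "v \<in> V" for v
    proof -
      have "((\<lambda>t. (R (p t) + R (y t)) \<bullet> R v) has_vector_derivative (R p' + R y') \<bullet> R v) (at t)"
        by (rule bounded_linear.has_vector_derivative[OF bounded_linear_inner_left has_vector_derivative_add[OF p1' y1']])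
      moreover have "((\<lambda>t. (R (p t) + R (y t)) \<bullet> R v) has_vector_derivative 0) (at t)"
      proof -
        \<comment> \<open>The pairing of \<open>p + y\<close> with a vector of \<open>V\<close> is
          constant for nonnegative times, so its derivative at \<open>t\<close> is 0.\<close>
        have const: "(R (p s) + R (y s)) \<bullet> R v = R x0 \<bullet> R v" if "0 \<le> s" for s
          using orth1[OF that, of "R v"] v by (simp add: p_def y_def RS inner_add_left inner_diff_left)
        have "\<forall>\<^sub>F s in nhds t. s \<in> UNIV \<longrightarrow> (R (p s) + R (y s)) \<bullet> R v = R x0 \<bullet> R v"
          by (rule eventually_mono[OF eventually_nhds_in_open[of "{0<..}" t]]) (use t const in auto)
        from has_vector_derivative_cong_ev[OF this const[OF tT(2)], of 0] show ?thesis by simp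
      qed
      ultimately have "(R p' + R y') \<bullet> R v = 0" by (rule vector_derivative_unique_at)
      then show ?thesis by (simp add: R.add)
    qed
    have normal: "p' \<in> normal_cone_C C ((\<lambda>\<tau>. \<tau> - \<sigma>t t) ` \<Sigma>) (y t)"
      unfolding normal_cone_C_def
    proof (intro CollectI ballI)
      fix c assume "c \<in> (\<lambda>\<tau>. \<tau> - \<sigma>t t) ` \<Sigma>"
      then obtain \<tau> where \<tau>: "\<tau> \<in> \<Sigma>" "c = \<tau> - \<sigma>t t" by blast
      define h where "h = R \<tau> - R (\<sigma>t t) - R (y t)"
      have "R p' \<bullet> h \<le> 0"
      proof (rule real_increment_square_imp_derivative_nonpos)
        show "((\<lambda>t. R (p t) \<bullet> h) has_vector_derivative R p' \<bullet> h) (at t)"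
          by (rule bounded_linear.has_vector_derivative[OF bounded_linear_inner_left p1'])
        fix t' assume "t \<le> t'"
        then show "R (p t') \<bullet> h - R (p t) \<bullet> h \<le> sw.M * (Ls + sw.M) * (t' - t)\<^sup>2"
          using norm1[of "R \<tau>" t t'] \<tau>(1) tT clamp_time(3)[OF T tT(1)]
          by (simp add: h_def p_def y_def RS inner_diff_left)
      qed
      then show "inner_C C p' (c - y t) \<le> 0" by (simp add: inner_C_eq \<tau>(2) h_def R.diff)
    qed
    have "- y' \<in> normal_cone_C C (\<C> t) (y t)"
      unfolding normal_cone_C_def
    proof (intro CollectI ballI)
      fix c assume c: "c \<in> \<C> t"
      then have "c - y t \<in> V" using yC[OF tT(1)] V(1) by (auto simp: \<C>_iff subspace_diff)
      then have "R (p' + y') \<bullet> R (c - y t) = 0" by (rule orth)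
      moreover have "inner_C C p' (c - y t) \<le> 0" using normal c by (auto simp: normal_cone_C_def \<C>_eq)
      ultimately show "inner_C C (- y') (c - y t) \<le> 0" by (simp add: inner_C_eq R.add R.neg inner_add_left)
    qed
    moreover have "p' + y' \<in> U" by (rule in_U) (rule orth)
    ultimately show ?case using y' p' s' normal by blast
  qed
  moreover have "norm ((p t + y t + \<sigma>t t) - (p s + y s + \<sigma>t s)) \<le> (M + M + L0) * \<bar>t - s\<bar>" if "s \<in> {0..T}" "t \<in> {0..T}" for s t
  proof -
    have "norm ((p t - p s) + (y t - y s) + (\<sigma>t t - \<sigma>t s)) \<le> M * \<bar>t - s\<bar> + M * \<bar>t - s\<bar> + L0 * \<bar>t - s\<bar>"
      by (intro norm_triangle_mono ylip plip L0 that)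
    then show ?thesis by (simp add: algebra_simps)
  qed
  then have "\<exists>B. \<forall>s\<in>{0..T}. \<forall>t\<in>{0..T}. norm ((p t + y t + \<sigma>t t) - (p s + y s + \<sigma>t s)) \<le> B * \<bar>t - s\<bar>" by blast
  moreover have "y 0 = x0" "p 0 = 0" using sw.y_0[OF x0K] \<open>p1 0 = 0\<close> by (simp_all add: y_def y1_def p_def SR S.zero)
  ultimately show ?thesis using W yC by (intro exI[of _ y] exI[of _ p]) simp
qed

end

end

theorem theorem4p2:
  fixes W0 :: "'x::banach set"
    and E :: "'x \<Rightarrow> 'h::{real_inner,banach,second_countable_topology}"
    and C :: "'h \<Rightarrow> 'h"
    and T :: real
    and g :: "real \<Rightarrow> 'h"
    and f :: "real \<Rightarrow> 'x \<Rightarrow> real"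
    and \<Sigma> :: "'h set"
    and \<sigma>0 \<epsilon>0 :: 'h
    and U V :: "'h set"
    and \<sigma>t :: "real \<Rightarrow> 'h"
    and \<C> :: "real \<Rightarrow> 'h set"
  assumes T: "T > 0"
    and reflexive: "reflexive_banach TYPE('x)"
    and W0: "subspace W0"
    and E_linear: "linear_on_subspace W0 E"
    and E_closed: "closed ((\<lambda>w. (w, E w)) ` W0)"
    and E_closed_image: "closed (E ` W0)"
    and C_bounded: "bounded_linear C"
    and C_symmetric: "\<And>\<sigma> \<tau>. C \<sigma> \<bullet> \<tau> = \<sigma> \<bullet> C \<tau>"
    and C_coercive: "\<exists>c0>0. \<forall>\<tau>. C \<tau> \<bullet> \<tau> \<ge> c0 * (norm \<tau>)\<^sup>2"
    and g: "W1inf T g"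
    and f: "W1inf_dual (closure W0) (adj_im W0 E) T f"
    and \<Sigma>: "bounded \<Sigma>" "closed \<Sigma>" "convex \<Sigma>" "\<Sigma> \<noteq> {}"
    and U_eq: "U = stress_range W0 E C"
    and V_eq: "V = adj_ker W0 E"
    and \<sigma>t_eq: "\<sigma>t = elastic_stress W0 E C g f"
    and \<C>_eq: "\<C> = (\<lambda>t. ((\<lambda>\<tau>. \<tau> - \<sigma>t t) ` \<Sigma>) \<inter> V)"
    and \<sigma>0: "\<sigma>0 - \<sigma>t 0 \<in> \<C> 0"
    and \<epsilon>0: "\<epsilon>0 \<in> inv C ` ((\<lambda>u. u + \<sigma>t 0) ` U)"
    and Slater: "\<forall>t\<in>{0..T}. ((\<lambda>\<tau>. \<tau> - \<sigma>t t) ` interior \<Sigma>) \<inter> V \<noteq> {}"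
  shows
    "(\<forall>t\<in>{0..T}. closed (\<C> t) \<and> convex (\<C> t) \<and> \<C> t \<noteq> {}) \<and>
     (\<exists>L\<ge>0. \<forall>s\<in>{0..T}. \<forall>t\<in>{0..T}. hausdorff_C C (\<C> s) (\<C> t) \<le> L * \<bar>s - t\<bar>) \<and>
     (\<exists>y. W1inf T y \<and> sweeping_solution C T \<C> (\<sigma>0 - \<sigma>t 0) y \<and>
        (\<forall>z. W1inf T z \<and> sweeping_solution C T \<C> (\<sigma>0 - \<sigma>t 0) z \<longrightarrow> (\<forall>t\<in>{0..T}. z t = y t)) \<and>
        (AE t in lebesgue_on {0..T}. \<exists>y' s'.
           (y has_vector_derivative y') (at t within {0..T}) \<and>
           (\<sigma>t has_vector_derivative s') (at t within {0..T}) \<and>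
           strain_rates C ((\<lambda>\<tau>. \<tau> - \<sigma>t t) ` \<Sigma>) U (y t) y' s' \<noteq> {}) \<and>
        (\<exists>\<epsilon>. W1inf T \<epsilon> \<and> \<epsilon> 0 = \<epsilon>0 \<and>
           (AE t in lebesgue_on {0..T}. \<exists>\<epsilon>' y' s'.
              (\<epsilon> has_vector_derivative \<epsilon>') (at t within {0..T}) \<and>
              (y has_vector_derivative y') (at t within {0..T}) \<and>
              (\<sigma>t has_vector_derivative s') (at t within {0..T}) \<and>
              \<epsilon>' \<in> strain_rates C ((\<lambda>\<tau>. \<tau> - \<sigma>t t) ` \<Sigma>) U (y t) y' s')))"
proof (rule weighted_space_isometry[OF C_bounded C_symmetric C_coercive])
  fix S R
  assume iso: "bounded_linear S" "bounded_linear R" "\<And>x. S (R x) = x" "\<And>x. R (S x) = x"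
    "\<And>x. C x = S (S x)" "\<And>x. inv C x = R (R x)" "\<And>x y. R x \<bullet> y = x \<bullet> R y"
    "\<And>x y. inner_C C x y = R x \<bullet> R y" "\<And>x. norm_C C x = norm (R x)"
  note Slater' = Slater[unfolded V_eq] and \<C>_eq' = \<C>_eq[unfolded V_eq]
  interpret elastoplastic_data W0 E C S R
    by (rule elastoplastic_data.intro[OF W0 E_linear E_closed_image C_bounded C_coercive iso])
  have \<sigma>t_lip: "\<exists>L\<ge>0. \<forall>s\<in>{0..T}. \<forall>t\<in>{0..T}. norm (\<sigma>t t - \<sigma>t s) \<le> L * \<bar>t - s\<bar>"
    unfolding \<sigma>t_eq by (rule elastic_stress_lipschitz[OF T g f])
  note data = T \<Sigma>(1-3) \<sigma>t_lip Slater' \<C>_eq'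
  obtain y p where W: "W1inf T y" and y0: "y 0 = \<sigma>0 - \<sigma>t 0" "p 0 = 0" and yC: "\<forall>t\<in>{0..T}. y t \<in> \<C> t"
    and AE: "AE t in lebesgue_on {0..T}. \<exists>y' p' s'.
       (y has_vector_derivative y') (at t) \<and> (p has_vector_derivative p') (at t) \<and> (\<sigma>t has_vector_derivative s') (at t) \<and>
       - y' \<in> normal_cone_C C (\<C> t) (y t) \<and> p' \<in> normal_cone_C C ((\<lambda>\<tau>. \<tau> - \<sigma>t t) ` \<Sigma>) (y t) \<and>
       p' + y' \<in> stress_range W0 E C"
    and lip: "\<exists>B. \<forall>s\<in>{0..T}. \<forall>t\<in>{0..T}. norm ((p t + y t + \<sigma>t t) - (p s + y s + \<sigma>t s)) \<le> B * \<bar>t - s\<bar>"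
    using sweeping_and_strain_solution[OF data \<sigma>0] by blast
  note within = has_vector_derivative_at_within
  have sol: "sweeping_solution C T \<C> (\<sigma>0 - \<sigma>t 0) y"
    unfolding sweeping_solution_def using y0 yC AE by (auto elim!: eventually_mono intro: within)
  have invC: "bounded_linear (inv C)" using bounded_linear_compose[OF iso(2) iso(2)] iso(6) by (simp add: ext[OF iso(6)])
  interpret invC: bounded_linear "inv C" by (rule invC)
  \<comment> \<open>One witness for both parts: \<open>p'\<close> is the normal vector, and
    \<open>p' + y'\<close> already lies in the stress range.\<close>
  have rates: "inv C (p' + y' + s') \<in> strain_rates C ((\<lambda>\<tau>. \<tau> - \<sigma>t t) ` \<Sigma>) U (y t) y' s'"
    if "p' \<in> normal_cone_C C ((\<lambda>\<tau>. \<tau> - \<sigma>t t) ` \<Sigma>) (y t)" "p' + y' \<in> stress_range W0 E C" for t y' p' s'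
    unfolding strain_rates_def U_eq using that by blast
  \<comment> \<open>An antiderivative of the selection \<open>inv C (p' + y' + s')\<close>, shifted
    to start at \<open>\<epsilon>0\<close>.\<close>
  define \<epsilon> where "\<epsilon> t = \<epsilon>0 + inv C ((p t + y t + \<sigma>t t) - (p 0 + y 0 + \<sigma>t 0))" for t
  have "W1inf T \<epsilon>"
  proof -
    obtain B where B: "\<And>s t. s \<in> {0..T} \<Longrightarrow> t \<in> {0..T} \<Longrightarrow> norm ((p t + y t + \<sigma>t t) - (p s + y s + \<sigma>t s)) \<le> B * \<bar>t - s\<bar>"
      using lip by blast
    obtain k where k: "k > 0" "\<And>x. norm (inv C x) \<le> norm x * k" using invC.pos_bounded by blast
    show ?thesis
    proof (rule lipschitz_imp_W1inf[OF T])
      fix s t assume st: "s \<in> {0..T}" "t \<in> {0..T}"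
      have "\<epsilon> t - \<epsilon> s = inv C ((p t + y t + \<sigma>t t) - (p s + y s + \<sigma>t s))"
        unfolding \<epsilon>_def by (simp add: invC.diff invC.add)
      then have "norm (\<epsilon> t - \<epsilon> s) \<le> norm ((p t + y t + \<sigma>t t) - (p s + y s + \<sigma>t s)) * k" using k(2) by simp
      also have "\<dots> \<le> (B * \<bar>t - s\<bar>) * k" using B[OF st] k(1) by (intro mult_right_mono) auto
      finally show "norm (\<epsilon> t - \<epsilon> s) \<le> (B * k) * \<bar>t - s\<bar>" by (simp add: mult_ac)
    qed
  qed
  moreover have "\<epsilon> 0 = \<epsilon>0" by (simp add: \<epsilon>_def invC.zero)
  moreover have "AE t in lebesgue_on {0..T}. \<exists>\<epsilon>' y' s'.
      (\<epsilon> has_vector_derivative \<epsilon>') (at t within {0..T}) \<and> (y has_vector_derivative y') (at t within {0..T}) \<and>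
      (\<sigma>t has_vector_derivative s') (at t within {0..T}) \<and> \<epsilon>' \<in> strain_rates C ((\<lambda>\<tau>. \<tau> - \<sigma>t t) ` \<Sigma>) U (y t) y' s'"
    using AE
  proof eventually_elim
    case (elim t)
    then obtain y' p' s' where d: "(y has_vector_derivative y') (at t)" "(p has_vector_derivative p') (at t)" "(\<sigma>t has_vector_derivative s') (at t)"
      and n: "p' \<in> normal_cone_C C ((\<lambda>\<tau>. \<tau> - \<sigma>t t) ` \<Sigma>) (y t)" "p' + y' \<in> stress_range W0 E C" by blast
    have "((\<lambda>t. p t + y t + \<sigma>t t - (p 0 + y 0 + \<sigma>t 0)) has_vector_derivative (p' + y' + s' - 0)) (at t)"
      by (intro has_vector_derivative_diff has_vector_derivative_add d has_vector_derivative_const)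
    from has_vector_derivative_add[OF has_vector_derivative_const[of \<epsilon>0] invC.has_vector_derivative[OF this]]
    have "(\<epsilon> has_vector_derivative inv C (p' + y' + s')) (at t)" unfolding \<epsilon>_def[abs_def] by simp
    then show ?case using d(1,3) rates[OF n] within by blast
  qed
  ultimately have strain: "\<exists>\<epsilon>. W1inf T \<epsilon> \<and> \<epsilon> 0 = \<epsilon>0 \<and> (AE t in lebesgue_on {0..T}. \<exists>\<epsilon>' y' s'.
      (\<epsilon> has_vector_derivative \<epsilon>') (at t within {0..T}) \<and> (y has_vector_derivative y') (at t within {0..T}) \<and>
      (\<sigma>t has_vector_derivative s') (at t within {0..T}) \<and> \<epsilon>' \<in> strain_rates C ((\<lambda>\<tau>. \<tau> - \<sigma>t t) ` \<Sigma>) U (y t) y' s')"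
    by blast
  have nonempty: "AE t in lebesgue_on {0..T}. \<exists>y' s'. (y has_vector_derivative y') (at t within {0..T}) \<and>
      (\<sigma>t has_vector_derivative s') (at t within {0..T}) \<and> strain_rates C ((\<lambda>\<tau>. \<tau> - \<sigma>t t) ` \<Sigma>) U (y t) y' s' \<noteq> {}"
    using AE
  proof eventually_elim
    case (elim t)
    then show ?case using rates within by blast
  qed
  have unique: "\<forall>z. W1inf T z \<and> sweeping_solution C T \<C> (\<sigma>0 - \<sigma>t 0) z \<longrightarrow> (\<forall>t\<in>{0..T}. z t = y t)"
    using sweeping_solution_unique[OF data _ _ W sol] by blast
  show ?thesis
    using \<C>_properties[OF data] W sol unique nonempty strain by blast
qed

end
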